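(* Let $\Omega$ be a biased expansion of a finite $2$-connected graph $\Delta$ with at least four nodes. If every expansion minor of $\Omega$ of order four is a group expansion, then $\Omega$ is a group expansion.
   Context: A biased graph is a graph with a set of circles, called balanced, such that no theta subgraph contains exactly two balanced circles. A biased expansion of $\Delta$ is a biased graph $\Omega$ with surjective $p:\|\Omega\|\to\Delta$, identity on nodes, no balanced digon in any fiber, and the circle lifting property (for every circle $e_1\cdots e_l$ of $\Delta$ and any $\tilde e_i\in p^{-1}(e_i)$, $i<l$, exactly one $\tilde e_l\in p^{-1}(e_l)$ makes $\tilde e_1\cdots\tilde e_l$ balanced). For a group $G$, $\langle G\Delta\rangle$ has an edge $ge$ for each $g\in G$, $e\in E(\Delta)$, of gain $g$ along a fixed orientation of $e$, and a circle is balanced iff its gain product is $1$; a group expansion is a biased expansion isomorphic (compatibly with projection) to some $\langle G\Delta'\rangle$ of its base graph $\Delta'$. Expansion minor: choose a partition $E(\Delta)=S\cup T\cup D$ (parts possibly empty) and a balanced lift $\tilde T$ of $T$ (one edge of $\Omega$ over each edge of $T$, containing no unbalanced circle); delete $p^{-1}(D)$, contract $\tilde T$ (identify endpoints of its edges and delete them), delete the remaining edges of $p^{-1}(T)$ (now loops), and delete any subset of isolated nodes. A circle $\tilde C$ of the result is balanced iff there is a balanced circle $\tilde D$ of $\Omega$ with $\tilde D\subseteq\tilde C\cup\tilde T$ and $\tilde D\setminus\tilde T=\tilde C$; the projection is the restriction of $p$, making the result a biased expansion of the corresponding minor of $\Delta$. Its order is its number of nodes. *)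

theory Defs
  imports "HOL-Algebra.Group"
begin

text \<open>
  Graphs are undirected and may have loops and multiple edges; they may be infinite.
  An edge with a single endpoint is a loop.
\<close>

record ('v, 'e) multigraph =
  nodes :: "'v set"
  edges :: "'e set"
  ends :: "'e \<Rightarrow> 'v set"

definition wf_multigraph :: "('v, 'e, 'm) multigraph_scheme \<Rightarrow> bool" where
  "wf_multigraph \<Gamma> \<longleftrightarrow>
     (\<forall>e\<in>edges \<Gamma>. \<exists>u\<in>nodes \<Gamma>. \<exists>v\<in>nodes \<Gamma>. ends \<Gamma> e = {u, v})"

definition adjacent_via :: "('v, 'e, 'm) multigraph_scheme \<Rightarrow> 'e set \<Rightarrow> ('v \<times> 'v) set" where
  "adjacent_via \<Gamma> A = {(u, v). \<exists>e\<in>A. ends \<Gamma> e = {u, v}}"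

definition connected_graph :: "('v, 'e, 'm) multigraph_scheme \<Rightarrow> bool" where
  "connected_graph \<Gamma> \<longleftrightarrow>
     nodes \<Gamma> \<noteq> {} \<and>
     (\<forall>u\<in>nodes \<Gamma>. \<forall>v\<in>nodes \<Gamma>. (u, v) \<in> (adjacent_via \<Gamma> (edges \<Gamma>))\<^sup>*)"

definition delete_node :: "('v, 'e) multigraph \<Rightarrow> 'v \<Rightarrow> ('v, 'e) multigraph" where
  "delete_node \<Gamma> v =
     \<lparr>nodes = nodes \<Gamma> - {v}, edges = {e \<in> edges \<Gamma>. v \<notin> ends \<Gamma> e}, ends = ends \<Gamma>\<rparr>"

text \<open>Node connectivity of a finite graph; loops and parallel edges have no influence on it.\<close>

definition two_connected :: "('v, 'e) multigraph \<Rightarrow> bool" where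
  "two_connected \<Gamma> \<longleftrightarrow>
     card (nodes \<Gamma>) \<ge> 3 \<and> connected_graph \<Gamma> \<and>
     (\<forall>v\<in>nodes \<Gamma>. connected_graph (delete_node \<Gamma> v))"

definition isolated_node :: "('v, 'e, 'm) multigraph_scheme \<Rightarrow> 'v \<Rightarrow> bool" where
  "isolated_node \<Gamma> v \<longleftrightarrow> v \<in> nodes \<Gamma> \<and> (\<forall>e\<in>edges \<Gamma>. v \<notin> ends \<Gamma> e)"

text \<open>
  A traversal of a circle: edge number \<open>i\<close> leads from node number \<open>i\<close> to the cyclically next
  node. Length one is a loop, length two a digon.
\<close>

definition circle_traversal ::
    "('v, 'e, 'm) multigraph_scheme \<Rightarrow> 'v list \<Rightarrow> 'e list \<Rightarrow> bool" where
  "circle_traversal \<Gamma> vs es \<longleftrightarrow>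
     es \<noteq> [] \<and> length vs = length es \<and> distinct vs \<and> distinct es \<and>
     set vs \<subseteq> nodes \<Gamma> \<and> set es \<subseteq> edges \<Gamma> \<and>
     (\<forall>i<length es. ends \<Gamma> (es ! i) = {vs ! i, vs ! (Suc i mod length es)})"

definition circles :: "('v, 'e, 'm) multigraph_scheme \<Rightarrow> 'e set set" where
  "circles \<Gamma> = {set es | vs es. circle_traversal \<Gamma> vs es}"

definition path_between ::
    "('v, 'e, 'm) multigraph_scheme \<Rightarrow> 'v \<Rightarrow> 'v list \<Rightarrow> 'e list \<Rightarrow> 'v \<Rightarrow> bool" where
  "path_between \<Gamma> u vs es w \<longleftrightarrow>
     length vs = Suc (length es) \<and> distinct vs \<and> hd vs = u \<and> last vs = w \<and>
     set vs \<subseteq> nodes \<Gamma> \<and> set es \<subseteq> edges \<Gamma> \<and>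
     (\<forall>i<length es. ends \<Gamma> (es ! i) = {vs ! i, vs ! Suc i})"

text \<open>
  A theta graph is the union of three internally disjoint paths joining the same two distinct
  nodes; subgraphs without isolated nodes are identified with their edge sets.
\<close>

definition theta :: "('v, 'e, 'm) multigraph_scheme \<Rightarrow> 'e set \<Rightarrow> bool" where
  "theta \<Gamma> H \<longleftrightarrow>
     (\<exists>u w vs1 es1 vs2 es2 vs3 es3.
        u \<noteq> w \<and>
        path_between \<Gamma> u vs1 es1 w \<and> path_between \<Gamma> u vs2 es2 w \<and> path_between \<Gamma> u vs3 es3 w \<and>
        set vs1 \<inter> set vs2 = {u, w} \<and> set vs1 \<inter> set vs3 = {u, w} \<and> set vs2 \<inter> set vs3 = {u, w} \<and>
        set es1 \<inter> set es2 = {} \<and> set es1 \<inter> set es3 = {} \<and> set es2 \<inter> set es3 = {} \<and>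
        H = set es1 \<union> set es2 \<union> set es3)"

record ('v, 'e) biased_graph = "('v, 'e) multigraph" +
  balanced :: "'e set set"

definition is_biased_graph :: "('v, 'e) biased_graph \<Rightarrow> bool" where
  "is_biased_graph \<Omega> \<longleftrightarrow>
     wf_multigraph \<Omega> \<and> balanced \<Omega> \<subseteq> circles \<Omega> \<and>
     (\<forall>H. theta \<Omega> H \<longrightarrow> card {C \<in> balanced \<Omega>. C \<subseteq> H} \<noteq> 2)"

text \<open>
  The projection is the identity on nodes, so it is given by its map \<open>p\<close> on edges, of which only
  the values on the edges of the biased graph matter.
\<close>

definition circle_lifting ::
    "('v, 'e) biased_graph \<Rightarrow> ('v, 'f) multigraph \<Rightarrow> ('e \<Rightarrow> 'f) \<Rightarrow> bool" where
  "circle_lifting \<Omega> \<Delta> p \<longleftrightarrow>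
     (\<forall>vs es xs. circle_traversal \<Delta> vs es \<and> set xs \<subseteq> edges \<Omega> \<and> map p xs = butlast es \<longrightarrow>
        (\<exists>!x. x \<in> edges \<Omega> \<and> p x = last es \<and> insert x (set xs) \<in> balanced \<Omega>))"

definition biased_expansion ::
    "('v, 'e) biased_graph \<Rightarrow> ('v, 'f) multigraph \<Rightarrow> ('e \<Rightarrow> 'f) \<Rightarrow> bool" where
  "biased_expansion \<Omega> \<Delta> p \<longleftrightarrow>
     is_biased_graph \<Omega> \<and> wf_multigraph \<Delta> \<and>
     nodes \<Omega> = nodes \<Delta> \<and> p ` edges \<Omega> = edges \<Delta> \<and>
     (\<forall>x\<in>edges \<Omega>. ends \<Delta> (p x) = ends \<Omega> x) \<and>
     (\<forall>x y. x \<noteq> y \<and> {x, y} \<in> balanced \<Omega> \<longrightarrow> p x \<noteq> p y) \<and>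
     circle_lifting \<Omega> \<Delta> p"

text \<open>
  A fixed orientation is given by the tail \<open>t e\<close> of each edge. A loop is always traversed in its
  fixed direction; this is harmless because a loop has gain 1 in one direction iff it has gain 1
  in the other.
\<close>

definition orientation :: "('v, 'f) multigraph \<Rightarrow> ('f \<Rightarrow> 'v) \<Rightarrow> bool" where
  "orientation \<Delta> t \<longleftrightarrow> (\<forall>e\<in>edges \<Delta>. t e \<in> ends \<Delta> e)"

definition gain_product ::
    "('g, 'm) monoid_scheme \<Rightarrow> ('f \<Rightarrow> 'v) \<Rightarrow> 'v list \<Rightarrow> ('g \<times> 'f) list \<Rightarrow> 'g" where
  "gain_product G t vs xs =
     foldr (\<lambda>(v, (g, e)) a. (if v = t e then g else inv\<^bsub>G\<^esub> g) \<otimes>\<^bsub>G\<^esub> a) (zip vs xs) \<one>\<^bsub>G\<^esub>"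

text \<open>
  The group expansion of \<open>\<Delta>\<close> by \<open>G\<close>; the edge \<open>(g, e)\<close> projects to \<open>e\<close>. Whether a gain product
  is 1 does not depend on the traversal of the circle, since another starting point or direction
  conjugates or inverts the product.
\<close>

definition gain_expansion ::
    "('g, 'm) monoid_scheme \<Rightarrow> ('v, 'f) multigraph \<Rightarrow> ('f \<Rightarrow> 'v) \<Rightarrow> ('v, 'g \<times> 'f) biased_graph" where
  "gain_expansion G \<Delta> t =
     (let \<Gamma> = \<lparr>nodes = nodes \<Delta>, edges = carrier G \<times> edges \<Delta>, ends = ends \<Delta> \<circ> snd\<rparr>
      in multigraph.extend \<Gamma>
           (biased_graph.fields
              {set xs | vs xs. circle_traversal \<Gamma> vs xs \<and> gain_product G t vs xs = \<one>\<^bsub>G\<^esub>}))"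

definition expansion_iso ::
    "('e \<Rightarrow> 'd) \<Rightarrow> ('v, 'e) biased_graph \<Rightarrow> ('e \<Rightarrow> 'f) \<Rightarrow> ('v, 'd) biased_graph \<Rightarrow> ('d \<Rightarrow> 'f) \<Rightarrow> bool" where
  "expansion_iso \<theta> \<Omega> p \<Omega>' p' \<longleftrightarrow>
     nodes \<Omega> = nodes \<Omega>' \<and> bij_betw \<theta> (edges \<Omega>) (edges \<Omega>') \<and>
     (\<forall>x\<in>edges \<Omega>. ends \<Omega>' (\<theta> x) = ends \<Omega> x \<and> p' (\<theta> x) = p x) \<and>
     (\<forall>C\<in>circles \<Omega>. C \<in> balanced \<Omega> \<longleftrightarrow> \<theta> ` C \<in> balanced \<Omega>')"

text \<open>
  Letting the carrier of the group live in the edge type of \<open>\<Omega>\<close> loses nothing: if \<open>\<Delta>\<close> has an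
  edge, the group is in bijection with its fiber; otherwise the group is irrelevant.
\<close>

definition group_expansion ::
    "('v, 'e) biased_graph \<Rightarrow> ('v, 'f) multigraph \<Rightarrow> ('e \<Rightarrow> 'f) \<Rightarrow> bool" where
  "group_expansion \<Omega> \<Delta> p \<longleftrightarrow>
     biased_expansion \<Omega> \<Delta> p \<and>
     (\<exists>(G :: 'e monoid) t \<theta>.
        group G \<and> orientation \<Delta> t \<and> expansion_iso \<theta> \<Omega> p (gain_expansion G \<Delta> t) snd)"

text \<open>
  The nodes of a contraction by \<open>T\<close> are the node sets of the components of the spanning subgraph
  with edge set \<open>T\<close>. All edges outside \<open>S\<close> and \<open>T\<close> are deleted, as are the nodes in \<open>I\<close>.
\<close>

definition node_class :: "('v, 'e, 'm) multigraph_scheme \<Rightarrow> 'e set \<Rightarrow> 'v \<Rightarrow> 'v set" where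
  "node_class \<Gamma> T v = (adjacent_via \<Gamma> T)\<^sup>* `` {v}"

definition graph_minor ::
    "('v, 'e, 'm) multigraph_scheme \<Rightarrow> 'e set \<Rightarrow> 'e set \<Rightarrow> 'v set set \<Rightarrow> ('v set, 'e) multigraph" where
  "graph_minor \<Gamma> S T I =
     \<lparr>nodes = node_class \<Gamma> T ` nodes \<Gamma> - I,
      edges = S,
      ends = (\<lambda>e. node_class \<Gamma> T ` ends \<Gamma> e)\<rparr>"

definition biased_minor ::
    "('v, 'e) biased_graph \<Rightarrow> 'e set \<Rightarrow> 'e set \<Rightarrow> 'v set set \<Rightarrow> ('v set, 'e) biased_graph" where
  "biased_minor \<Omega> S T I =
     multigraph.extend (graph_minor \<Omega> S T I)
       (biased_graph.fields
          {C \<in> circles (graph_minor \<Omega> S T I).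
             \<exists>B\<in>balanced \<Omega>. B \<subseteq> C \<union> T \<and> B - T = C})"

definition balanced_lift ::
    "('v, 'e) biased_graph \<Rightarrow> ('e \<Rightarrow> 'f) \<Rightarrow> 'f set \<Rightarrow> 'e set \<Rightarrow> bool" where
  "balanced_lift \<Omega> p T T' \<longleftrightarrow>
     T' \<subseteq> edges \<Omega> \<and> bij_betw p T' T \<and> (\<forall>C\<in>circles \<Omega>. C \<subseteq> T' \<longrightarrow> C \<in> balanced \<Omega>)"

text \<open>
  \<open>\<Omega>'\<close> with base graph \<open>\<Delta>'\<close> is an expansion minor of \<open>\<Omega>\<close>, with the same edge projection \<open>p\<close>.
\<close>

definition expansion_minor ::
    "('v, 'e) biased_graph \<Rightarrow> ('v, 'f) multigraph \<Rightarrow> ('e \<Rightarrow> 'f) \<Rightarrow>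
     ('v set, 'e) biased_graph \<Rightarrow> ('v set, 'f) multigraph \<Rightarrow> bool" where
  "expansion_minor \<Omega> \<Delta> p \<Omega>' \<Delta>' \<longleftrightarrow>
     (\<exists>S T D T' I.
        S \<union> T \<union> D = edges \<Delta> \<and> S \<inter> T = {} \<and> S \<inter> D = {} \<and> T \<inter> D = {} \<and>
        balanced_lift \<Omega> p T T' \<and>
        I \<subseteq> {v. isolated_node (graph_minor \<Omega> {x \<in> edges \<Omega>. p x \<in> S} T' {}) v} \<and>
        \<Omega>' = biased_minor \<Omega> {x \<in> edges \<Omega>. p x \<in> S} T' I \<and>
        \<Delta>' = graph_minor \<Delta> S T I)"

end

theory Submission
  imports Defs
begin

text \<open>
  Fix a normal (depth-first) spanning tree. All its fundamental paths are vertical, so the gains of a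
  group expansion can be oriented upwards, and a lift of the tree determines, for each cotree edge
  \<open>f\<close>, the edge over \<open>f\<close> closing a balanced fundamental circle. By the theta property, an expansion is
  a group expansion as soon as the gains describe the balanced fundamental circles: given a potential
  on the nodes, the edges whose gains are its differences form a copy of the base graph in which all
  fundamental circles, hence all circles, are balanced.

  Contracting all but three tree edges gives minors of order four, so any three tree edges carry
  compatible gains in some group. Whether two pairs of edges over a tree edge and its parent edge are
  exchangeable is a property of these two tree edges only, and it determines the group operation that
  they carry. Minors containing two such pairs identify the two groups, and since these pairs form a
  tree themselves (the tree being normal and the base graph 2-connected), there is no monodromy and
  one group serves for the whole tree. Finally, exchanging neighbouring edges along a vertical path
  moves all gains to its lowest edge, so each fundamental circle is governed by a product of gains.
\<close>


section \<open>Normal spanning trees\<close>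

text \<open>The groups of different minors are unrelated a priori, and within one minor the gains
  may be altered by automorphisms and by translations at the nodes. What survives is the relation
  \<open>\<psi>b y \<otimes> \<psi>a x = \<psi>b y' \<otimes> \<psi>a x'\<close> on pairs of edges,
  which closing edges of circles detect directly. The number four enters through the third tree
  edge: two tree edges carry the relation, and the third is free either to be changed, which shows
  that the relation ignores the rest of the lift, or to form a second pair with one of the two,
  which makes the operations induced on the common tree edge agree. Potentials replace products
  along paths: gains \<open>inv (h x) \<otimes> h (par x)\<close> telescope, and changing
  \<open>h\<close> at one inner node exchanges two neighbouring edges. 2-connectedness acts twice,
  both times by deleting \<open>par b\<close>: it supplies a circle through each tree edge and its
  parent edge, without which there would be nothing to exchange, and it leaves the root with a
  single child, so that all pairs hang from one tree edge.\<close>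

definition parent_rel :: "'v set \<Rightarrow> 'v \<Rightarrow> ('v \<Rightarrow> 'v) \<Rightarrow> ('v \<times> 'v) set" where
  "parent_rel V r par = {(x, par x) | x. x \<in> V - {r}}"

text \<open>The depth is part of the data: it drives the inductions up and down the tree and
  excludes cycles of parents. The value of \<open>par\<close> at the root is arbitrary.\<close>

locale rooted_tree =
  fixes V :: "'v set" and r :: 'v and par :: "'v \<Rightarrow> 'v" and dep :: "'v \<Rightarrow> nat"
  assumes root_in: "r \<in> V"
    and dep_root: "dep r = 0"
    and par_in: "x \<in> V - {r} \<Longrightarrow> par x \<in> V"
    and dep_par: "x \<in> V - {r} \<Longrightarrow> dep x = Suc (dep (par x))"
begin

abbreviation P where "P \<equiv> parent_rel V r par"

lemma P_iff: "(x, y) \<in> P \<longleftrightarrow> x \<in> V - {r} \<and> y = par x"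
  by (auto simp: parent_rel_def)

lemma par_ne: "x \<in> V - {r} \<Longrightarrow> par x \<noteq> x"
  using dep_par by fastforce

lemma single_valued_P: "single_valued P"
  by (auto simp: single_valued_def P_iff)

lemma dep_rtrancl: "(x, y) \<in> P\<^sup>* \<Longrightarrow> dep y \<le> dep x"
  by (induction rule: rtrancl_induct) (simp, use dep_par in \<open>force simp: P_iff\<close>)+

lemma dep_trancl: "(x, y) \<in> P\<^sup>+ \<Longrightarrow> dep y < dep x"
  by (induction rule: trancl_induct) (use dep_par in \<open>force simp: P_iff\<close>)+

lemma antisym_P: "(x, y) \<in> P\<^sup>* \<Longrightarrow> (y, x) \<in> P\<^sup>* \<Longrightarrow> x = y"
  using dep_rtrancl[of y x] dep_trancl[of x y] rtranclD[of x y P] by fastforce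

lemma linear_P: "(x, y) \<in> P\<^sup>* \<Longrightarrow> (x, z) \<in> P\<^sup>* \<Longrightarrow> (y, z) \<in> P\<^sup>* \<or> (z, y) \<in> P\<^sup>*"
  by (rule single_valued_confluent[OF single_valued_P])

lemma reaches_root: "x \<in> V \<Longrightarrow> (x, r) \<in> P\<^sup>*"
proof (induction "dep x" arbitrary: x rule: less_induct)
  case less
  show ?case
  proof (cases "x = r")
    case False
    then have "(par x, r) \<in> P\<^sup>*"
      using less by (simp add: par_in dep_par)
    then show ?thesis
      using False less.prems by (meson DiffI P_iff converse_rtrancl_into_rtrancl singletonD)
  qed simp
qed

lemma step_up: "(x, y) \<in> P\<^sup>* \<Longrightarrow> x \<noteq> y \<Longrightarrow> x \<in> V - {r} \<and> (par x, y) \<in> P\<^sup>*"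
  by (erule converse_rtranclE) (auto simp: P_iff)

lemma trancl_iff: "(x, y) \<in> P\<^sup>+ \<longleftrightarrow> x \<in> V - {r} \<and> (par x, y) \<in> P\<^sup>*"
  by (auto simp: P_iff dest!: tranclD intro: rtrancl_into_trancl2)

lemma root_top: "(r, y) \<in> P\<^sup>* \<longleftrightarrow> y = r"
  using step_up by blast

lemma trancl_neq: "(x, y) \<in> P\<^sup>+ \<Longrightarrow> x \<noteq> y"
  using dep_trancl by blast

end

text \<open>The tree order has ancestors on the right: a pair in the reflexive transitive closure of
  \<open>parent_rel\<close> consists of a node and one of its ancestors.\<close>

definition normal_tree where
  "normal_tree E X r par dep \<longleftrightarrow> rooted_tree X r par dep \<and> (\<forall>x\<in>X - {r}. (x, par x) \<in> E) \<and>
    (\<forall>x\<in>X. \<forall>y\<in>X. (x, y) \<in> E \<longrightarrow> (x, y) \<in> (parent_rel X r par)\<^sup>* \<or> (y, x) \<in> (parent_rel X r par)\<^sup>*)"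

text \<open>Depth-first search as an induction: once \<open>r\<close> is removed, no edge joins
  different components, so each component gets a normal tree rooted at a neighbour of
  \<open>r\<close>, and these trees are hung below \<open>r\<close>. Ends of edges inside a
  component are comparable by induction, and \<open>r\<close> is above everything.\<close>

lemma normal_tree_exists:
  fixes E :: "('v \<times> 'v) set"
  assumes "finite X" "r \<in> X" "sym E" "\<And>x. x \<in> X \<Longrightarrow> (r, x) \<in> (E \<inter> X \<times> X)\<^sup>*"
  shows "\<exists>par dep. normal_tree E X r par dep"
  using assms(1,2,4)
proof (induction "card X" arbitrary: X r rule: less_induct)
  case less
  define F where "F = E \<inter> (X - {r}) \<times> (X - {r})"
  have symF: "sym (F\<^sup>*)"
    using \<open>sym E\<close> by (intro sym_rtrancl) (auto simp: F_def sym_def)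
  define comp where "comp x = F\<^sup>* `` {x}" for x
  have comp_eq: "comp x = comp y" if "(x, y) \<in> F\<^sup>*" for x y
    using that symF by (auto simp: comp_def sym_def) (meson rtrancl_trans symD symF)+
  have mem: "y \<in> comp x \<longleftrightarrow> (x, y) \<in> F\<^sup>*" for x y by (simp add: comp_def)
  have self: "x \<in> comp x" for x by (simp add: comp_def)
  have compX: "comp x \<subseteq> X - {r}" if "x \<in> X - {r}" for x
  proof
    fix y assume "y \<in> comp x"
    then have "(x, y) \<in> F\<^sup>*" by (simp add: comp_def)
    then show "y \<in> X - {r}"
      by (induction rule: rtrancl_induct) (use that in \<open>auto simp: F_def\<close>)
  qed
  \<comment> \<open>A walk from \<open>r\<close>, cut at its last visit to \<open>r\<close>, enters
    the component of its end at a neighbour of \<open>r\<close>; such a neighbour will be the root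
    of the component.\<close>
  have reach: "x = r \<or> (\<exists>c\<in>X - {r}. (r, c) \<in> E \<and> (c, x) \<in> F\<^sup>*)" if "x \<in> X" for x
    using less.prems(3)[OF that]
  proof (induction rule: rtrancl_induct)
    case (step y z)
    show ?case
    proof (cases "z = r \<or> y = r")
      case True
      then show ?thesis using step by auto
    next
      case False
      then show ?thesis using step by (auto simp: F_def intro: rtrancl_into_rtrancl)
    qed
  qed simp
  define Q where "Q C c par dep \<longleftrightarrow> c \<in> C \<and> (r, c) \<in> E \<and> normal_tree E C c par dep"
    for C c and par :: "'v \<Rightarrow> 'v" and dep :: "'v \<Rightarrow> nat"
  have "\<exists>c par dep. Q C c par dep"
    if "C \<in> comp ` (X - {r})" for C
  proof -
    obtain x where x: "x \<in> X - {r}" "C = comp x" using \<open>C \<in> _\<close> by auto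
    obtain c where c: "c \<in> X - {r}" "(r, c) \<in> E" "(c, x) \<in> F\<^sup>*" using reach x by auto
    have C: "C = comp c" using comp_eq[OF c(3)] x by simp
    have sub: "C \<subseteq> X - {r}" using compX c C by simp
    have lt: "card C < card X"
      using sub less.prems(1,2) by (intro psubset_card_mono) auto
    have conn: "(c, y) \<in> (E \<inter> C \<times> C)\<^sup>*" if "y \<in> C" for y
    proof -
      have "(c, y) \<in> F\<^sup>*" using that C by (simp add: comp_def)
      then show ?thesis
      proof (induction rule: rtrancl_induct)
        case (step y z)
        have "(y, z) \<in> E \<inter> C \<times> C"
          using step(1,2) unfolding C comp_def F_def[symmetric] by (auto simp: F_def intro: rtrancl_into_rtrancl)
        then show ?case using step.IH by (rule rtrancl_into_rtrancl[rotated])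
      qed simp
    qed
    have "c \<in> C" "finite C"
      using self[of c] C finite_subset[OF sub] less.prems(1) by auto
    have "\<exists>par dep. normal_tree E C c par dep"
      by (rule less.hyps[OF lt]) (fact \<open>finite C\<close> \<open>c \<in> C\<close> conn)+
    then show ?thesis using c(2) \<open>c \<in> C\<close> unfolding Q_def by blast
  qed
  \<comment> \<open>The choice is indexed by components, so that all nodes of one component use the
    same tree.\<close>
  then obtain c pr dp where Q: "\<And>C. C \<in> comp ` (X - {r}) \<Longrightarrow> Q C (c C) (pr C) (dp C)"
    by metis
  have Qx: "Q (comp x) (c (comp x)) (pr (comp x)) (dp (comp x))" if "x \<in> X - {r}" for x
    using Q that by blast
  have rt: "rooted_tree (comp x) (c (comp x)) (pr (comp x)) (dp (comp x))" if "x \<in> X - {r}" for x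
    using Qx[OF that] unfolding Q_def normal_tree_def by (elim conjE)
  define par where "par x = (if x = c (comp x) then r else pr (comp x) x)" for x
  define dep where "dep x = (if x = r then 0 else Suc (dp (comp x) x))" for x
  have inC: "pr (comp x) x \<in> comp x \<and> comp (pr (comp x) x) = comp x \<and>
      dp (comp x) x = Suc (dp (comp x) (pr (comp x) x)) \<and> pr (comp x) x \<in> X - {r}"
    if "x \<in> X - {r}" "x \<noteq> c (comp x)" for x
  proof -
    note rt = rt[OF that(1)]
    have 1: "x \<in> comp x - {c (comp x)}" using self that by auto
    have 2: "pr (comp x) x \<in> comp x" using rooted_tree.par_in[OF rt 1] .
    have "comp (pr (comp x) x) = comp x"
      using comp_eq[of x "pr (comp x) x"] 2 unfolding mem by simp
    then show ?thesis
      using rooted_tree.dep_par[OF rt 1] compX[OF that(1)] 2 by blast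
  qed
  have root0: "dp (comp x) (c (comp x)) = 0" if "x \<in> X - {r}" for x
    using rooted_tree.dep_root[OF rt[OF that]] .
  interpret T: rooted_tree X r par dep
  proof
    show "r \<in> X" by fact
    show "dep r = 0" by (simp add: dep_def)
    show "par x \<in> X" if "x \<in> X - {r}" for x
      using inC[OF that] \<open>r \<in> X\<close> by (auto simp: par_def)
    show "dep x = Suc (dep (par x))" if "x \<in> X - {r}" for x
      using inC[OF that] that root0[OF that] by (auto simp: par_def dep_def)
  qed
  have "(x, par x) \<in> E" if "x \<in> X - {r}" for x
  proof (cases "c (comp x) = x")
    case True
    have "(r, c (comp x)) \<in> E" using Qx[OF that] unfolding Q_def normal_tree_def by (elim conjE)
    with True show ?thesis using symD[OF \<open>sym E\<close>] by (simp add: par_def)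
  next
    case False
    have "\<forall>y\<in>comp x - {c (comp x)}. (y, pr (comp x) y) \<in> E" using Qx[OF that] unfolding Q_def normal_tree_def by (elim conjE)
    with False self[of x] show ?thesis by (auto simp: par_def)
  qed
  moreover have "(x, y) \<in> (parent_rel X r par)\<^sup>* \<or> (y, x) \<in> (parent_rel X r par)\<^sup>*"
    if xy: "x \<in> X" "y \<in> X" "(x, y) \<in> E" for x y
  proof (cases "x = r \<or> y = r")
    case True
    then show ?thesis using T.reaches_root xy by auto
  next
    case False
    let ?C = "comp x"
    have "(x, y) \<in> F" using xy False by (simp add: F_def)
    then have y: "y \<in> ?C" unfolding mem by blast
    have xX: "x \<in> X - {r}" using xy False by simp
    have "parent_rel ?C (c ?C) (pr ?C) \<subseteq> parent_rel X r par"
    proof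
      fix q assume "q \<in> parent_rel ?C (c ?C) (pr ?C)"
      then obtain z where z: "z \<in> ?C" "z \<noteq> c ?C" "q = (z, pr ?C z)" by (auto simp: parent_rel_def)
      have "comp z = ?C" using comp_eq[of x z] z(1) by (simp add: mem)
      then show "q \<in> parent_rel X r par" using z compX[OF xX] by (auto simp: parent_rel_def par_def)
    qed
    note mono = rtrancl_mono[OF this]
    have normal: "\<forall>u\<in>?C. \<forall>v\<in>?C. (u, v) \<in> E \<longrightarrow>
        (u, v) \<in> (parent_rel ?C (c ?C) (pr ?C))\<^sup>* \<or> (v, u) \<in> (parent_rel ?C (c ?C) (pr ?C))\<^sup>*"
      using Qx[OF xX] unfolding Q_def normal_tree_def by (elim conjE)
    have "(x, y) \<in> (parent_rel ?C (c ?C) (pr ?C))\<^sup>* \<or> (y, x) \<in> (parent_rel ?C (c ?C) (pr ?C))\<^sup>*"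
      by (rule normal[rule_format, OF self y xy(3)])
    then show ?thesis using mono by blast
  qed
  ultimately show ?case unfolding normal_tree_def using T.rooted_tree_axioms by blast
qed

section \<open>What 2-connectedness says about a normal tree\<close>

lemma crossing_step:
  assumes "(x, y) \<in> R\<^sup>*" "x \<in> D" "y \<notin> D"
  obtains u v where "(u, v) \<in> R" "u \<in> D" "v \<notin> D"
  using assms by (induction rule: rtrancl_induct) auto

lemma sym_adjacent_via: "sym (adjacent_via \<Gamma> A)"
  by (auto simp: sym_def adjacent_via_def insert_commute)

text \<open>After deletion of \<open>par b\<close> a path still joins \<open>b\<close> to
  \<open>z\<close>, and it must leave the set of descendants of \<open>b\<close>. By normality the
  edge along which it leaves ends at an ancestor of \<open>b\<close> other than
  \<open>par b\<close>, hence strictly above \<open>par b\<close>. The node \<open>z\<close> only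
  witnesses that the subtree of \<open>b\<close> and \<open>par b\<close> are not
  everything.\<close>

lemma (in rooted_tree) two_connected_bypass:
  fixes \<Delta> :: "('v, 'f) multigraph"
  assumes V: "V = nodes \<Delta>" and "two_connected \<Delta>"
    and normal: "\<And>x y. (x, y) \<in> adjacent_via \<Delta> (edges \<Delta>) \<Longrightarrow> (x, y) \<in> P\<^sup>* \<or> (y, x) \<in> P\<^sup>*"
    and b: "b \<in> V - {r}" and z: "z \<in> V" "(z, b) \<notin> P\<^sup>*" "z \<noteq> par b"
  shows "\<exists>f\<in>edges \<Delta>. \<exists>u v. ends \<Delta> f = {u, v} \<and> (v, b) \<in> P\<^sup>* \<and> (par b, u) \<in> P\<^sup>+"
proof -
  let ?D = "delete_node \<Delta> (par b)"
  have "connected_graph ?D"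
    using \<open>two_connected \<Delta>\<close> par_in[OF b] V by (auto simp: two_connected_def)
  moreover have "b \<in> nodes ?D" "z \<in> nodes ?D"
    using b z V par_ne[OF b] by (auto simp: delete_node_def)
  ultimately have "(b, z) \<in> (adjacent_via ?D (edges ?D))\<^sup>*"
    by (auto simp: connected_graph_def)
  then obtain x y where xy: "(x, y) \<in> adjacent_via ?D (edges ?D)" "(x, b) \<in> P\<^sup>*" "(y, b) \<notin> P\<^sup>*"
    using crossing_step[of b z _ "{x. (x, b) \<in> P\<^sup>*}"] z by blast
  then obtain f where f: "f \<in> edges \<Delta>" "ends \<Delta> f = {x, y}" "y \<noteq> par b"
    by (auto simp: adjacent_via_def delete_node_def)
  have "(x, y) \<in> P\<^sup>* \<or> (y, x) \<in> P\<^sup>*"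
    using f by (intro normal) (auto simp: adjacent_via_def)
  then have "(x, y) \<in> P\<^sup>*" using xy by (meson rtrancl_trans)
  then have "(b, y) \<in> P\<^sup>*" using linear_P xy by blast
  then have "(par b, y) \<in> P\<^sup>*" using step_up xy by blast
  then have "(par b, y) \<in> P\<^sup>+" using f(3) by (simp add: rtrancl_eq_or_trancl)
  then show ?thesis using f xy by blast
qed

section \<open>Circles and theta graphs\<close>

lemma circle_rotate:
  assumes "circle_traversal \<Gamma> vs es"
  shows "circle_traversal \<Gamma> (rotate n vs) (rotate n es)"
proof -
  have len: "length vs = length es" and ne: "es \<noteq> []"
    and e: "\<And>i. i < length es \<Longrightarrow> ends \<Gamma> (es ! i) = {vs ! i, vs ! (Suc i mod length es)}"
    using assms by (auto simp: circle_traversal_def)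
  have "ends \<Gamma> (rotate n es ! i) = {rotate n vs ! i, rotate n vs ! (Suc i mod length es)}"
    if i: "i < length es" for i
  proof -
    have lt: "(n + i) mod length es < length es" "Suc i mod length es < length es"
      using ne by simp_all
    have "Suc ((n + i) mod length es) mod length es = (n + Suc i mod length es) mod length es"
      by (simp add: mod_simps)
    then show ?thesis
      using i len lt e[OF lt(1)] by (simp add: nth_rotate)
  qed
  then show ?thesis using assms by (simp add: circle_traversal_def)
qed

text \<open>Circle lifting singles out the last edge of a traversal; by rotation every edge of the
  circle can take this place.\<close>

lemma circle_with_last:
  assumes "C \<in> circles \<Gamma>" "e \<in> C"
  obtains vs es where "circle_traversal \<Gamma> vs es" "set es = C" "last es = e"
proof -
  obtain vs es where c: "circle_traversal \<Gamma> vs es" "set es = C"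
    using assms by (auto simp: circles_def)
  then obtain i where i: "i < length es" "es ! i = e"
    using assms by (metis in_set_conv_nth)
  then have "es \<noteq> []" "Suc i + (length es - 1) = i + length es" by auto
  then have "last (rotate (Suc i) es) = e"
    using i by (simp del: rotate_Suc add: last_conv_nth nth_rotate)
  then show ?thesis using that circle_rotate[OF c(1)] c(2) by (metis set_rotate)
qed

text \<open>Lower half of the fact that nodes of a circle have degree two;
  \<open>circle_degree\<close> is the upper half. Both speak of edge sets, so that later arguments
  can follow a circle without its traversal.\<close>

lemma circle_other_edge:
  assumes "C \<in> circles \<Gamma>" "e \<in> C" "ends \<Gamma> e = {y, z}" "y \<noteq> z"
  shows "\<exists>e'\<in>C. e' \<noteq> e \<and> y \<in> ends \<Gamma> e'"
proof -
  obtain vs es where c: "circle_traversal \<Gamma> vs es" "set es = C" "last es = e"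
    using circle_with_last[OF assms(1,2)] .
  define l where "l = length es"
  have len: "length vs = l" and ne: "es \<noteq> []" and dist: "distinct es"
    and e: "\<And>i. i < l \<Longrightarrow> ends \<Gamma> (es ! i) = {vs ! i, vs ! (Suc i mod l)}"
    using c(1) by (auto simp: circle_traversal_def l_def)
  have last: "es ! (l - 1) = e" using c(3) ne by (simp add: last_conv_nth l_def)
  have "l \<noteq> 1"
    using e[of 0] last assms(3,4) by auto
  then have l: "2 \<le> l" using ne by (cases l) (auto simp: l_def)
  then have "Suc (l - 1) mod l = 0" by simp
  then have "{y, z} = {vs ! (l - 1), vs ! 0}"
    using e[of "l - 1"] last l assms(3) by simp
  then consider "y = vs ! 0" | "y = vs ! (l - 1)" by (auto simp: doubleton_eq_iff)
  then obtain i where "i < l - 1" "y \<in> ends \<Gamma> (es ! i)"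
  proof cases
    case 1
    then show ?thesis using that[of 0] e[of 0] l by auto
  next
    case 2
    have "Suc (l - 2) = l - 1" using l by simp
    then show ?thesis using that[of "l - 2"] e[of "l - 2"] l 2 by auto
  qed
  moreover have "es ! i \<noteq> e" using dist last \<open>i < l - 1\<close> nth_eq_iff_index_eq[OF dist, of i "l - 1"]
    by (auto simp: l_def)
  ultimately show ?thesis using c(2) by (intro bexI[of _ "es ! i"]) (auto simp: l_def)
qed

text \<open>The node in position \<open>k\<close> is met only by the edges in position
  \<open>k\<close> and in the cyclically preceding one.\<close>

lemma circle_degree:
  assumes "C \<in> circles \<Gamma>" "{e1, e2, e3} \<subseteq> C" "y \<in> ends \<Gamma> e1" "y \<in> ends \<Gamma> e2" "y \<in> ends \<Gamma> e3"
    "e1 \<noteq> e2" "e1 \<noteq> e3"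
  shows "e2 = e3"
proof (rule ccontr)
  assume "e2 \<noteq> e3"
  obtain vs es where c: "circle_traversal \<Gamma> vs es" "set es = C"
    using assms by (auto simp: circles_def)
  define l where "l = length es"
  have len: "length vs = l" and dist: "distinct vs"
    and e: "\<And>i. i < l \<Longrightarrow> ends \<Gamma> (es ! i) = {vs ! i, vs ! (Suc i mod l)}"
    using c(1) by (auto simp: circle_traversal_def l_def)
  have idx: "\<exists>i<l. es ! i = e" if "e \<in> {e1, e2, e3}" for e
    using that assms(2) c(2) by (metis in_set_conv_nth l_def subsetD)
  obtain i1 where i1: "i1 < l" "es ! i1 = e1" using idx by auto
  obtain i2 where i2: "i2 < l" "es ! i2 = e2" using idx by auto
  obtain i3 where i3: "i3 < l" "es ! i3 = e3" using idx by auto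
  have ne: "i1 \<noteq> i2" "i1 \<noteq> i3" "i2 \<noteq> i3" using assms \<open>e2 \<noteq> e3\<close> i1 i2 i3 by auto
  have "\<exists>k<l. y = vs ! k" using assms(3) e[OF i1(1)] i1 by (auto intro: exI[of _ "Suc i1 mod l"])
  then obtain k where k: "k < l" "y = vs ! k" by blast
  have inc: "i = k \<or> Suc i mod l = k" if "i < l" "y \<in> ends \<Gamma> (es ! i)" for i
  proof -
    have "Suc i mod l < l" using that by simp
    then show ?thesis
      using that e[OF that(1)] k dist len by (auto simp: nth_eq_iff_index_eq)
  qed
  have inj: "i = j" if "i < l" "j < l" "Suc i mod l = Suc j mod l" for i j
    using that by (auto simp: mod_Suc split: if_splits)
  show False
    using inc[OF i1(1)] inc[OF i2(1)] inc[OF i3(1)] assms(3-5) i1 i2 i3 ne inj by metis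
qed

section \<open>Paths and the three circles of a theta graph\<close>

lemma path_edge_ends:
  assumes "path_between \<Gamma> u vs es w" "e \<in> set es"
  shows "ends \<Gamma> e \<subseteq> set vs"
proof -
  obtain i where i: "i < length es" "e = es ! i" using assms(2) by (auto simp: in_set_conv_nth)
  then have "ends \<Gamma> e = {vs ! i, vs ! Suc i}" "Suc i < length vs"
    using assms(1) by (auto simp: path_between_def)
  then show ?thesis by (auto intro: nth_mem)
qed

lemma path_nth_0: "path_between \<Gamma> u vs es w \<Longrightarrow> vs ! 0 = u"
  by (cases vs) (auto simp: path_between_def)

lemma path_nth_last: "path_between \<Gamma> u vs es w \<Longrightarrow> vs ! length es = w"
  by (cases "vs = []") (auto simp: path_between_def last_conv_nth)

lemma path_distinct_edges:
  assumes "path_between \<Gamma> u vs es w"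
  shows "distinct es"
  unfolding distinct_conv_nth
proof (intro allI impI)
  fix i j assume ij: "i < length es" "j < length es" "i \<noteq> j"
  have "length vs = Suc (length es)" "distinct vs"
    and e: "\<And>i. i < length es \<Longrightarrow> ends \<Gamma> (es ! i) = {vs ! i, vs ! Suc i}"
    using assms by (auto simp: path_between_def)
  then have "{vs ! i, vs ! Suc i} \<noteq> {vs ! j, vs ! Suc j}"
    using ij by (auto simp: doubleton_eq_iff nth_eq_iff_index_eq)
  then show "es ! i \<noteq> es ! j" using e ij by metis
qed

lemma path_start_edge:
  assumes "path_between \<Gamma> u vs es w" "u \<noteq> w"
  obtains e z where "e \<in> set es" "ends \<Gamma> e = {u, z}" "u \<noteq> z"
    "\<And>e'. e' \<in> set es \<Longrightarrow> u \<in> ends \<Gamma> e' \<Longrightarrow> e' = e"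
proof -
  have len: "length vs = Suc (length es)" and dist: "distinct vs"
    and e: "\<And>i. i < length es \<Longrightarrow> ends \<Gamma> (es ! i) = {vs ! i, vs ! Suc i}"
    using assms(1) by (auto simp: path_between_def)
  have u: "vs ! 0 = u" using path_nth_0[OF assms(1)] .
  have ne: "0 < length es" using assms u path_nth_last[OF assms(1)] by (cases es) auto
  have eq: "vs ! i = u \<longleftrightarrow> i = 0" if "i \<le> length es" for i
    using that u dist len nth_eq_iff_index_eq[of vs i 0] by simp
  have uniq: "e' = es ! 0" if "e' \<in> set es" "u \<in> ends \<Gamma> e'" for e'
  proof -
    obtain i where i: "i < length es" "e' = es ! i" using \<open>e' \<in> set es\<close> by (auto simp: in_set_conv_nth)
    then have "u = vs ! i \<or> u = vs ! Suc i" using that(2) e by auto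
    then have "i = 0" using eq[of i] eq[of "Suc i"] i by auto
    then show ?thesis using i by simp
  qed
  have un: "u \<noteq> vs ! 1" using eq[of 1] ne by auto
  have en: "ends \<Gamma> (es ! 0) = {u, vs ! 1}" using e[OF ne] u by simp
  show ?thesis by (rule that[OF nth_mem[OF ne] en un uniq])
qed

text \<open>At an inner node of the path the only edges available to \<open>C\<close> are the two
  path edges there. A circle using one of them uses the other, so membership spreads along the whole
  path.\<close>

lemma circle_path_all_or_none:
  assumes p: "path_between \<Gamma> u vs es w" and C: "C \<in> circles \<Gamma>" "C \<subseteq> set es \<union> X"
    and X: "\<And>e. e \<in> X \<Longrightarrow> ends \<Gamma> e \<inter> set vs \<subseteq> {u, w}" and "set es \<inter> C \<noteq> {}"
  shows "set es \<subseteq> C"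
proof -
  define n where "n = length es"
  have len: "length vs = Suc n" and dist: "distinct vs"
    and e: "\<And>i. i < n \<Longrightarrow> ends \<Gamma> (es ! i) = {vs ! i, vs ! Suc i}"
    using p by (auto simp: path_between_def n_def)
  have uw: "vs ! 0 = u" "vs ! n = w" using path_nth_0[OF p] path_nth_last[OF p] by (auto simp: n_def)
  have eq: "vs ! i = vs ! j \<longleftrightarrow> i = j" if "i \<le> n" "j \<le> n" for i j
    using that dist len by (simp add: nth_eq_iff_index_eq)
  have inner: "\<exists>j<n. j \<noteq> i \<and> (j = k \<or> Suc j = k) \<and> es ! j \<in> C"
    if h: "i < n" "es ! i \<in> C" "k = i \<or> k = Suc i" "0 < k" "k < n" for i k
  proof -
    obtain z where z: "ends \<Gamma> (es ! i) = {vs ! k, z}" "vs ! k \<noteq> z"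
      using h e[OF h(1)] eq[of i "Suc i"] by (auto simp: insert_commute)
    obtain e' where e': "e' \<in> C" "e' \<noteq> es ! i" "vs ! k \<in> ends \<Gamma> e'"
      using circle_other_edge[OF C(1) h(2) z] by blast
    have "vs ! k \<notin> {u, w}" using uw eq[of k 0] eq[of k n] h by auto
    moreover have "vs ! k \<in> set vs" using h len by simp
    ultimately have "e' \<in> set es" using X[of e'] e' C(2) by auto
    then obtain j where j: "j < n" "es ! j = e'" by (auto simp: in_set_conv_nth n_def)
    have "k = j \<or> k = Suc j"
      using e'(3) e[OF j(1)] j h eq[of k j] eq[of k "Suc j"] by auto
    then show ?thesis using j e' by auto
  qed
  have up: "es ! Suc i \<in> C" if "Suc i < n" "es ! i \<in> C" for i
    using inner[of i "Suc i"] that by auto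
  have down: "es ! i \<in> C" if "Suc i < n" "es ! Suc i \<in> C" for i
    using inner[of "Suc i" "Suc i"] that by auto
  obtain i where i: "i < n" "es ! i \<in> C"
    using assms(5) by (auto simp: in_set_conv_nth n_def)
  have ge: "es ! j \<in> C" if "i \<le> j" "j < n" for j
    using that by (induction j rule: dec_induct) (auto simp: i up)
  have le: "es ! j \<in> C" if "j \<le> i" for j
    using that by (induction j rule: inc_induct) (use i in \<open>auto intro: down\<close>)
  show ?thesis
    using ge le by (auto simp: in_set_conv_nth n_def) (metis nat_le_linear)
qed

text \<open>The circle is a union of whole paths. One path is too little, since \<open>u\<close>
  would have degree one, and three are too many, since \<open>u\<close> would have degree
  three.\<close>

lemma circle_in_theta:
  assumes p: "path_between \<Gamma> u vs1 es1 w" "path_between \<Gamma> u vs2 es2 w" "path_between \<Gamma> u vs3 es3 w"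
    and vs: "set vs1 \<inter> set vs2 = {u, w}" "set vs1 \<inter> set vs3 = {u, w}" "set vs2 \<inter> set vs3 = {u, w}"
    and es: "set es1 \<inter> set es2 = {}" "set es1 \<inter> set es3 = {}" "set es2 \<inter> set es3 = {}"
    and "u \<noteq> w" and C: "C \<in> circles \<Gamma>" "C \<subseteq> set es1 \<union> set es2 \<union> set es3"
  shows "C \<in> {set es1 \<union> set es2, set es1 \<union> set es3, set es2 \<union> set es3}"
proof -
  obtain e1 z1 where e1: "e1 \<in> set es1" "ends \<Gamma> e1 = {u, z1}" "u \<noteq> z1"
    "\<And>e'. e' \<in> set es1 \<Longrightarrow> u \<in> ends \<Gamma> e' \<Longrightarrow> e' = e1"
    using path_start_edge[OF p(1) \<open>u \<noteq> w\<close>] by metis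
  obtain e2 z2 where e2: "e2 \<in> set es2" "ends \<Gamma> e2 = {u, z2}" "u \<noteq> z2"
    "\<And>e'. e' \<in> set es2 \<Longrightarrow> u \<in> ends \<Gamma> e' \<Longrightarrow> e' = e2"
    using path_start_edge[OF p(2) \<open>u \<noteq> w\<close>] by metis
  obtain e3 z3 where e3: "e3 \<in> set es3" "ends \<Gamma> e3 = {u, z3}" "u \<noteq> z3"
    "\<And>e'. e' \<in> set es3 \<Longrightarrow> u \<in> ends \<Gamma> e' \<Longrightarrow> e' = e3"
    using path_start_edge[OF p(3) \<open>u \<noteq> w\<close>] by metis
  have all1: "set es1 \<subseteq> C" if "set es1 \<inter> C \<noteq> {}"
    by (rule circle_path_all_or_none[OF p(1) C(1), of "set es2 \<union> set es3"])
      (use C(2) vs that path_edge_ends[OF p(2)] path_edge_ends[OF p(3)] in blast)+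
  have all2: "set es2 \<subseteq> C" if "set es2 \<inter> C \<noteq> {}"
    by (rule circle_path_all_or_none[OF p(2) C(1), of "set es1 \<union> set es3"])
      (use C(2) vs that path_edge_ends[OF p(1)] path_edge_ends[OF p(3)] in blast)+
  have all3: "set es3 \<subseteq> C" if "set es3 \<inter> C \<noteq> {}"
    by (rule circle_path_all_or_none[OF p(3) C(1), of "set es1 \<union> set es2"])
      (use C(2) vs that path_edge_ends[OF p(1)] path_edge_ends[OF p(2)] in blast)+
  have "C \<noteq> {}" using C(1) by (auto simp: circles_def circle_traversal_def)
  have single: "\<not> C \<subseteq> set es"
    if "e \<in> set es" "ends \<Gamma> e = {u, z}" "u \<noteq> z"
      "\<And>e'. e' \<in> set es \<Longrightarrow> u \<in> ends \<Gamma> e' \<Longrightarrow> e' = e" "set es \<inter> C \<noteq> {} \<Longrightarrow> set es \<subseteq> C" for es e z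
  proof
    assume "C \<subseteq> set es"
    then have "e \<in> C" using that \<open>C \<noteq> {}\<close> by blast
    then show False using circle_other_edge[OF C(1) _ that(2,3)] that(4) \<open>C \<subseteq> set es\<close> by blast
  qed
  note single1 = single[OF e1 all1] and single2 = single[OF e2 all2] and single3 = single[OF e3 all3]
  have "\<not> (set es1 \<subseteq> C \<and> set es2 \<subseteq> C \<and> set es3 \<subseteq> C)"
  proof
    assume "set es1 \<subseteq> C \<and> set es2 \<subseteq> C \<and> set es3 \<subseteq> C"
    then have "{e1, e2, e3} \<subseteq> C" using e1(1) e2(1) e3(1) by blast
    moreover have "e1 \<noteq> e2" "e1 \<noteq> e3" "e2 \<noteq> e3" using e1(1) e2(1) e3(1) es by blast+
    moreover have "u \<in> ends \<Gamma> e1" "u \<in> ends \<Gamma> e2" "u \<in> ends \<Gamma> e3" using e1(2) e2(2) e3(2) by simp_all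
    ultimately show False using circle_degree[OF C(1)] by blast
  qed
  moreover have "set es1 \<subseteq> C \<or> set es1 \<inter> C = {}" "set es2 \<subseteq> C \<or> set es2 \<inter> C = {}"
    "set es3 \<subseteq> C \<or> set es3 \<inter> C = {}" using all1 all2 all3 by blast+
  ultimately show ?thesis using single1 single2 single3 C(2) by (elim disjE) blast+
qed

text \<open>The theta axiom counts balanced circles. By \<open>circle_in_theta\<close> only three
  circles can occur, so if the third one were unbalanced the count would be exactly two.\<close>

lemma biased_theta_third:
  assumes \<Omega>: "is_biased_graph \<Omega>"
    and p: "path_between \<Omega> u vs1 es1 w" "path_between \<Omega> u vs2 es2 w" "path_between \<Omega> u vs3 es3 w"
    and vs: "set vs1 \<inter> set vs2 = {u, w}" "set vs1 \<inter> set vs3 = {u, w}" "set vs2 \<inter> set vs3 = {u, w}"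
    and es: "set es1 \<inter> set es2 = {}" "set es1 \<inter> set es3 = {}" "set es2 \<inter> set es3 = {}"
    and "u \<noteq> w" and bal: "set es1 \<union> set es2 \<in> balanced \<Omega>" "set es1 \<union> set es3 \<in> balanced \<Omega>"
  shows "set es2 \<union> set es3 \<in> balanced \<Omega>"
proof (rule ccontr)
  let ?H = "set es1 \<union> set es2 \<union> set es3"
  assume not: "set es2 \<union> set es3 \<notin> balanced \<Omega>"
  have "theta \<Omega> ?H"
    unfolding theta_def using p vs es \<open>u \<noteq> w\<close> by blast
  then have "card {C \<in> balanced \<Omega>. C \<subseteq> ?H} \<noteq> 2"
    using \<Omega> by (simp add: is_biased_graph_def)
  moreover have "{C \<in> balanced \<Omega>. C \<subseteq> ?H} = {set es1 \<union> set es2, set es1 \<union> set es3}"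
  proof -
    have "balanced \<Omega> \<subseteq> circles \<Omega>" using \<Omega> by (simp add: is_biased_graph_def)
    then show ?thesis
      using circle_in_theta[OF p vs es \<open>u \<noteq> w\<close>] not bal by blast
  qed
  moreover have "set es1 \<union> set es2 \<noteq> set es1 \<union> set es3"
    using path_start_edge[OF p(2) \<open>u \<noteq> w\<close>] es by (metis Int_iff Un_iff empty_iff)
  ultimately show False by simp
qed

section \<open>Joining paths to circles, cutting circles into paths, shortest connections\<close>

lemma set_tl_subset: "set (tl xs) \<subseteq> set xs"
  by (cases xs) auto

lemma circle_of_paths:
  assumes p: "path_between \<Gamma> u vs1 es1 w" "path_between \<Gamma> u vs2 es2 w"
    and vs: "set vs1 \<inter> set vs2 = {u, w}" and es: "set es1 \<inter> set es2 = {}" and "u \<noteq> w"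
  shows "set es1 \<union> set es2 \<in> circles \<Gamma>"
proof -
  define m n where "m = length es1" and "n = length es2"
  have len: "length vs1 = Suc m" "length vs2 = Suc n" and dist: "distinct vs1" "distinct vs2"
    and sub: "set vs1 \<subseteq> nodes \<Gamma>" "set vs2 \<subseteq> nodes \<Gamma>" "set es1 \<subseteq> edges \<Gamma>" "set es2 \<subseteq> edges \<Gamma>"
    and e1: "\<And>i. i < m \<Longrightarrow> ends \<Gamma> (es1 ! i) = {vs1 ! i, vs1 ! Suc i}"
    and e2: "\<And>i. i < n \<Longrightarrow> ends \<Gamma> (es2 ! i) = {vs2 ! i, vs2 ! Suc i}"
    using p by (auto simp: path_between_def m_def n_def)
  note uw = path_nth_0[OF p(1)] path_nth_0[OF p(2)] path_nth_last[OF p(1), folded m_def]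
    path_nth_last[OF p(2), folded n_def]
  have pos: "0 < m" "0 < n" using uw \<open>u \<noteq> w\<close> by (auto intro!: Nat.gr0I)
  have diste: "distinct es1" "distinct es2"
    using path_distinct_edges[OF p(1)] path_distinct_edges[OF p(2)] .
  define vs where "vs = butlast vs1 @ rev (tl vs2)"
  define es where "es = es1 @ rev es2"
  have vs1: "vs ! i = vs1 ! i" if "i \<le> m" for i
  proof (cases "i = m")
    case True
    then have "vs ! i = tl vs2 ! (n - 1)" using len pos by (simp add: vs_def nth_append rev_nth)
    also have "\<dots> = vs2 ! n" using len pos by (simp add: nth_tl)
    finally show ?thesis using True uw by simp
  next
    case False
    then show ?thesis using that len by (simp add: vs_def nth_append nth_butlast)
  qed
  have vs2: "vs ! (m + j) = vs2 ! (n - j)" if "j < n" for j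
    using that len by (simp add: vs_def nth_append rev_nth nth_tl Suc_diff_Suc)
  have vs_0: "vs ! 0 = u" using vs1[of 0] uw by simp
  have es2: "es ! (m + j) = es2 ! (n - Suc j)" if "j < n" for j
    using that by (simp add: es_def nth_append m_def n_def rev_nth)
  have lens: "length es = m + n" "length vs = m + n" using len by (simp_all add: es_def vs_def m_def n_def)
  have e: "ends \<Gamma> (es ! i) = {vs ! i, vs ! (Suc i mod (m + n))}" if i: "i < m + n" for i
  proof (cases "i < m")
    case True
    then have "Suc i mod (m + n) = Suc i" using pos by simp
    then show ?thesis using True e1[OF True] vs1[of i] vs1[of "Suc i"] by (simp add: es_def nth_append m_def)
  next
    case False
    then obtain j where j: "i = m + j" "j < n" using i by (metis add_diff_inverse_nat nat_add_left_cancel_less)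
    have "vs ! (Suc i mod (m + n)) = vs2 ! (n - Suc j)"
    proof (cases "Suc j = n")
      case True
      then have "Suc i mod (m + n) = 0" using j by auto
      then show ?thesis using True uw vs_0 by simp
    next
      case False
      then show ?thesis using j vs2[of "Suc j"] by simp
    qed
    moreover have "Suc (n - Suc j) = n - j" using j by simp
    ultimately show ?thesis
      using j e2[of "n - Suc j"] vs2[OF j(2)] es2[OF j(2)] by auto
  qed
  have "distinct vs"
  proof -
    obtain ys y where v1: "vs1 = ys @ [y]" using len(1) by (cases vs1 rule: rev_cases) auto
    then have "y = w" using p(1) by (simp add: path_between_def)
    then have b: "set (butlast vs1) \<subseteq> set vs1 - {w}" using v1 dist(1) by auto
    obtain x xs where v2: "vs2 = x # xs" using len(2) by (cases vs2) auto
    then have "x = u" using uw by simp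
    then have t: "set (tl vs2) \<subseteq> set vs2 - {u}" using v2 dist(2) by auto
    show ?thesis using b t vs dist by (auto simp: vs_def distinct_butlast distinct_tl)
  qed
  moreover have "set vs \<subseteq> set vs1 \<union> set vs2"
    using set_tl_subset[of vs2] by (auto simp: vs_def dest: in_set_butlastD)
  moreover have "distinct es" "set es = set es1 \<union> set es2"
    using es diste by (auto simp: es_def)
  ultimately have "circle_traversal \<Gamma> vs es"
    using e sub pos lens by (simp add: circle_traversal_def) (metis Un_least list.size(3) add_is_0 less_numeral_extra(3) subset_trans)
  then show ?thesis
    using \<open>set es = _\<close> unfolding circles_def by blast
qed

text \<open>With \<open>u\<close> rotated to the front, one arc is a prefix of the node list; the
  other steps from \<open>u\<close> to the end of the list and runs backwards to
  \<open>w\<close>.\<close>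

lemma circle_split:
  assumes "circle_traversal \<Gamma> vs es" "u \<in> set vs" "w \<in> set vs" "u \<noteq> w"
  obtains vs1 es1 vs2 es2 where "path_between \<Gamma> u vs1 es1 w" "path_between \<Gamma> u vs2 es2 w"
    "set vs1 \<inter> set vs2 = {u, w}" "set vs1 \<union> set vs2 = set vs"
    "set es1 \<inter> set es2 = {}" "set es1 \<union> set es2 = set es"
proof -
  obtain i where i: "i < length vs" "vs ! i = u" using assms by (auto simp: in_set_conv_nth)
  define us ds where "us = rotate i vs" and "ds = rotate i es"
  define l where "l = length ds"
  have c: "circle_traversal \<Gamma> us ds" unfolding us_def ds_def by (rule circle_rotate) fact
  have sets: "set us = set vs" "set ds = set es" by (simp_all add: us_def ds_def)
  have len: "length us = l" and dist: "distinct us" "distinct ds"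
    and sub: "set us \<subseteq> nodes \<Gamma>" "set ds \<subseteq> edges \<Gamma>"
    and e: "\<And>i. i < l \<Longrightarrow> ends \<Gamma> (ds ! i) = {us ! i, us ! (Suc i mod l)}"
    using c by (auto simp: circle_traversal_def l_def)
  have "length vs = l" using len by (simp add: us_def)
  then have u: "us ! 0 = u" using i by (simp add: us_def nth_rotate)
  obtain k where k: "k < l" "us ! k = w" using assms(3) sets len by (metis in_set_conv_nth)
  have k0: "0 < k" using k u assms(4) by (cases k) auto
  define vs1 where "vs1 = take (Suc k) us"
  define vs2 where "vs2 = us ! 0 # rev (drop k us)"
  \<comment> \<open>The modulus matters only for \<open>i = 0\<close>, where \<open>l - i\<close>
    must wrap around to the position of \<open>u\<close>.\<close>
  have v2: "vs2 ! i = us ! ((l - i) mod l)" if "i \<le> l - k" for i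
    using that k k0 len by (cases i) (auto simp: vs2_def rev_nth)
  have p1: "path_between \<Gamma> u vs1 (take k ds) w"
    unfolding path_between_def
  proof (intro conjI)
    show "length vs1 = Suc (length (take k ds))" using k len by (simp add: vs1_def l_def)
    show "hd vs1 = u" using u len k by (cases us) (auto simp: vs1_def)
    show "last vs1 = w" using k len by (simp add: vs1_def take_Suc_conv_app_nth)
    show "\<forall>i<length (take k ds). ends \<Gamma> (take k ds ! i) = {vs1 ! i, vs1 ! Suc i}"
      using e k by (auto simp: vs1_def)
  qed (use dist sub in \<open>auto simp: vs1_def dest: in_set_takeD\<close>)
  have p2: "path_between \<Gamma> u vs2 (rev (drop k ds)) w"
    unfolding path_between_def
  proof (intro conjI)
    show "length vs2 = Suc (length (rev (drop k ds)))" using k len by (simp add: vs2_def l_def)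
    show "hd vs2 = u" using u by (simp add: vs2_def)
    show "last vs2 = w" using k len by (simp add: vs2_def last_rev hd_drop_conv_nth)
    show "distinct vs2"
      using k0 dist(1) len k by (auto simp: vs2_def in_set_conv_nth nth_eq_iff_index_eq)
    show "set vs2 \<subseteq> nodes \<Gamma>"
      proof -
      have "us ! 0 \<in> set us" using k(1) len by (intro nth_mem) simp
      then show ?thesis using sub(1) unfolding vs2_def by (auto dest: in_set_dropD)
    qed
    show "\<forall>i<length (rev (drop k ds)). ends \<Gamma> (rev (drop k ds) ! i) = {vs2 ! i, vs2 ! Suc i}"
    proof (intro allI impI)
      fix i assume "i < length (rev (drop k ds))"
      then have i: "i < l - k" by (simp add: l_def)
      then have "rev (drop k ds) ! i = ds ! (l - Suc i)" by (simp add: rev_nth l_def)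
      moreover have "vs2 ! Suc i = us ! (l - Suc i)" using v2[of "Suc i"] i by simp
      moreover have "Suc (l - Suc i) = l - i" using i by simp
      ultimately show "ends \<Gamma> (rev (drop k ds) ! i) = {vs2 ! i, vs2 ! Suc i}"
        using e[of "l - Suc i"] v2[of i] i by (auto simp: insert_commute)
    qed
  qed (use sub in \<open>auto dest: in_set_dropD\<close>)
  obtain X Y where us: "us = u # X @ w # Y" and X: "take k us = u # X" and Y: "drop (Suc k) us = Y"
  proof -
    have 1: "us = take k us @ w # drop (Suc k) us" using id_take_nth_drop[of k us] k len by simp
    obtain a X where 2: "take k us = a # X" using k0 k len by (cases "take k us") auto
    have "us ! 0 = take k us ! 0" using k0 by simp
    then have "a = u" using u 2 by simp
    then show ?thesis using that[of X "drop (Suc k) us"] 1 2 by (metis append_Cons)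
  qed
  have d: "distinct (u # X @ w # Y)" using us dist(1) by metis
  have s1: "set vs1 = {u, w} \<union> set X" using X k len by (auto simp: vs1_def take_Suc_conv_app_nth)
  have s2: "set vs2 = {u, w} \<union> set Y"
    using Y k len u by (auto simp: vs2_def Cons_nth_drop_Suc[symmetric])
  have s: "set vs = {u, w} \<union> set X \<union> set Y" using sets(1) arg_cong[OF us, of set] by auto
  have "set vs1 \<inter> set vs2 = {u, w}" using d unfolding s1 s2 by auto
  moreover have "set vs1 \<union> set vs2 = set vs" unfolding s1 s2 s by auto
  moreover have "distinct (take k ds @ drop k ds)" "set (take k ds @ drop k ds) = set es"
    using dist(2) sets(2) by simp_all
  then have "set (take k ds) \<inter> set (rev (drop k ds)) = {}" "set (take k ds) \<union> set (rev (drop k ds)) = set es"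
    unfolding distinct_append set_append by simp_all
  ultimately show ?thesis
    using that p1 p2 by blast
qed

lemma path_singleton: "u \<in> nodes \<Gamma> \<Longrightarrow> path_between \<Gamma> u [u] [] u"
  by (simp add: path_between_def)

lemma path_take:
  assumes p: "path_between \<Gamma> u vs es w" and i: "i < length vs"
  shows "path_between \<Gamma> u (take (Suc i) vs) (take i es) (vs ! i)"
  unfolding path_between_def
proof (intro conjI)
  show "hd (take (Suc i) vs) = u" using p i by (auto simp: path_between_def)
  show "last (take (Suc i) vs) = vs ! i" using i by (simp add: take_Suc_conv_app_nth)
qed (use p i in \<open>auto simp: path_between_def dest: in_set_takeD\<close>)

lemma path_append:
  assumes p: "path_between \<Gamma> u vs es w"
    and z: "e \<in> edges \<Gamma>" "ends \<Gamma> e = {w, z}" "z \<in> nodes \<Gamma>" "z \<notin> set vs"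
  shows "path_between \<Gamma> u (vs @ [z]) (es @ [e]) z"
proof -
  have "vs \<noteq> []" using p by (auto simp: path_between_def)
  then show ?thesis
    using p z path_nth_last[OF p] by (auto simp: path_between_def nth_append less_Suc_eq)
qed

text \<open>A walk from \<open>L\<close> to \<open>R\<close> is scanned edge by edge, keeping a path
  that starts in \<open>L\<close> and otherwise avoids \<open>L\<close> and \<open>R\<close>.
  Meeting the path again cuts off a detour, returning to \<open>L\<close> restarts the path, and the
  first arrival in \<open>R\<close> completes it.\<close>

lemma connecting_path:
  assumes "(a, b) \<in> (adjacent_via \<Gamma> E)\<^sup>*" "a \<in> L" "b \<in> R" "L \<inter> R = {}"
    and "E \<subseteq> edges \<Gamma>" and N: "L \<subseteq> nodes \<Gamma>" "\<And>e. e \<in> E \<Longrightarrow> ends \<Gamma> e \<subseteq> nodes \<Gamma>"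
  obtains u w vs es where "u \<in> L" "w \<in> R" "path_between \<Gamma> u vs es w" "set es \<subseteq> E"
    "set vs \<inter> (L \<union> R) = {u, w}"
proof -
  let ?good = "\<exists>u w vs es. u \<in> L \<and> w \<in> R \<and> path_between \<Gamma> u vs es w \<and> set es \<subseteq> E \<and>
    set vs \<inter> (L \<union> R) = {u, w}"
  have "?good \<or> (\<exists>u\<in>L. \<exists>vs es. path_between \<Gamma> u vs es b \<and> set es \<subseteq> E \<and> set vs \<inter> L = {u} \<and> set vs \<inter> R = {})"
    using assms(1)
  proof (induction rule: rtrancl_induct)
    case base
    have "path_between \<Gamma> a [a] [] a" using N assms(2) by (intro path_singleton) auto
    then show ?case using assms(2,4) by (intro disjI2 bexI[of _ a] exI[of _ "[a]"] exI[of _ "[]"]) auto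
  next
    case (step y z)
    show ?case
    proof (cases ?good)
      case False
      then obtain u vs es where p: "u \<in> L" "path_between \<Gamma> u vs es y" "set es \<subseteq> E"
        "set vs \<inter> L = {u}" "set vs \<inter> R = {}" using step.IH by blast
      obtain e where e: "e \<in> E" "ends \<Gamma> e = {y, z}" using step.hyps by (auto simp: adjacent_via_def)
      have z: "z \<in> nodes \<Gamma>" using N(2) e by auto
      have app: "path_between \<Gamma> u (vs @ [z]) (es @ [e]) z" if "z \<notin> set vs"
        using p e z that assms(5) by (intro path_append) auto
      consider "z \<in> set vs" | "z \<notin> set vs" "z \<in> L" | "z \<notin> set vs" "z \<in> R" | "z \<notin> set vs" "z \<notin> L \<union> R" by auto
      then show ?thesis
      proof cases
        case 1
        then obtain i where i: "i < length vs" "vs ! i = z" by (auto simp: in_set_conv_nth)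
        have q: "path_between \<Gamma> u (take (Suc i) vs) (take i es) z" using path_take[OF p(2) i(1)] i(2) by simp
        have "u \<in> set (take (Suc i) vs)"
          using path_nth_0[OF p(2)] i by (cases vs) auto
        then have "set (take (Suc i) vs) \<inter> L = {u}" "set (take (Suc i) vs) \<inter> R = {}"
          using p set_take_subset[of "Suc i" vs] by blast+
        moreover have "set (take i es) \<subseteq> E" using p set_take_subset[of i es] by blast
        ultimately show ?thesis using q p(1) by blast
      next
        case 2
        have "path_between \<Gamma> z [z] [] z" using z by (rule path_singleton)
        then show ?thesis using 2 assms(4) by (intro disjI2 bexI[of _ z] exI[of _ "[z]"] exI[of _ "[]"]) auto
      next
        case 3
        then have "?good" using app p e assms(4)
          by (intro exI[of _ u] exI[of _ z] exI[of _ "vs @ [z]"] exI[of _ "es @ [e]"]) auto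
        then show ?thesis ..
      next
        case 4
        then show ?thesis using app p e
          by (intro disjI2 bexI[of _ u] exI[of _ "vs @ [z]"] exI[of _ "es @ [e]"]) auto
      qed
    qed blast
  qed
  moreover have "b \<in> set vs" if "path_between \<Gamma> u vs es b" for u vs es
    using that by (auto simp: path_between_def intro: last_in_set)
  ultimately have ?good using assms(3) by blast
  then show ?thesis using that by blast
qed

section \<open>Fundamental circles\<close>

lemma (in rooted_tree) tree_edges_inj:
  assumes "\<And>x. x \<in> V - {r} \<Longrightarrow> E (\<sigma> x) = {x, par x}"
  shows "inj_on \<sigma> (V - {r})"
proof (rule inj_onI)
  fix x y assume xy: "x \<in> V - {r}" "y \<in> V - {r}" "\<sigma> x = \<sigma> y"
  then have "{x, par x} = {y, par y}" using assms by metis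
  then show "x = y" using dep_par[OF xy(1)] dep_par[OF xy(2)] by (auto simp: doubleton_eq_iff)
qed

lemma finite_circle: "C \<in> circles \<Gamma> \<Longrightarrow> finite C"
  by (auto simp: circles_def)

lemma circle_nonempty: "C \<in> circles \<Gamma> \<Longrightarrow> C \<noteq> {}"
  by (auto simp: circles_def circle_traversal_def)

text \<open>At the lower end of a deepest tree edge of the circle a second edge would have to come
  from a child and lie deeper. \<open>\<Gamma>\<close> and \<open>\<sigma>\<close> are arbitrary
  because the lemma serves the tree and its lifts alike.\<close>

lemma (in rooted_tree) no_tree_circle:
  assumes E: "\<And>x. x \<in> V - {r} \<Longrightarrow> ends \<Gamma> (\<sigma> x) = {x, par x}"
    and C: "C \<in> circles \<Gamma>"
  shows "\<not> C \<subseteq> \<sigma> ` (V - {r})"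
proof
  assume sub: "C \<subseteq> \<sigma> ` (V - {r})"
  define X where "X = {x \<in> V - {r}. \<sigma> x \<in> C}"
  have "finite X"
    using finite_circle[OF C] finite_imageD[of \<sigma> X] inj_on_subset[OF tree_edges_inj[of "ends \<Gamma>", OF E]]
    by (auto simp: X_def intro: finite_subset inj_on_subset)
  moreover have "X \<noteq> {}" using circle_nonempty[OF C] sub by (auto simp: X_def)
  ultimately have "Max (dep ` X) \<in> dep ` X" "\<And>y. y \<in> X \<Longrightarrow> dep y \<le> Max (dep ` X)"
    by simp_all
  then obtain x where x: "x \<in> X" "\<And>y. y \<in> X \<Longrightarrow> dep y \<le> dep x"
    by auto
  then have xN: "x \<in> V - {r}" by (simp add: X_def)
  then obtain e' where e': "e' \<in> C" "e' \<noteq> \<sigma> x" "x \<in> ends \<Gamma> e'"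
    using circle_other_edge[OF C _ E[OF xN]] x(1) par_ne[OF xN] by (auto simp: X_def)
  then obtain y where y: "y \<in> X" "e' = \<sigma> y" using sub by (auto simp: X_def)
  then have "x \<in> {y, par y}" using E e' by (auto simp: X_def)
  then have "x = par y" using e' y by auto
  then show False using x(2)[OF y(1)] dep_par[of y] y by (auto simp: X_def)
qed

text \<open>
  The vertices \<open>x\<close> stand for the tree edges joining them to their parents, so \<open>K\<close> is a set of tree
  edges, and \<open>c\<close> is a contraction of the others.
\<close>

lemma (in rooted_tree) chain_list:
  assumes "(v, u) \<in> P\<^sup>*" and c: "\<And>x. x \<in> V - {r} - K \<Longrightarrow> c x = c (par x)"
  shows "\<exists>ks. distinct ks \<and> set ks = {z \<in> K. (v, z) \<in> P\<^sup>* \<and> (z, u) \<in> P\<^sup>+} \<and>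
    (\<forall>i<length ks. c (par (ks ! i)) = c ((ks @ [u]) ! Suc i)) \<and> c v = c ((ks @ [u]) ! 0)"
  using assms(1)
proof (induction rule: converse_rtrancl_induct)
  case base
  have "{z \<in> K. (u, z) \<in> P\<^sup>* \<and> (z, u) \<in> P\<^sup>+} = {}"
    using dep_trancl dep_rtrancl by fastforce
  then show ?case by (intro exI[of _ "[]"]) simp
next
  case (step v v')
  have v: "v \<in> V - {r}" "v' = par v" using step.hyps by (auto simp: P_iff)
  obtain ks where ks: "distinct ks" "set ks = {z \<in> K. (v', z) \<in> P\<^sup>* \<and> (z, u) \<in> P\<^sup>+}"
    "\<And>i. i < length ks \<Longrightarrow> c (par (ks ! i)) = c ((ks @ [u]) ! Suc i)" "c v' = c ((ks @ [u]) ! 0)"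
    using step.IH by blast
  have vu: "(v, u) \<in> P\<^sup>+" using step.hyps by (rule rtrancl_into_trancl2)
  have vz: "(v, z) \<in> P\<^sup>* \<longleftrightarrow> z = v \<or> (v', z) \<in> P\<^sup>*" for z
    using step_up[of v z] v step.hyps(1) by (auto intro: converse_rtrancl_into_rtrancl)
  have vn: "v \<notin> set ks" using ks(2) dep_rtrancl[of v' v] dep_par[OF v(1)] v(2) by auto
  show ?case
  proof (cases "v \<in> K")
    case True
    have "\<forall>i<length (v # ks). c (par ((v # ks) ! i)) = c (((v # ks) @ [u]) ! Suc i)"
      using ks(3,4) v(2) by (auto simp: less_Suc_eq_0_disj)
    then show ?thesis using True ks vn vu vz by (intro exI[of _ "v # ks"]) auto
  next
    case False
    then have "c v = c v'" using c v by simp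
    then show ?thesis using False ks vz by (intro exI[of _ ks]) auto
  qed
qed

text \<open>One construction for three uses: with all tree edges in \<open>K\<close> and
  \<open>c\<close> the identity it gives the fundamental circles of the base graph, with a
  contraction \<open>c\<close> it gives their images in a minor of the base graph and, for another
  edge map \<open>s\<close>, in the minor of the expansion. The edge \<open>w\<close> comes last and
  leads from the top node back to the bottom one.\<close>

lemma (in rooted_tree) contracted_fundamental_traversal:
  assumes vu: "(v, u) \<in> P\<^sup>*" and c: "\<And>x. x \<in> V - {r} - K \<Longrightarrow> c x = c (par x)"
    and X: "X = {z \<in> K. (v, z) \<in> P\<^sup>* \<and> (z, u) \<in> P\<^sup>+}"
    and inj: "inj_on c K" "\<And>k. k \<in> K \<Longrightarrow> (k, u) \<in> P\<^sup>+ \<Longrightarrow> c k \<noteq> c u"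
    and s: "inj_on s K" "w \<notin> s ` K" "\<And>k. k \<in> K \<Longrightarrow> ends \<Gamma> (s k) = {c k, c (par k)}"
    and w: "w \<in> edges \<Gamma>" "ends \<Gamma> w = {c v, c u}"
    and sub: "s ` K \<subseteq> edges \<Gamma>" "c ` insert u K \<subseteq> nodes \<Gamma>"
  obtains ks where "set ks = X" "distinct ks"
    "circle_traversal \<Gamma> (map c (ks @ [u])) (map s ks @ [w])"
    "\<And>i. i < length ks \<Longrightarrow> c (par (ks ! i)) = c ((ks @ [u]) ! Suc i)" "c v = c ((ks @ [u]) ! 0)"
proof -
  obtain ks where ks: "distinct ks" "set ks = {z \<in> K. (v, z) \<in> P\<^sup>* \<and> (z, u) \<in> P\<^sup>+}"
    "\<And>i. i < length ks \<Longrightarrow> c (par (ks ! i)) = c ((ks @ [u]) ! Suc i)" "c v = c ((ks @ [u]) ! 0)"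
    using chain_list[of v u K c, OF vu c] by blast
  have K: "set ks \<subseteq> K" using ks by auto
  have "circle_traversal \<Gamma> (map c (ks @ [u])) (map s ks @ [w])"
    unfolding circle_traversal_def
  proof (intro conjI allI impI)
    have "c u \<notin> c ` set ks" using inj(2) ks(2) by fastforce
    then show "distinct (map c (ks @ [u]))"
      using ks(1) inj_on_subset[OF inj(1) K] by (simp add: distinct_map)
    show "distinct (map s ks @ [w])"
      using ks(1) K s inj_on_subset[OF s(1) K] by (auto simp: distinct_map)
    show "set (map c (ks @ [u])) \<subseteq> nodes \<Gamma>" using K sub by auto
    show "set (map s ks @ [w]) \<subseteq> edges \<Gamma>" using K sub w by auto
    fix i assume i: "i < length (map s ks @ [w])"
    show "ends \<Gamma> ((map s ks @ [w]) ! i) =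
        {map c (ks @ [u]) ! i, map c (ks @ [u]) ! (Suc i mod length (map s ks @ [w]))}"
    proof (cases "i < length ks")
      case True
      then have "ks ! i \<in> K" using K by (meson nth_mem subsetD)
      then show ?thesis using True s(3)[of "ks ! i"] ks(3)[OF True]
        by (simp add: nth_append del: map_append)
    next
      case False
      then have "i = length ks" using i by simp
      then show ?thesis using w(2) ks(4) by (auto simp: nth_append simp del: map_append)
    qed
  qed simp_all
  then show ?thesis using that ks X by blast
qed

lemma circle_loop:
  assumes "C \<in> circles \<Gamma>" "f \<in> C" "ends \<Gamma> f = {v}"
  shows "C = {f}"
proof -
  obtain vs es where c: "circle_traversal \<Gamma> vs es" "set es = C" "last es = f"
    using circle_with_last[OF assms(1,2)] .
  define l where "l = length es"
  have ne: "es \<noteq> []" and len: "length vs = l" "distinct vs" and "ends \<Gamma> (es ! (l - 1)) = {vs ! (l - 1), vs ! (Suc (l - 1) mod l)}"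
    using c(1) by (auto simp: circle_traversal_def l_def)
  then have "{v} = {vs ! (l - 1), vs ! 0}" using c(3) assms(3) by (simp add: last_conv_nth l_def)
  then have "vs ! (l - 1) = vs ! 0" by auto
  then have "l - 1 = 0" using len ne nth_eq_iff_index_eq[OF len(2), of "l - 1" 0] by (simp add: l_def)
  then have "es = [f]" using ne c(3) by (cases es) (auto simp: l_def)
  then show ?thesis using c(2) by simp
qed

text \<open>Parallel edges are allowed, so \<open>te\<close> selects the tree edge above each node
  other than the root; the edges parallel to it are cotree edges.\<close>

locale normal_spanning_tree = rooted_tree "nodes \<Delta>" r par dep
  for \<Delta> :: "('v, 'f) multigraph" and r par dep +
  fixes te :: "'v \<Rightarrow> 'f"
  assumes wf: "wf_multigraph \<Delta>"
    and te_in: "x \<in> nodes \<Delta> - {r} \<Longrightarrow> te x \<in> edges \<Delta>"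
    and te_ends: "x \<in> nodes \<Delta> - {r} \<Longrightarrow> ends \<Delta> (te x) = {x, par x}"
    and normal: "f \<in> edges \<Delta> \<Longrightarrow> ends \<Delta> f = {x, y} \<Longrightarrow> (x, y) \<in> P\<^sup>* \<or> (y, x) \<in> P\<^sup>*"
begin

abbreviation V where "V \<equiv> nodes \<Delta>"

abbreviation N where "N \<equiv> V - {r}"

text \<open>
  Normality makes every fundamental path vertical: it climbs from \<open>lo f\<close> to its ancestor \<open>hi f\<close>.
  For a loop both are equal and the chain is empty.
\<close>

definition cotree where "cotree = edges \<Delta> - te ` N"

definition lohi where
  "lohi f = (SOME q. ends \<Delta> f = {fst q, snd q} \<and> q \<in> P\<^sup>*)"

definition lo where "lo f = fst (lohi f)"

definition hi where "hi f = snd (lohi f)"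

text \<open>The tree edges of the fundamental path, named by their lower ends. Hence
  \<open>lo f\<close> belongs to the chain unless \<open>f\<close> is a loop, and
  \<open>hi f\<close> never does.\<close>

definition chain where "chain f = {z. (lo f, z) \<in> P\<^sup>* \<and> (z, hi f) \<in> P\<^sup>+}"

lemma lo_hi:
  assumes "f \<in> edges \<Delta>"
  shows "ends \<Delta> f = {lo f, hi f}" "(lo f, hi f) \<in> P\<^sup>*"
proof -
  obtain x y where "ends \<Delta> f = {x, y}" using wf assms unfolding wf_multigraph_def by blast
  then have "\<exists>q. ends \<Delta> f = {fst q, snd q} \<and> q \<in> P\<^sup>*"
    using normal[OF assms] by (metis fst_conv snd_conv insert_commute)
  then have "ends \<Delta> f = {fst (lohi f), snd (lohi f)} \<and> lohi f \<in> P\<^sup>*"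
    unfolding lohi_def by (rule someI_ex)
  then show "ends \<Delta> f = {lo f, hi f}" "(lo f, hi f) \<in> P\<^sup>*" by (simp_all add: lo_def hi_def)
qed

lemma lo_hi_unique:
  assumes "f \<in> edges \<Delta>" "ends \<Delta> f = {x, y}" "(x, y) \<in> P\<^sup>*"
  shows "lo f = x" "hi f = y"
  using lo_hi[OF assms(1)] assms(2,3) antisym_P[of x y] by (auto simp: doubleton_eq_iff)

lemma lo_hi_in: "f \<in> edges \<Delta> \<Longrightarrow> lo f \<in> V \<and> hi f \<in> V"
  using lo_hi(1)[of f] wf unfolding wf_multigraph_def by (metis insert_subset empty_subsetI insertCI doubleton_eq_iff)

lemma lo_te: "x \<in> N \<Longrightarrow> lo (te x) = x"
  by (rule lo_hi_unique(1)[OF te_in te_ends]) (auto simp: P_iff)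

lemma hi_te: "x \<in> N \<Longrightarrow> hi (te x) = par x"
  by (rule lo_hi_unique(2)[OF te_in te_ends]) (auto simp: P_iff)

lemma te_inj: "inj_on te N"
  using tree_edges_inj[of "ends \<Delta>", OF te_ends] .

lemma chain_sub: "chain f \<subseteq> N"
  unfolding chain_def trancl_iff by auto

lemma chain_linear: "x \<in> chain f \<Longrightarrow> y \<in> chain f \<Longrightarrow> (x, y) \<in> P\<^sup>* \<or> (y, x) \<in> P\<^sup>*"
  unfolding chain_def using linear_P by blast

lemma lo_in_chain: "f \<in> edges \<Delta> \<Longrightarrow> lo f \<noteq> hi f \<Longrightarrow> lo f \<in> chain f"
  using lo_hi(2)[of f] by (auto simp: chain_def rtrancl_eq_or_trancl)

lemma chain_loop: "lo f = hi f \<Longrightarrow> chain f = {}"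
  unfolding chain_def using dep_rtrancl dep_trancl by fastforce

lemma tree_connected:
  assumes "x \<in> V" "y \<in> V"
  shows "(x, y) \<in> (adjacent_via \<Delta> (te ` N))\<^sup>*"
proof -
  have "P \<subseteq> adjacent_via \<Delta> (te ` N)"
    using te_ends by (auto simp: P_iff adjacent_via_def)
  from rtrancl_mono[OF this] have "(x, r) \<in> (adjacent_via \<Delta> (te ` N))\<^sup>*" "(y, r) \<in> (adjacent_via \<Delta> (te ` N))\<^sup>*"
    using reaches_root assms by blast+
  then show ?thesis
    using sym_rtrancl[OF sym_adjacent_via] by (metis symD rtrancl_trans)
qed

lemma fundamental_circle:
  assumes "f \<in> cotree"
  shows "insert f (te ` chain f) \<in> circles \<Delta>"
proof -
  have f: "f \<in> edges \<Delta>" "f \<notin> te ` N" using assms by (auto simp: cotree_def)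
  obtain ks where ks: "set ks = chain f"
    "circle_traversal \<Delta> (map (\<lambda>x. x) (ks @ [hi f])) (map te ks @ [f])"
  proof (rule contracted_fundamental_traversal[of "lo f" "hi f" N "\<lambda>x. x" "chain f" te f \<Delta>])
    show "chain f = {z \<in> N. (lo f, z) \<in> P\<^sup>* \<and> (z, hi f) \<in> P\<^sup>+}"
      using chain_sub[of f] by (auto simp: chain_def)
  qed (use f lo_hi[OF f(1)] lo_hi_in[OF f(1)] te_inj te_in te_ends trancl_neq in auto)
  then have "set (map te ks @ [f]) \<in> circles \<Delta>" unfolding circles_def by blast
  then show ?thesis using ks(1) by simp
qed

text \<open>Degree two leaves no choice. Followed downwards, tree edges of the circle can only end
  at \<open>lo f\<close>, so all of them lie above it; followed upwards, they cannot turn into a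
  sibling edge, because two siblings are not both ancestors of \<open>lo f\<close>, and so they
  climb to \<open>hi f\<close>.\<close>

lemma fundamental_circle_unique:
  assumes C: "C \<in> circles \<Delta>" and f: "C - te ` N = {f}" "f \<in> edges \<Delta>"
  shows "C = insert f (te ` chain f)"
proof (cases "lo f = hi f")
  case True
  then have "C = {f}" using circle_loop[OF C, of f "lo f"] f lo_hi[OF f(2)] by auto
  then show ?thesis using chain_loop[OF True] by simp
next
  case False
  define u v where "u = hi f" and "v = lo f"
  have vu: "(v, u) \<in> P\<^sup>*" "v \<noteq> u" and fe: "ends \<Delta> f = {v, u}"
    using lo_hi[OF f(2)] False by (auto simp: u_def v_def)
  define X where "X = {x \<in> N. te x \<in> C}"
  have XN: "x \<in> N" if "x \<in> X" for x using that by (simp add: X_def)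
  have CX: "C = insert f (te ` X)" using f(1) by (auto simp: X_def)
  have "te ` X \<subseteq> C" "X \<subseteq> N" by (auto simp: X_def)
  then have "finite X"
    using finite_imageD finite_subset finite_circle[OF C] inj_on_subset[OF te_inj] by metis
  have other: "(y \<in> {v, u}) \<or> (\<exists>z\<in>X. z \<noteq> x \<and> y \<in> {z, par z})"
    if "x \<in> X" and y: "y = x \<or> y = par x" for x y
  proof -
    have x: "ends \<Delta> (te x) = {x, par x}" "x \<noteq> par x" "te x \<in> C"
      using te_ends[OF XN[OF that(1)]] par_ne[OF XN[OF that(1)]] that(1) by (auto simp: X_def)
    then obtain y' where "ends \<Delta> (te x) = {y, y'}" "y \<noteq> y'"
      using y by (metis insert_commute)
    then obtain e' where e': "e' \<in> C" "e' \<noteq> te x" "y \<in> ends \<Delta> e'"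
      using circle_other_edge[OF C x(3)] by blast
    then have "e' = f \<or> (\<exists>z\<in>X. e' = te z)" using CX by blast
    then show ?thesis
    proof
      assume "e' = f"
      then show ?thesis using e'(3) fe by simp
    next
      assume "\<exists>z\<in>X. e' = te z"
      then obtain z where z: "z \<in> X" "e' = te z" by blast
      then have "z \<noteq> x" "y \<in> {z, par z}" using e' te_ends[OF XN[OF z(1)]] by auto
      then show ?thesis using z(1) by blast
    qed
  qed
  \<comment> \<open>The induction starts at the deepest level: the second tree edge at
    \<open>y\<close> belongs to a child of \<open>y\<close>, which is already known to be above
    \<open>v\<close>.\<close>
  have above: "(v, y) \<in> P\<^sup>*" if "y \<in> X" for y
    using that
  proof (induction "Max (dep ` X) - dep y" arbitrary: y rule: less_induct)
    case less
    show ?case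
    proof (cases "y \<in> {v, u}")
      case True
      then show ?thesis using vu by auto
    next
      case False
      then obtain z where z: "z \<in> X" "z \<noteq> y" "y \<in> {z, par z}" using other[OF less.prems, of y] by auto
      then have y: "y = par z" by auto
      have "dep z \<le> Max (dep ` X)" using \<open>finite X\<close> z by simp
      then have "(v, z) \<in> P\<^sup>*"
        using z dep_par[OF XN[OF z(1)]] y by (intro less.hyps) auto
      moreover have "(z, y) \<in> P" using y XN[OF z(1)] by (simp add: P_iff)
      ultimately show ?thesis by (rule rtrancl_into_rtrancl)
    qed
  qed
  have vX: "v \<in> X"
  proof -
    obtain e' where e': "e' \<in> C" "e' \<noteq> f" "v \<in> ends \<Delta> e'"
      using circle_other_edge[OF C _ fe vu(2)] f(1) by blast
    then obtain z where z: "z \<in> X" "e' = te z" using CX by auto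
    then have "v = z \<or> v = par z" using e' te_ends[OF XN[OF z(1)]] by auto
    moreover have "v \<noteq> par z"
      using dep_rtrancl[OF above[OF z(1)]] dep_par[OF XN[OF z(1)]] by auto
    ultimately show ?thesis using z by simp
  qed
  \<comment> \<open>The second edge at \<open>par y\<close> is not that of a sibling of
    \<open>y\<close>: both siblings would be ancestors of \<open>v\<close> and hence
    comparable.\<close>
  have up: "par y \<in> X" if yX: "y \<in> X" and yu: "par y \<noteq> u" for y
  proof -
    have lt: "dep (par y) < dep y" using dep_par[OF XN[OF that(1)]] by simp
    have "par y \<noteq> v" using dep_rtrancl[OF above[OF that(1)]] lt by auto
    then obtain z where z: "z \<in> X" "z \<noteq> y" "par y \<in> {z, par z}"
      using other[OF yX, of "par y"] yu by auto
    have "par y \<noteq> par z"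
    proof
      assume eq: "par y = par z"
      have "(y, z) \<in> P\<^sup>* \<or> (z, y) \<in> P\<^sup>*" using linear_P[OF above[OF that(1)] above[OF z(1)]] .
      then have "(par y, z) \<in> P\<^sup>* \<or> (par z, y) \<in> P\<^sup>*" using step_up z(2) by metis
      then show False
        using eq dep_rtrancl dep_par[OF XN[OF that(1)]] dep_par[OF XN[OF z(1)]] by fastforce
    qed
    then show ?thesis using z by auto
  qed
  have below: "(par y, u) \<in> P\<^sup>*" if "y \<in> X" for y
    using that
  proof (induction "dep y" arbitrary: y rule: less_induct)
    case less
    show ?case
    proof (cases "par y = u")
      case False
      then have py: "par y \<in> X" using up less.prems by simp
      then have "(par (par y), u) \<in> P\<^sup>*" using less dep_par[OF XN[OF less.prems]] by simp
      moreover have "(par y, par (par y)) \<in> P" using XN[OF py] by (simp add: P_iff)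
      ultimately show ?thesis by (rule converse_rtrancl_into_rtrancl[rotated])
    qed simp
  qed
  have "(z, u) \<in> P\<^sup>+ \<longrightarrow> z \<in> X" if "(v, z) \<in> P\<^sup>*" for z
    using that
  proof (induction rule: rtrancl_induct)
    case (step y z)
    show ?case
    proof
      assume zu: "(z, u) \<in> P\<^sup>+"
      then have "y \<in> X" using step by (meson trancl_into_trancl2)
      moreover have "z = par y" using step by (simp add: P_iff)
      ultimately show "z \<in> X" using up trancl_neq[OF zu] by simp
    qed
  qed (use vX in simp)
  then have "X = chain f"
    using above below XN by (auto simp: chain_def u_def v_def trancl_iff)
  then show ?thesis using CX by simp
qed

end

section \<open>Lifts of a spanning tree\<close>

text \<open>Circle lifting freed from traversals: the missing edge is any edge of the circle, and
  the remaining lifted edges form a set.\<close>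

lemma circle_lifting_unique:
  assumes exp: "biased_expansion \<Omega> \<Delta> p" and C: "C \<in> circles \<Delta>" "e \<in> C"
    and X: "X \<subseteq> edges \<Omega>" "bij_betw p X (C - {e})"
  shows "\<exists>!x. x \<in> edges \<Omega> \<and> p x = e \<and> insert x X \<in> balanced \<Omega>"
proof -
  obtain vs es where c: "circle_traversal \<Delta> vs es" "set es = C" "last es = e"
    using circle_with_last[OF C] .
  have es: "es \<noteq> []" "distinct es" using c(1) by (auto simp: circle_traversal_def)
  then obtain ds where ds: "es = ds @ [e]" using c(3) by (metis append_butlast_last_id)
  then have "set (butlast es) = C - {e}" using es(2) c(2) by auto
  define xs where "xs = map (inv_into X p) (butlast es)"
  have "set xs = X"
    using bij_betw_imp_surj_on[OF bij_betw_inv_into[OF X(2)]] \<open>set (butlast es) = _\<close>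
    by (simp add: xs_def)
  moreover have "p (inv_into X p d) = d" if "d \<in> set (butlast es)" for d
    using bij_betw_inv_into_right[OF X(2)] that \<open>set (butlast es) = _\<close> by blast
  then have "map p xs = butlast es" by (simp add: xs_def map_idI)
  moreover have "circle_lifting \<Omega> \<Delta> p" using exp by (simp add: biased_expansion_def)
  ultimately show ?thesis
    using c(1,3) X(1) unfolding circle_lifting_def by metis
qed

locale tree_expansion = normal_spanning_tree \<Delta> r par dep te
  for \<Delta> :: "('v, 'f) multigraph" and r par dep te +
  fixes \<Omega> :: "('v, 'e) biased_graph" and p :: "'e \<Rightarrow> 'f"
  assumes exp: "biased_expansion \<Omega> \<Delta> p"
    and fin_nodes: "finite (nodes \<Delta>)"
begin

lemma p_in: "x \<in> edges \<Omega> \<Longrightarrow> p x \<in> edges \<Delta>"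
  and ends_p: "x \<in> edges \<Omega> \<Longrightarrow> ends \<Omega> x = ends \<Delta> (p x)"
  and nodes_eq: "nodes \<Omega> = V"
  and biased: "is_biased_graph \<Omega>"
  and p_surj: "p ` edges \<Omega> = edges \<Delta>"
  using exp by (auto simp: biased_expansion_def)

lemma project_traversal:
  assumes c: "circle_traversal \<Omega> vs xs" and "distinct (map p xs)"
  shows "set (map p xs) \<in> circles \<Delta>"
proof -
  have xs: "set xs \<subseteq> edges \<Omega>" using c by (simp add: circle_traversal_def)
  then have "ends \<Delta> (p (xs ! i)) = ends \<Omega> (xs ! i)" if "i < length xs" for i
    using ends_p[of "xs ! i"] that by (simp add: subset_iff)
  then have "circle_traversal \<Delta> vs (map p xs)"
    using assms nodes_eq p_in xs by (auto simp: circle_traversal_def)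
  then show ?thesis unfolding circles_def by blast
qed

definition fiber where "fiber e = {x \<in> edges \<Omega>. p x = e}"

abbreviation tfiber where "tfiber x \<equiv> fiber (te x)"

lemma fiber_nonempty: "e \<in> edges \<Delta> \<Longrightarrow> fiber e \<noteq> {}"
  by (auto simp: fiber_def p_surj[symmetric])

definition lift where "lift \<sigma> \<longleftrightarrow> (\<forall>x\<in>N. \<sigma> x \<in> tfiber x)"

text \<open>Meaningful only for a cotree edge \<open>f\<close> and a lift \<open>\<sigma>\<close> of the tree.\<close>

definition closing where
  "closing f \<sigma> = (THE w. w \<in> fiber f \<and> insert w (\<sigma> ` chain f) \<in> balanced \<Omega>)"

lemma liftD: "lift \<sigma> \<Longrightarrow> x \<in> N \<Longrightarrow> \<sigma> x \<in> edges \<Omega> \<and> p (\<sigma> x) = te x"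
  by (auto simp: lift_def fiber_def)

lemma lift_upd: "lift \<sigma> \<Longrightarrow> y \<in> tfiber x \<Longrightarrow> lift (\<sigma>(x := y))"
  by (auto simp: lift_def)

lemma lift_exists: "\<exists>\<sigma>. lift \<sigma>"
proof -
  have "\<forall>x\<in>N. \<exists>y. y \<in> tfiber x" using fiber_nonempty te_in by blast
  then show ?thesis unfolding lift_def by metis
qed

lemma bij_lift:
  assumes "lift \<sigma>" "X \<subseteq> N"
  shows "bij_betw p (\<sigma> ` X) (te ` X)"
proof -
  have "p (\<sigma> x) = te x" if "x \<in> X" for x using liftD[OF assms(1)] that assms(2) by blast
  moreover have "inj_on te X" using te_inj assms(2) inj_on_subset by blast
  ultimately show ?thesis
    by (auto simp: bij_betw_def inj_on_def image_image)
qed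

lemma lift_edges: "lift \<sigma> \<Longrightarrow> X \<subseteq> N \<Longrightarrow> \<sigma> ` X \<subseteq> edges \<Omega>"
  using liftD by blast

lemma lift_inj: "lift \<sigma> \<Longrightarrow> inj_on \<sigma> N"
proof (rule inj_onI)
  fix x y assume \<sigma>: "lift \<sigma>" and xy: "x \<in> N" "y \<in> N" "\<sigma> x = \<sigma> y"
  then have "te x = te y" using liftD[OF \<sigma> xy(1)] liftD[OF \<sigma> xy(2)] by simp
  then show "x = y" using te_inj xy by (simp add: inj_on_eq_iff)
qed

lemma closing_unique: "f \<in> cotree \<Longrightarrow> lift \<sigma> \<Longrightarrow> \<exists>!w. w \<in> fiber f \<and> insert w (\<sigma> ` chain f) \<in> balanced \<Omega>"
proof -
  assume f: "f \<in> cotree" and \<sigma>: "lift \<sigma>"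
  have "insert f (te ` chain f) - {f} = te ` chain f"
    using f chain_sub[of f] by (auto simp: cotree_def)
  then show ?thesis
    using circle_lifting_unique[OF exp fundamental_circle[OF f], of f "\<sigma> ` chain f"]
      bij_lift[OF \<sigma> chain_sub] lift_edges[OF \<sigma> chain_sub]
    by (simp add: fiber_def conj_assoc)
qed

lemma closing_fiber: "f \<in> cotree \<Longrightarrow> lift \<sigma> \<Longrightarrow> closing f \<sigma> \<in> fiber f"
  and closing_balanced: "f \<in> cotree \<Longrightarrow> lift \<sigma> \<Longrightarrow> insert (closing f \<sigma>) (\<sigma> ` chain f) \<in> balanced \<Omega>"
  using theI'[OF closing_unique[of f \<sigma>]] by (auto simp: closing_def)

lemma closing_eqI:
  "f \<in> cotree \<Longrightarrow> lift \<sigma> \<Longrightarrow> w \<in> fiber f \<Longrightarrow> insert w (\<sigma> ` chain f) \<in> balanced \<Omega> \<Longrightarrow> closing f \<sigma> = w"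
  using the1_equality[OF closing_unique[of f \<sigma>]] by (auto simp: closing_def)

lemma closing_cong: "(\<And>x. x \<in> chain f \<Longrightarrow> \<sigma> x = \<sigma>' x) \<Longrightarrow> closing f \<sigma> = closing f \<sigma>'"
  unfolding closing_def by (metis (no_types, lifting) image_cong)

text \<open>The fundamental circle of \<open>f\<close> is lifted with \<open>te x\<close> instead of
  \<open>f\<close> as the missing edge. The closing edge and any single edge of the lifted chain
  thus determine each other, which later turns equal closing edges into equal gains.\<close>

lemma closing_solve:
  assumes f: "f \<in> cotree" and \<sigma>: "lift \<sigma>" and x: "x \<in> chain f" and w: "w \<in> fiber f"
  shows "\<exists>!y. y \<in> tfiber x \<and> closing f (\<sigma>(x := y)) = w"
proof -
  have xN: "x \<in> N" using x chain_sub by blast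
  let ?A = "chain f - {x}"
  have img: "(\<sigma>(x := y)) ` chain f = insert y (\<sigma> ` ?A)" for y
    using x by auto
  have f_tree: "f \<notin> te ` N" using f by (simp add: cotree_def)
  have wp: "w \<in> edges \<Omega>" "p w = f" using w by (auto simp: fiber_def)
  have A: "?A \<subseteq> N" using chain_sub by blast
  have eq: "insert f (te ` chain f) - {te x} = insert f (te ` ?A)"
  proof -
    have "te x \<notin> te ` ?A" using inj_on_image_mem_iff[OF te_inj xN, of ?A] A by blast
    moreover have "te ` chain f = insert (te x) (te ` ?A)" using x by blast
    moreover have "te x \<noteq> f" using f_tree xN by blast
    ultimately show ?thesis by blast
  qed
  have "bij_betw p (insert w (\<sigma> ` ?A)) (insert f (te ` ?A))"
  proof -
    have "f \<notin> te ` ?A" using f_tree A by blast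
    moreover have "w \<notin> \<sigma> ` ?A" using f_tree A liftD[OF \<sigma>] wp(2) by blast
    ultimately show ?thesis
      using notIn_Un_bij_betw[of w "\<sigma> ` ?A" p, OF _ _ bij_lift[OF \<sigma> A]] wp(2) by simp
  qed
  then have "\<exists>!y. y \<in> edges \<Omega> \<and> p y = te x \<and> insert y (insert w (\<sigma> ` ?A)) \<in> balanced \<Omega>"
    using circle_lifting_unique[OF exp fundamental_circle[OF f], of "te x" "insert w (\<sigma> ` ?A)"]
      wp lift_edges[OF \<sigma> A] x by (simp add: eq)
  moreover have "y \<in> edges \<Omega> \<and> p y = te x \<and> insert y (insert w (\<sigma> ` ?A)) \<in> balanced \<Omega>
      \<longleftrightarrow> y \<in> tfiber x \<and> closing f (\<sigma>(x := y)) = w" for y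
    using closing_eqI[OF f lift_upd[OF \<sigma>, of y x] w] closing_balanced[OF f lift_upd[OF \<sigma>, of y x]]
    unfolding img by (auto simp: fiber_def insert_commute)
  ultimately show ?thesis by simp
qed

text \<open>Induction on the number of cotree edges in \<open>C\<close>. Two of them cut the circle
  into arcs with node sets \<open>L\<close> and \<open>R\<close>. A tree path from one arc to the
  other forms a theta graph with \<open>C\<close>, and each of its two new circles avoids a cotree
  edge of \<open>C\<close>; both are balanced by induction, hence so is the lift of
  \<open>C\<close>.\<close>

lemma section_balanced:
  assumes s: "\<And>e. e \<in> edges \<Delta> \<Longrightarrow> s e \<in> fiber e"
    and bal: "\<And>f. f \<in> cotree \<Longrightarrow> insert (s f) ((s \<circ> te) ` chain f) \<in> balanced \<Omega>"
    and "C \<in> circles \<Delta>"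
  shows "s ` C \<in> balanced \<Omega>"
  using \<open>C \<in> circles \<Delta>\<close>
proof (induction "card (C - te ` N)" arbitrary: C rule: less_induct)
  case less
  note C = \<open>C \<in> circles \<Delta>\<close>
  have fin: "finite (C - te ` N)" using finite_circle[OF C] by simp
  have sub: "C \<subseteq> edges \<Delta>" using C by (auto simp: circles_def circle_traversal_def)
  have "\<not> C \<subseteq> te ` N" using te_ends C by (rule no_tree_circle)
  then have ne: "C - te ` N \<noteq> {}" by blast
  then obtain f where f: "f \<in> C" "f \<notin> te ` N" by auto
  show ?case
  proof (cases "C - te ` N = {f}")
    case True
    have "C = insert f (te ` chain f)"
      using fundamental_circle_unique[OF C True] sub f by blast
    then show ?thesis using bal[of f] f sub by (simp add: cotree_def image_comp subset_iff)
  next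
    case False
    then obtain g where g: "g \<in> C" "g \<notin> te ` N" "g \<noteq> f" using f by auto
    obtain vs es where c: "circle_traversal \<Delta> vs es" "set es = C" "last es = f"
      using circle_with_last[OF C f(1)] .
    define l where "l = length es"
    have len: "length vs = l" and dist: "distinct vs" "distinct es" and "es \<noteq> []"
      and nod: "set vs \<subseteq> V"
      and e: "\<And>i. i < l \<Longrightarrow> ends \<Delta> (es ! i) = {vs ! i, vs ! (Suc i mod l)}"
      using c(1) by (auto simp: circle_traversal_def l_def)
    have lastf: "es ! (l - 1) = f" using c(3) \<open>es \<noteq> []\<close> by (simp add: last_conv_nth l_def)
    obtain j where j: "j < l" "es ! j = g" using g(1) c(2) by (auto simp: in_set_conv_nth l_def)
    have jl: "Suc j < l" using j lastf g(3) by (cases "j = l - 1") auto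
    define L R where "L = set (take (Suc j) vs)" and "R = set (drop (Suc j) vs)"
    have LR: "L \<union> R = set vs" "L \<inter> R = {}"
      using dist(1) unfolding L_def R_def
      by (metis append_take_drop_id set_append, metis append_take_drop_id distinct_append)
    have inL: "vs ! i \<in> L" if "i \<le> j" for i
      using that jl len by (auto simp: L_def in_set_conv_nth intro!: exI[of _ i])
    have inR: "vs ! i \<in> R" if "j < i" "i < l" for i
      using that len by (auto simp: R_def in_set_conv_nth intro!: exI[of _ "i - Suc j"])
    \<comment> \<open>The circle passes between \<open>L\<close> and \<open>R\<close> only along
      \<open>g\<close> in position \<open>j\<close> and \<open>f\<close> in the last position, and
      neither is a tree edge.\<close>
    have sep: "ends \<Delta> e \<subseteq> L \<or> ends \<Delta> e \<subseteq> R" if eC: "e \<in> C" and eT: "e \<in> te ` N" for e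
    proof -
      obtain i where i: "i < l" "es ! i = e" using eC c(2) by (auto simp: in_set_conv_nth l_def)
      have "i \<noteq> j" "i \<noteq> l - 1" using i j lastf eT f g by auto
      then show ?thesis
        using e[OF i(1)] i inL[of i] inL[of "Suc i"] inR[of i] inR[of "Suc i"] by (cases "i < j") auto
    qed
    have ab: "vs ! 0 \<in> L" "vs ! (l - 1) \<in> R" using inL[of 0] inR[of "l - 1"] jl by auto
    then have "vs ! 0 \<in> V" "vs ! (l - 1) \<in> V" using LR nod by auto
    from tree_connected[OF this] obtain u w ps ds where
      uw: "u \<in> L" "w \<in> R" and pth: "path_between \<Delta> u ps ds w" and ds: "set ds \<subseteq> te ` N"
      and ps: "set ps \<inter> (L \<union> R) = {u, w}"
    proof (rule connecting_path[OF _ ab LR(2)])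
      show "te ` N \<subseteq> edges \<Delta>" using te_in by auto
      show "L \<subseteq> V" using LR nod by auto
      show "ends \<Delta> e \<subseteq> V" if "e \<in> te ` N" for e using that te_ends par_in by auto
    qed
    have uw': "u \<noteq> w" "u \<in> set vs" "w \<in> set vs" using uw LR by auto
    obtain vs1 es1 vs2 es2 where
      p1: "path_between \<Delta> u vs1 es1 w" and p2: "path_between \<Delta> u vs2 es2 w" and
      v12: "set vs1 \<inter> set vs2 = {u, w}" "set vs1 \<union> set vs2 = set vs" and
      e12: "set es1 \<inter> set es2 = {}" "set es1 \<union> set es2 = set es"
      using circle_split[OF c(1) uw'(2,3,1)] by metis
    \<comment> \<open>A common edge would have both ends in \<open>L\<close> or both in
      \<open>R\<close>, but the path has a single node in each.\<close>
    have disj: "set ds \<inter> C = {}"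
    proof (rule ccontr)
      assume "set ds \<inter> C \<noteq> {}"
      then obtain d where d: "d \<in> set ds" "d \<in> C" by auto
      then obtain x where x: "x \<in> N" "d = te x" using ds by auto
      have "ends \<Delta> d \<subseteq> L \<or> ends \<Delta> d \<subseteq> R" using sep[OF d(2)] d(1) ds by blast
      moreover have "ends \<Delta> d \<subseteq> {u, w}" using path_edge_ends[OF pth d(1)] ps calculation by blast
      moreover have "ends \<Delta> d = {x, par x}" "x \<noteq> par x" using te_ends x par_ne[OF x(1)] by auto
      ultimately show False using uw LR(2) by auto
    qed
    \<comment> \<open>Any path from \<open>L\<close> to \<open>R\<close> inside the circle uses an
      edge that \<open>sep\<close> excludes from the tree, so each side of the theta graph owns a
      cotree edge that the circle through the other side avoids.\<close>
    have cross: "set ds' - te ` N \<noteq> {}" if pd: "path_between \<Delta> u vs' ds' w" "set ds' \<subseteq> C" for vs' ds'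
    proof -
      have e': "\<And>i. i < length ds' \<Longrightarrow> ends \<Delta> (ds' ! i) = {vs' ! i, vs' ! Suc i}"
        using pd by (auto simp: path_between_def)
      have 0: "vs' ! 0 \<in> L" using path_nth_0[OF pd(1)] uw by simp
      have 1: "vs' ! length ds' \<notin> L" using path_nth_last[OF pd(1)] uw LR by auto
      have "\<exists>i<length ds'. vs' ! i \<in> L \<and> vs' ! Suc i \<notin> L"
      proof (rule ccontr)
        assume *: "\<not> ?thesis"
        have "i \<le> length ds' \<Longrightarrow> vs' ! i \<in> L" for i
          by (induction i) (use 0 * in \<open>auto simp: Suc_le_eq\<close>)
        then show False using 1 by blast
      qed
      then obtain i where i: "i < length ds'" "vs' ! i \<in> L" "vs' ! Suc i \<notin> L" by blast
      then have "ds' ! i \<in> C" using pd by auto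
      then have "ds' ! i \<notin> te ` N" using sep[of "ds' ! i"] e'[OF i(1)] i LR by auto
      then show ?thesis using i(1) by (metis Diff_iff empty_iff nth_mem)
    qed
    have smaller: "set ds \<union> set A \<in> circles \<Delta> \<and> s ` (set ds \<union> set A) \<in> balanced \<Omega>"
      if A: "path_between \<Delta> u V A w" "set V \<subseteq> set vs" "set A \<subseteq> C" "b \<in> C - te ` N" "b \<notin> set A" for V A b
    proof
      have "V \<noteq> []" "hd V = u" "last V = w" using A(1) by (auto simp: path_between_def)
      then have "{u, w} \<subseteq> set V" using hd_in_set[of V] last_in_set[of V] by simp
      then have "set ps \<inter> set V = {u, w}" using ps A(2) LR by blast
      then show *: "set ds \<union> set A \<in> circles \<Delta>"
        using circle_of_paths[OF pth A(1)] disj A(3) uw' by blast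
      have "(set ds \<union> set A) - te ` N \<subset> C - te ` N" using ds A by blast
      then have "card ((set ds \<union> set A) - te ` N) < card (C - te ` N)" using fin by (rule psubset_card_mono[rotated])
      then show "s ` (set ds \<union> set A) \<in> balanced \<Omega>" using less.hyps * by blast
    qed
    obtain b1 where b1: "b1 \<in> set es1" "b1 \<notin> te ` N" using cross[OF p1] e12 c(2) by blast
    obtain b2 where b2: "b2 \<in> set es2" "b2 \<notin> te ` N" using cross[OF p2] e12 c(2) by blast
    have bal1: "s ` (set ds \<union> set es1) \<in> balanced \<Omega>" "s ` (set ds \<union> set es2) \<in> balanced \<Omega>"
      using smaller[OF p1, of b2] smaller[OF p2, of b1] b1 b2 v12 e12 c(2) by blast+
    have p_s: "p (s e) = e" "s e \<in> edges \<Omega>" if "e \<in> edges \<Delta>" for e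
      using s[OF that] by (auto simp: fiber_def)
    have s_inj: "inj_on s (edges \<Delta>)" by (metis inj_onI p_s(1))
    have lifted: "path_between \<Omega> u V (map s A) w" if "path_between \<Delta> u V A w" for V A
      using that p_s ends_p nodes_eq by (auto simp: path_between_def subset_iff)
    have edg: "set ds \<subseteq> edges \<Delta>" "set es1 \<subseteq> edges \<Delta>" "set es2 \<subseteq> edges \<Delta>"
      using ds te_in e12 c(2) sub by auto
    have img: "set (map s A) \<inter> set (map s B) = {}"
      if "set A \<inter> set B = {}" "set A \<subseteq> edges \<Delta>" "set B \<subseteq> edges \<Delta>" for A B
      using that inj_on_image_Int[OF s_inj, of "set A" "set B"] by auto
    have "{u, w} \<subseteq> set vs1" "{u, w} \<subseteq> set vs2" using v12 by auto
    moreover have "set vs1 \<subseteq> L \<union> R" "set vs2 \<subseteq> L \<union> R" unfolding LR(1) v12(2)[symmetric] by blast+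
    ultimately have ps12: "set ps \<inter> set vs1 = {u, w}" "set ps \<inter> set vs2 = {u, w}"
      using ps by blast+
    have disjs: "set (map s ds) \<inter> set (map s es1) = {}" "set (map s ds) \<inter> set (map s es2) = {}"
      "set (map s es1) \<inter> set (map s es2) = {}"
      using img[OF _ edg(1,2)] img[OF _ edg(1,3)] img[OF e12(1) edg(2,3)] disj e12(2) c(2) by blast+
    have bals: "set (map s ds) \<union> set (map s es1) \<in> balanced \<Omega>"
      "set (map s ds) \<union> set (map s es2) \<in> balanced \<Omega>"
      using bal1 by (simp_all add: image_Un)
    have "set (map s es1) \<union> set (map s es2) \<in> balanced \<Omega>"
      by (rule biased_theta_third[OF biased lifted[OF pth] lifted[OF p1] lifted[OF p2]
            ps12 v12(1) disjs uw'(1) bals])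
    moreover have "set (map s es1) \<union> set (map s es2) = s ` C"
      unfolding set_map image_Un[symmetric] e12(2) c(2) ..
    ultimately show ?thesis by simp
  qed
qed

end

section \<open>Minors of order four\<close>

text \<open>Here \<open>h\<close> is a sequence along the traversal and not a function on nodes, so
  it need not close up; the product measures its failure to do so.\<close>

lemma gain_product_telescope:
  assumes "group G" "length vs = length xs"
    and h: "\<And>i. i \<le> length xs \<Longrightarrow> h i \<in> carrier G"
    and step: "\<And>i. i < length xs \<Longrightarrow>
      (if vs ! i = t (snd (xs ! i)) then fst (xs ! i) else inv\<^bsub>G\<^esub> (fst (xs ! i))) =
      inv\<^bsub>G\<^esub> (h i) \<otimes>\<^bsub>G\<^esub> h (Suc i)"
  shows "gain_product G t vs xs = inv\<^bsub>G\<^esub> (h 0) \<otimes>\<^bsub>G\<^esub> h (length xs)"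
proof -
  interpret group G by fact
  show ?thesis
    using assms(2) h step
  proof (induction xs arbitrary: vs h)
    case Nil
    then show ?case by (simp add: gain_product_def)
  next
    case (Cons x xs)
    then obtain v vs' where vs: "vs = v # vs'" by (cases vs) auto
    have h: "h 0 \<in> carrier G" "h (Suc 0) \<in> carrier G" "h (Suc (length xs)) \<in> carrier G"
      using Cons.prems(2) by auto
    have "gain_product G t vs' xs = inv\<^bsub>G\<^esub> (h (Suc 0)) \<otimes>\<^bsub>G\<^esub> h (Suc (length xs))"
      using Cons.IH[of vs' "\<lambda>i. h (Suc i)"] Cons.prems vs by force
    moreover have "gain_product G t vs (x # xs) =
      (if v = t (snd x) then fst x else inv\<^bsub>G\<^esub> (fst x)) \<otimes>\<^bsub>G\<^esub> gain_product G t vs' xs"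
      by (simp add: gain_product_def vs split_beta)
    moreover have "(if v = t (snd x) then fst x else inv\<^bsub>G\<^esub> (fst x)) = inv\<^bsub>G\<^esub> (h 0) \<otimes>\<^bsub>G\<^esub> h (Suc 0)"
      using Cons.prems(3)[of 0] vs by (simp cong: if_cong)
    moreover have "h (Suc 0) \<otimes>\<^bsub>G\<^esub> (inv\<^bsub>G\<^esub> (h (Suc 0)) \<otimes>\<^bsub>G\<^esub> h (Suc (length xs))) = h (Suc (length xs))"
      using h by (simp add: m_assoc[symmetric])
    ultimately show ?case using h by (simp add: m_assoc)
  qed
qed

lemma (in rooted_tree) tree_recursion:
  "\<exists>F. F r = b \<and> (\<forall>x\<in>V - {r}. F x = g x (F (par x)))"
proof -
  define F where "F = rec_nat (\<lambda>x. b) (\<lambda>n H x. g x (H (par x)))"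
  have "F (dep r) r = b" by (simp add: F_def dep_root)
  moreover have "F (dep x) x = g x (F (dep (par x)) (par x))" if "x \<in> V - {r}" for x
    using dep_par[OF that] by (simp add: F_def)
  ultimately show ?thesis by (intro exI[of _ "\<lambda>x. F (dep x) x"]) simp
qed

lemma (in rooted_tree) tree_induct [consumes 1, case_names root step]:
  assumes "x \<in> V" "R r" "\<And>x. x \<in> V - {r} \<Longrightarrow> R (par x) \<Longrightarrow> R x"
  shows "R x"
  using assms(1)
proof (induction "dep x" arbitrary: x rule: less_induct)
  case less
  then show ?case using assms(2,3) par_in dep_par by (cases "x = r") auto
qed

lemma node_class_eq: "(x, y) \<in> (adjacent_via \<Gamma> T)\<^sup>* \<Longrightarrow> node_class \<Gamma> T x = node_class \<Gamma> T y"
  unfolding node_class_def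
  by (auto intro: rtrancl_trans) (metis rtrancl_trans symD sym_adjacent_via sym_rtrancl)

lemma graph_minor_simps [simp]:
  "nodes (graph_minor \<Gamma> S T I) = node_class \<Gamma> T ` nodes \<Gamma> - I"
  "edges (graph_minor \<Gamma> S T I) = S"
  "ends (graph_minor \<Gamma> S T I) e = node_class \<Gamma> T ` ends \<Gamma> e"
  by (simp_all add: graph_minor_def)

lemma biased_minor_simps [simp]:
  "nodes (biased_minor \<Omega> S T I) = node_class \<Omega> T ` nodes \<Omega> - I"
  "edges (biased_minor \<Omega> S T I) = S"
  "ends (biased_minor \<Omega> S T I) e = node_class \<Omega> T ` ends \<Omega> e"
  by (simp_all add: biased_minor_def graph_minor_def multigraph.extend_def biased_graph.fields_def)

lemma circles_biased_minor: "circles (biased_minor \<Omega> S T I) = circles (graph_minor \<Omega> S T I)"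
  by (simp add: circles_def circle_traversal_def)

lemma balanced_biased_minor:
  "balanced (biased_minor \<Omega> S T I) =
    {C \<in> circles (biased_minor \<Omega> S T I). \<exists>B\<in>balanced \<Omega>. B \<subseteq> C \<union> T \<and> B - T = C}"
  unfolding circles_biased_minor
  by (simp add: biased_minor_def multigraph.extend_def biased_graph.fields_def)

lemma gain_expansion_simps [simp]:
  "nodes (gain_expansion G \<Delta> t) = nodes \<Delta>"
  "edges (gain_expansion G \<Delta> t) = carrier G \<times> edges \<Delta>"
  "ends (gain_expansion G \<Delta> t) x = ends \<Delta> (snd x)"
  by (simp_all add: gain_expansion_def multigraph.extend_def biased_graph.fields_def Let_def)

lemma balanced_gain_expansion:
  "balanced (gain_expansion G \<Delta> t) =
    {set xs | vs xs. circle_traversal (gain_expansion G \<Delta> t) vs xs \<and> gain_product G t vs xs = \<one>\<^bsub>G\<^esub>}"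
  by (simp add: gain_expansion_def multigraph.extend_def biased_graph.fields_def Let_def circle_traversal_def)

lemma traversal_map:
  assumes "nodes \<Gamma> = nodes \<Gamma>'" "inj_on \<theta> (edges \<Gamma>)" "\<theta> ` edges \<Gamma> \<subseteq> edges \<Gamma>'"
    and ends: "\<And>x. x \<in> edges \<Gamma> \<Longrightarrow> ends \<Gamma>' (\<theta> x) = ends \<Gamma> x"
    and c: "circle_traversal \<Gamma> vs xs"
  shows "circle_traversal \<Gamma>' vs (map \<theta> xs)"
proof -
  have sub: "set xs \<subseteq> edges \<Gamma>" using c by (simp add: circle_traversal_def)
  then have "inj_on \<theta> (set xs)" using assms(2) inj_on_subset by blast
  moreover have "\<theta> ` set xs \<subseteq> edges \<Gamma>'" using sub assms(3) by blast
  moreover have "ends \<Gamma>' (\<theta> (xs ! i)) = ends \<Gamma> (xs ! i)" if "i < length xs" for i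
    using ends sub that by (meson nth_mem subsetD)
  ultimately show ?thesis using c assms(1) by (simp add: circle_traversal_def distinct_map)
qed

lemma expansion_iso_traversal:
  assumes "expansion_iso \<theta> \<Omega> p \<Omega>' p'" "circle_traversal \<Omega> vs xs"
  shows "circle_traversal \<Omega>' vs (map \<theta> xs)"
  using assms by (intro traversal_map[of \<Omega> \<Omega>' \<theta>]) (auto simp: expansion_iso_def bij_betw_def)

lemma gain_expansion_fiber_bij:
  assumes iso: "expansion_iso \<theta> \<Omega> p (gain_expansion G \<Delta> t) snd" and e: "e \<in> edges \<Delta>"
  shows "bij_betw (\<lambda>x. fst (\<theta> x)) {x \<in> edges \<Omega>. p x = e} (carrier G)"
proof -
  have b: "bij_betw \<theta> (edges \<Omega>) (carrier G \<times> edges \<Delta>)"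
    and s: "\<And>x. x \<in> edges \<Omega> \<Longrightarrow> snd (\<theta> x) = p x"
    using iso by (auto simp: expansion_iso_def)
  show ?thesis
  proof (rule bij_betwI')
    fix x y assume xy: "x \<in> {x \<in> edges \<Omega>. p x = e}" "y \<in> {x \<in> edges \<Omega>. p x = e}"
    then have "\<theta> x = \<theta> y \<longleftrightarrow> x = y" using b by (auto simp: bij_betw_def inj_on_def)
    then show "fst (\<theta> x) = fst (\<theta> y) \<longleftrightarrow> x = y" using xy s by (auto simp: prod_eq_iff)
  next
    fix x assume "x \<in> {x \<in> edges \<Omega>. p x = e}"
    then have "\<theta> x \<in> carrier G \<times> edges \<Delta>" using b bij_betwE by fastforce
    then show "fst (\<theta> x) \<in> carrier G" by auto
  next
    fix g assume "g \<in> carrier G"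
    then have "(g, e) \<in> \<theta> ` edges \<Omega>" using b e by (simp add: bij_betw_def)
    then obtain x where "x \<in> edges \<Omega>" "\<theta> x = (g, e)" by auto
    then show "\<exists>x\<in>{x \<in> edges \<Omega>. p x = e}. g = fst (\<theta> x)" using s by force
  qed
qed

context tree_expansion
begin

text \<open>What a group expansion structure says about the minor that contracts
  \<open>\<sigma>\<close> on the tree edges outside \<open>K\<close>, expressed in
  \<open>\<Omega>\<close> itself. Gains are read upwards, from \<open>lo e\<close> to
  \<open>hi e\<close>. A potential on the nodes of the minor appears as an \<open>h\<close> on
  \<open>V\<close> that is constant along contracted edges. If the chain of \<open>f\<close> misses
  \<open>K\<close>, then \<open>f\<close> becomes a loop of the minor and nothing is claimed about
  its closing edge.\<close>

definition gains :: "('v \<Rightarrow> 'e) \<Rightarrow> 'v set \<Rightarrow> 'e monoid \<Rightarrow> ('f \<Rightarrow> 'e \<Rightarrow> 'e) \<Rightarrow> bool" where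
  "gains \<sigma> K G \<psi> \<longleftrightarrow> group G \<and>
    (\<forall>e\<in>edges \<Delta> - te ` (N - K). bij_betw (\<psi> e) (fiber e) (carrier G)) \<and>
    (\<forall>h f \<sigma>'. f \<in> cotree \<and> chain f \<inter> K \<noteq> {} \<and> h \<in> V \<rightarrow> carrier G \<and>
      (\<forall>x\<in>N - K. h (par x) = h x) \<and> lift \<sigma>' \<and> (\<forall>x\<in>N - K. \<sigma>' x = \<sigma> x) \<and>
      (\<forall>k\<in>K. \<psi> (te k) (\<sigma>' k) = inv\<^bsub>G\<^esub> (h k) \<otimes>\<^bsub>G\<^esub> h (par k)) \<longrightarrow>
      \<psi> f (closing f \<sigma>') = inv\<^bsub>G\<^esub> (h (lo f)) \<otimes>\<^bsub>G\<^esub> h (hi f))"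

text \<open>Contracting the tree edges outside \<open>K\<close> leaves one node for the root and one
  for each element of \<open>K\<close>, hence four. In the minor the fundamental circle of
  \<open>f\<close> shrinks to \<open>f\<close> and the chain edges in \<open>K\<close>. Two edges
  over \<open>f\<close> make its lift balanced, namely \<open>closing f \<sigma>'\<close> and the
  edge with the gain prescribed by \<open>h\<close>; unique lifting in the minor identifies
  them.\<close>

lemma minor_gains:
  assumes minors: "\<And>\<Omega>' \<Delta>'. expansion_minor \<Omega> \<Delta> p \<Omega>' \<Delta>' \<Longrightarrow> card (nodes \<Omega>') = 4 \<Longrightarrow>
           group_expansion \<Omega>' \<Delta>' p"
    and K: "K \<subseteq> N" "card K = 3" and \<sigma>: "lift \<sigma>"
  shows "\<exists>G \<psi>. gains \<sigma> K G \<psi>"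
proof -
  define R R' where "R = te ` (N - K)" and "R' = \<sigma> ` (N - K)"
  define S S' where "S = edges \<Delta> - R" and "S' = {x \<in> edges \<Omega>. p x \<in> S}"
  define \<Omega>' where "\<Omega>' = biased_minor \<Omega> S' R' {}"
  define \<Delta>' where "\<Delta>' = graph_minor \<Delta> S R {}"
  define c where "c = node_class \<Delta> R"
  have adj: "adjacent_via \<Omega> R' = adjacent_via \<Delta> R"
    using ends_p liftD[OF \<sigma>] by (auto simp: adjacent_via_def R_def R'_def)
  then have c': "node_class \<Omega> R' = c" by (simp add: c_def node_class_def fun_eq_iff)
  have \<Omega>'_simps: "nodes \<Omega>' = c ` V" "edges \<Omega>' = S'" "\<And>x. ends \<Omega>' x = c ` ends \<Omega> x"
    by (simp_all add: \<Omega>'_def c' nodes_eq)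
  have \<Delta>'_simps: "nodes \<Delta>' = c ` nodes \<Delta>" "edges \<Delta>' = S" "\<And>x. ends \<Delta>' x = c ` ends \<Delta> x"
    by (simp_all add: \<Delta>'_def c_def)
  \<comment> \<open>\<open>rep x\<close> is the first node of \<open>insert r K\<close> on the way
    up from \<open>x\<close>. It is constant on contraction classes, so the nodes of
    \<open>insert r K\<close> represent different classes.\<close>
  obtain rep where rep_r: "rep r = r" and rep: "\<And>x. x \<in> N \<Longrightarrow> rep x = (if x \<in> K then x else rep (par x))"
    using tree_recursion[of r "\<lambda>x y. if x \<in> K then x else y"] by blast
  have rep_K: "rep x = x" if "x \<in> insert r K" for x
    using that rep_r rep[of x] K(1) by (cases "x = r") auto
  have rep_in: "rep x \<in> insert r K" if "x \<in> V" for x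
    using that by (induction rule: tree_induct) (auto simp: rep_r rep)
  have rep_up: "(x, rep x) \<in> P\<^sup>*" if "x \<in> V" for x
    using that
  proof (induction rule: tree_induct)
    case (step x)
    then have "(x, par x) \<in> P" by (simp add: P_iff)
    then show ?case using step rep[of x] by (auto intro: converse_rtrancl_into_rtrancl)
  qed (simp add: rep_r)
  have c_par: "c x = c (par x)" if "x \<in> N - K" for x
    using that te_ends unfolding c_def
    by (intro node_class_eq r_into_rtrancl) (auto simp: adjacent_via_def R_def)
  have c_rep: "c x = c (rep x)" if "x \<in> V" for x
    using that by (induction rule: tree_induct) (use c_par in \<open>auto simp: rep_r rep\<close>)
  have rep_eq: "rep x = rep y" if "c x = c y" for x y
  proof -
    have "(x, y) \<in> (adjacent_via \<Delta> R)\<^sup>*" using that by (auto simp: c_def node_class_def)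
    then show ?thesis
    proof (induction rule: rtrancl_induct)
      case (step y z)
      then obtain w where "w \<in> N - K" "{y, z} = {w, par w}"
        using te_ends by (auto simp: adjacent_via_def R_def)
      then show ?case using step.IH rep[of w] by (auto simp: doubleton_eq_iff)
    qed simp
  qed
  have c_inj: "inj_on c (insert r K)"
  proof (rule inj_onI)
    fix x y assume "x \<in> insert r K" "y \<in> insert r K" "c x = c y"
    then show "x = y" using rep_eq[of x y] rep_K[of x] rep_K[of y] by simp
  qed
  have "c ` V = c ` insert r K"
  proof
    show "c ` V \<subseteq> c ` insert r K" using c_rep rep_in by (metis image_eqI image_subsetI)
    show "c ` insert r K \<subseteq> c ` V" using K(1) root_in by blast
  qed
  moreover have "card (insert r K) = 4"
  proof -
    have "finite K" using K(2) card.infinite by fastforce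
    moreover have "r \<notin> K" using K(1) by blast
    ultimately show ?thesis using K(2) by simp
  qed
  ultimately have "card (nodes \<Omega>') = 4" 
    unfolding \<Omega>'_simps using card_image[OF c_inj] by argo
  moreover have "expansion_minor \<Omega> \<Delta> p \<Omega>' \<Delta>'"
    unfolding expansion_minor_def
  proof (intro exI conjI)
    \<comment> \<open>A lift of tree edges contains no circle at all, so it is balanced
      vacuously.\<close>
    have "\<not> C \<subseteq> R'" if "C \<in> circles \<Omega>" for C
    proof -
      have "\<not> C \<subseteq> \<sigma> ` N"
        by (rule no_tree_circle[OF _ that]) (use ends_p liftD[OF \<sigma>] te_ends in auto)
      then show ?thesis by (auto simp: R'_def)
    qed
    then show "balanced_lift \<Omega> p R R'"
      using bij_lift[OF \<sigma>, of "N - K"] lift_edges[OF \<sigma>, of "N - K"]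
      by (auto simp: balanced_lift_def R_def R'_def)
    show "S \<union> R \<union> {} = edges \<Delta>" using te_in by (auto simp: S_def R_def)
    show "\<Omega>' = biased_minor \<Omega> {x \<in> edges \<Omega>. p x \<in> S} R' {}" by (simp add: \<Omega>'_def S'_def)
    show "\<Delta>' = graph_minor \<Delta> S R {}" by (simp add: \<Delta>'_def)
  qed (auto simp: S_def)
  ultimately have "group_expansion \<Omega>' \<Delta>' p" using minors by blast
  then obtain G :: "'e monoid" and t \<theta> where exp': "biased_expansion \<Omega>' \<Delta>' p"
    and G: "group G" and t: "orientation \<Delta>' t"
    and iso: "expansion_iso \<theta> \<Omega>' p (gain_expansion G \<Delta>' t) snd"
    by (auto simp: group_expansion_def)
  interpret group G by fact
  \<comment> \<open>\<open>\<gamma> A x\<close> is the gain of \<open>x\<close> traversed from the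
    node \<open>A\<close> of the minor. Starting at the lower end, \<open>\<psi>\<close> reorients
    the given gains upwards.\<close>
  define \<gamma> where "\<gamma> A x = (if A = t (p x) then fst (\<theta> x) else inv\<^bsub>G\<^esub> (fst (\<theta> x)))" for A x
  define \<psi> where "\<psi> e x = \<gamma> (c (lo e)) x" for e x
  have fst_bij: "bij_betw (\<lambda>x. fst (\<theta> x)) (fiber e) (carrier G)" if "e \<in> S" for e
  proof -
    have "fiber e = {x \<in> edges \<Omega>'. p x = e}" using that by (auto simp: fiber_def \<Omega>'_simps S'_def)
    then show ?thesis using gain_expansion_fiber_bij[OF iso, of e] that by (simp add: \<Delta>'_simps)
  qed
  have inv_bij: "bij_betw (\<lambda>g. inv\<^bsub>G\<^esub> g) (carrier G) (carrier G)"
    by (rule bij_betwI[where g = "\<lambda>g. inv\<^bsub>G\<^esub> g"]) auto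
  have \<psi>_bij: "bij_betw (\<psi> e) (fiber e) (carrier G)" if "e \<in> S" for e
  proof (cases "c (lo e) = t e")
    case True
    then have eq: "\<And>x. x \<in> fiber e \<Longrightarrow> \<psi> e x = fst (\<theta> x)" by (simp add: \<psi>_def \<gamma>_def fiber_def)
    show ?thesis using fst_bij[OF that] by (subst bij_betw_cong[OF eq])
  next
    case False
    then have eq: "\<And>x. x \<in> fiber e \<Longrightarrow> \<psi> e x = ((\<lambda>g. inv\<^bsub>G\<^esub> g) \<circ> (\<lambda>x. fst (\<theta> x))) x"
      by (simp add: \<psi>_def \<gamma>_def fiber_def)
    show ?thesis using bij_betw_trans[OF fst_bij[OF that] inv_bij] by (subst bij_betw_cong[OF eq])
  qed
  have main: "\<psi> f (closing f \<sigma>') = inv\<^bsub>G\<^esub> (h (lo f)) \<otimes>\<^bsub>G\<^esub> h (hi f)"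
    if f: "f \<in> cotree" "chain f \<inter> K \<noteq> {}" and h: "h \<in> V \<rightarrow> carrier G"
      "\<And>x. x \<in> N - K \<Longrightarrow> h (par x) = h x" and \<sigma>': "lift \<sigma>'" "\<And>x. x \<in> N - K \<Longrightarrow> \<sigma>' x = \<sigma> x"
      and hk: "\<And>k. k \<in> K \<Longrightarrow> \<psi> (te k) (\<sigma>' k) = inv\<^bsub>G\<^esub> (h k) \<otimes>\<^bsub>G\<^esub> h (par k)"
    for h f \<sigma>'
  proof -
    have fe: "f \<in> edges \<Delta>" "f \<notin> te ` N" using f(1) by (auto simp: cotree_def)
    have fS: "f \<in> S" using fe by (auto simp: S_def R_def)
    have teK: "te k \<in> S" "te k \<notin> R" if "k \<in> K" for k
    proof -
      show "te k \<notin> R"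
        using inj_on_image_mem_iff[OF te_inj, of k "N - K"] that K(1) by (auto simp: R_def)
      then show "te k \<in> S" using that K(1) te_in by (auto simp: S_def)
    qed
    define X where "X = chain f \<inter> K"
    have XN: "X \<subseteq> N" using K(1) by (auto simp: X_def)
    \<comment> \<open>The potential descends to the nodes of the minor.\<close>
    have h_eq: "h x = h y" if "c x = c y" "x \<in> V" "y \<in> V" for x y
    proof -
      have "h x = h (rep x)" if "x \<in> V" for x
        using that by (induction rule: tree_induct) (use h(2) in \<open>auto simp: rep_r rep\<close>)
      then show ?thesis using rep_eq[OF that(1)] that by metis
    qed
    have lh: "lo f \<in> V" "hi f \<in> V" using lo_hi_in[OF fe(1)] by auto
    have ends_f: "ends \<Delta>' f = {c (lo f), c (hi f)}" using lo_hi[OF fe(1)] by (simp add: \<Delta>'_simps)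
    have trav: "\<exists>ks. set ks = X \<and> circle_traversal \<Gamma> (map c (ks @ [hi f])) (map s ks @ [w]) \<and>
        (\<forall>i<length ks. c (par (ks ! i)) = c ((ks @ [hi f]) ! Suc i)) \<and> c (lo f) = c ((ks @ [hi f]) ! 0)"
      if s: "inj_on s K" "w \<notin> s ` K" "\<And>k. k \<in> K \<Longrightarrow> ends \<Gamma> (s k) = {c k, c (par k)}"
        "w \<in> edges \<Gamma>" "ends \<Gamma> w = {c (lo f), c (hi f)}" "s ` K \<subseteq> edges \<Gamma>" "nodes \<Gamma> = c ` V"
      for \<Gamma> :: "('v set, 'z, 'm) multigraph_scheme" and s w
    proof -
      have n1: "c k \<noteq> c (hi f)" if "k \<in> K" "(k, hi f) \<in> P\<^sup>+" for k
      proof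
        assume "c k = c (hi f)"
        then have "rep (hi f) = k" using rep_eq[of k "hi f"] rep_K[of k] that by simp
        then have "(hi f, k) \<in> P\<^sup>*" using rep_up[OF lh(2)] by simp
        then show False using dep_rtrancl dep_trancl[OF that(2)] by fastforce
      qed
      have n2: "X = {z \<in> K. (lo f, z) \<in> P\<^sup>* \<and> (z, hi f) \<in> P\<^sup>+}" by (auto simp: X_def chain_def)
      have n3: "inj_on c K" using c_inj by (rule inj_on_subset) auto
      have n4: "c ` insert (hi f) K \<subseteq> nodes \<Gamma>" using s(7) K(1) lh by auto
      show ?thesis
      proof (rule contracted_fundamental_traversal[of "lo f" "hi f" K c X s w \<Gamma>])
        show "(lo f, hi f) \<in> P\<^sup>*" using lo_hi(2)[OF fe(1)] .
        show "c x = c (par x)" if "x \<in> N - K" for x using c_par[OF that] .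
      qed (fact n1 n2 n3 n4 s | blast)+
    qed
    have trav_\<Omega>: "\<exists>ks. set ks = X \<and> circle_traversal \<Omega>' (map c (ks @ [hi f])) (map \<sigma>' ks @ [w]) \<and>
        (\<forall>i<length ks. c (par (ks ! i)) = c ((ks @ [hi f]) ! Suc i)) \<and> c (lo f) = c ((ks @ [hi f]) ! 0)"
      if "w \<in> fiber f" for w
    proof (rule trav)
      show "inj_on \<sigma>' K" using lift_inj[OF \<sigma>'(1)] K(1) inj_on_subset by blast
      have w: "w \<in> edges \<Omega>" "p w = f" using that by (auto simp: fiber_def)
      show "w \<notin> \<sigma>' ` K" using liftD[OF \<sigma>'(1)] K(1) w fe by auto
      show "ends \<Omega>' (\<sigma>' k) = {c k, c (par k)}" if "k \<in> K" for k
      proof -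
        have "k \<in> N" using that K(1) by blast
        then show ?thesis using liftD[OF \<sigma>'(1), of k] te_ends[of k] by (simp add: \<Omega>'_simps ends_p)
      qed
      show "w \<in> edges \<Omega>'" using w fS by (simp add: \<Omega>'_simps S'_def)
      show "ends \<Omega>' w = {c (lo f), c (hi f)}" using w ends_p lo_hi[OF fe(1)] by (simp add: \<Omega>'_simps)
      show "\<sigma>' ` K \<subseteq> edges \<Omega>'" 
      proof
        fix x assume "x \<in> \<sigma>' ` K"
        then obtain k where "k \<in> K" "x = \<sigma>' k" by blast
        moreover from this have "k \<in> N" using K(1) by blast
        ultimately show "x \<in> edges \<Omega>'"
          using liftD[OF \<sigma>'(1), of k] teK[of k] by (simp add: \<Omega>'_simps S'_def)
      qed
      show "nodes \<Omega>' = c ` V" by (simp add: \<Omega>'_simps)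
    qed
    have circ_\<Delta>: "insert f (te ` X) \<in> circles \<Delta>'"
    proof -
      have "\<exists>ks. set ks = X \<and> circle_traversal \<Delta>' (map c (ks @ [hi f])) (map te ks @ [f]) \<and>
        (\<forall>i<length ks. c (par (ks ! i)) = c ((ks @ [hi f]) ! Suc i)) \<and> c (lo f) = c ((ks @ [hi f]) ! 0)"
      proof (rule trav)
        show "inj_on te K" using te_inj K(1) inj_on_subset by blast
        show "ends \<Delta>' (te k) = {c k, c (par k)}" if "k \<in> K" for k
        proof -
          have "k \<in> N" using that K(1) by blast
          then show ?thesis using te_ends[of k] by (simp add: \<Delta>'_simps)
        qed
      qed (use fe fS ends_f teK K in \<open>auto simp: \<Delta>'_simps\<close>)
      then obtain ks where "set (map te ks @ [f]) = insert f (te ` X)"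
        "circle_traversal \<Delta>' (map c (ks @ [hi f])) (map te ks @ [f])" by auto
      then show ?thesis unfolding circles_def by (metis (mono_tags, lifting) mem_Collect_eq)
    qed
    have "inv\<^bsub>G\<^esub> (h (lo f)) \<otimes>\<^bsub>G\<^esub> h (hi f) \<in> \<psi> f ` fiber f"
      using Pi_mem[OF h(1) lh(1)] Pi_mem[OF h(1) lh(2)] bij_betw_imp_surj_on[OF \<psi>_bij[OF fS]] by simp
    \<comment> \<open>The candidate with the prescribed gain; it remains to prove
      \<open>closing f \<sigma>' = w\<close>.\<close>
    then obtain w where w: "w \<in> fiber f" "\<psi> f w = inv\<^bsub>G\<^esub> (h (lo f)) \<otimes>\<^bsub>G\<^esub> h (hi f)"
      by (metis imageE)
    obtain ks where ks: "set ks = X" and ct: "circle_traversal \<Omega>' (map c (ks @ [hi f])) (map \<sigma>' ks @ [w])"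
      and next_k: "\<And>i. i < length ks \<Longrightarrow> c (par (ks ! i)) = c ((ks @ [hi f]) ! Suc i)"
      and first_k: "c (lo f) = c ((ks @ [hi f]) ! 0)"
      using trav_\<Omega>[OF w(1)] by blast
    define L where "L = length ks"
    have L: "0 < L" using ks f(2) by (auto simp: X_def L_def)
    define b where "b = ks @ [hi f]"
    have b_nodes: "b ! i \<in> V" if "i \<le> L" for i
    proof -
      have "set b \<subseteq> V" using ks XN lh by (auto simp: b_def)
      moreover have "i < length b" using that by (simp add: b_def L_def)
      ultimately show ?thesis by (meson nth_mem subsetD)
    qed
    have bal_w: "insert w (\<sigma>' ` X) \<in> balanced \<Omega>'"
    proof -
      let ?xs = "map \<sigma>' ks @ [w]"
      \<comment> \<open>The potentials met around the circle. After the closing edge the index wraps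
        to the start, which makes the telescoped product the unit.\<close>
      let ?hh = "\<lambda>i. h (b ! (i mod Suc L))"
      have len: "length ?xs = Suc L" by (simp add: L_def)
      have "distinct (map c b)" using ct by (simp add: circle_traversal_def b_def)
      then have "map c b ! 0 \<noteq> map c b ! L" using L nth_eq_iff_index_eq[of "map c b" 0 L] by (simp add: b_def L_def)
      \<comment> \<open>As \<open>f\<close> is not a loop of the minor, reading it downwards inverts
        its gain; a loop would always be read in its fixed direction.\<close>
      then have ne: "c (lo f) \<noteq> c (hi f)" using first_k L by (simp add: b_def L_def nth_append)
      have "gain_product G t (map c b) (map \<theta> ?xs) = inv\<^bsub>G\<^esub> (?hh 0) \<otimes>\<^bsub>G\<^esub> ?hh (length (map \<theta> ?xs))"
      proof (rule gain_product_telescope[OF G])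
        show "length (map c b) = length (map \<theta> ?xs)" by (simp add: b_def)
        show "?hh i \<in> carrier G" if "i \<le> length (map \<theta> ?xs)" for i
          by (rule Pi_mem[OF h(1)], rule b_nodes) (simp add: less_Suc_eq_le[symmetric])
        fix i assume "i < length (map \<theta> ?xs)"
        then have i: "i \<le> L" by (simp add: L_def)
        have snd\<theta>: "snd (\<theta> (?xs ! i)) = p (?xs ! i)"
        proof -
          have "?xs ! i \<in> edges \<Omega>'"
            using ct len i unfolding circle_traversal_def by (metis less_Suc_eq_le nth_mem subsetD)
          then show ?thesis using iso by (simp add: expansion_iso_def)
        qed
        have "\<gamma> (c (b ! i)) (?xs ! i) = inv\<^bsub>G\<^esub> (h (b ! i)) \<otimes>\<^bsub>G\<^esub> h (b ! (Suc i mod Suc L))"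
        proof (cases "i < L")
          case True
          define k where "k = ks ! i"
          have "k \<in> set ks" using True by (simp add: L_def k_def)
          then have k: "k \<in> K" using ks by (simp add: X_def)
          have "c (par k) = c (b ! Suc i)" using next_k[of i] True by (simp add: L_def k_def b_def)
          moreover have "par k \<in> V" using par_in[of k] k K(1) by blast
          moreover have "b ! Suc i \<in> V" using b_nodes[of "Suc i"] True by simp
          ultimately have "h (par k) = h (b ! Suc i)" by (rule h_eq)
          moreover have "k \<in> N" using k K(1) by blast
          then have "\<gamma> (c k) (\<sigma>' k) = \<psi> (te k) (\<sigma>' k)" using lo_te[of k] by (simp add: \<psi>_def)
          moreover have "b ! i = k" "?xs ! i = \<sigma>' k" "Suc i mod Suc L = Suc i"
            using True by (simp_all add: b_def nth_append k_def L_def)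
          ultimately show ?thesis using hk[OF k] by simp
        next
          case False
          then have iL: "i = L" using i by simp
          have pw: "p w = f" using w(1) by (simp add: fiber_def)
          have "fst (\<theta> w) \<in> carrier G" using fst_bij[OF fS] w(1) bij_betwE by fastforce
          moreover have "t f \<in> {c (lo f), c (hi f)}"
            using t fS ends_f by (auto simp: orientation_def \<Delta>'_simps)
          ultimately have "\<gamma> (c (hi f)) w = inv\<^bsub>G\<^esub> (\<gamma> (c (lo f)) w)"
            using ne by (auto simp: \<gamma>_def pw)
          also have "\<dots> = inv\<^bsub>G\<^esub> (inv\<^bsub>G\<^esub> (h (lo f)) \<otimes>\<^bsub>G\<^esub> h (hi f))"
            using w(2) by (simp add: \<psi>_def)
          also have "\<dots> = inv\<^bsub>G\<^esub> (h (hi f)) \<otimes>\<^bsub>G\<^esub> h (lo f)"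
            using Pi_mem[OF h(1) lh(1)] Pi_mem[OF h(1) lh(2)] by (simp add: inv_mult_group)
          also have "h (lo f) = h (b ! 0)"
            using first_k b_nodes[of 0] by (intro h_eq) (simp_all add: b_def lh)
          finally have "\<gamma> (c (hi f)) w = inv\<^bsub>G\<^esub> (h (hi f)) \<otimes>\<^bsub>G\<^esub> h (b ! 0)" .
          moreover have "b ! i = hi f" "?xs ! i = w" "Suc i mod Suc L = 0"
            using iL by (simp_all add: b_def nth_append L_def)
          ultimately show ?thesis by simp
        qed
        moreover have "i mod Suc L = i" using i by simp
        moreover have "map c b ! i = c (b ! i)" using i by (simp add: b_def L_def del: map_append)
        moreover have "map \<theta> ?xs ! i = \<theta> (?xs ! i)" using i len by (intro nth_map) simp
        ultimately show "(if map c b ! i = t (snd (map \<theta> ?xs ! i)) then fst (map \<theta> ?xs ! i)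
             else inv\<^bsub>G\<^esub> (fst (map \<theta> ?xs ! i))) = inv\<^bsub>G\<^esub> (?hh i) \<otimes>\<^bsub>G\<^esub> ?hh (Suc i)"
          by (simp only: snd\<theta> \<gamma>_def)
      qed
      also have "\<dots> = \<one>\<^bsub>G\<^esub>" using Pi_mem[OF h(1) b_nodes[of 0]] by (simp add: L_def)
      finally have "gain_product G t (map c b) (map \<theta> ?xs) = \<one>\<^bsub>G\<^esub>" .
      then have "set (map \<theta> ?xs) \<in> balanced (gain_expansion G \<Delta>' t)"
        using expansion_iso_traversal[OF iso ct] unfolding balanced_gain_expansion b_def by blast
      moreover have "set ?xs \<in> circles \<Omega>'" using ct unfolding circles_def by blast
      ultimately have "set ?xs \<in> balanced \<Omega>'"
        using iso unfolding expansion_iso_def by (metis list.set_map)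
      then show ?thesis using ks by simp
    qed
    \<comment> \<open>The balanced fundamental circle of \<open>\<Omega>\<close> consists of this
      smaller circle and edges of the contracted lift, which is the criterion for balance in a
      minor.\<close>
    have bal_Q: "insert (closing f \<sigma>') (\<sigma>' ` X) \<in> balanced \<Omega>'"
    proof -
      have q: "closing f \<sigma>' \<in> fiber f" using closing_fiber[OF f(1) \<sigma>'(1)] .
      obtain ks' where "set ks' = X" "circle_traversal \<Omega>' (map c (ks' @ [hi f])) (map \<sigma>' ks' @ [closing f \<sigma>'])"
        using trav_\<Omega>[OF q] by blast
      moreover from this have "set (map \<sigma>' ks' @ [closing f \<sigma>']) = insert (closing f \<sigma>') (\<sigma>' ` X)" by simp
      ultimately have circ: "insert (closing f \<sigma>') (\<sigma>' ` X) \<in> circles \<Omega>'"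
        unfolding circles_def by (metis (mono_tags, lifting) mem_Collect_eq)
      have pR: "p x \<in> R" if "x \<in> R'" for x using that liftD[OF \<sigma>] by (auto simp: R_def R'_def)
      have "closing f \<sigma>' \<notin> R'" using pR[of "closing f \<sigma>'"] q fS by (auto simp: fiber_def S_def)
      moreover have "\<sigma>' k \<notin> R'" if "k \<in> X" for k
      proof -
        have "k \<in> K" "k \<in> N" using that XN by (auto simp: X_def)
        then show ?thesis using pR[of "\<sigma>' k"] liftD[OF \<sigma>'(1), of k] teK(2)[of k] by auto
      qed
      moreover have "\<sigma>' ` (chain f - K) \<subseteq> R'"
        using \<sigma>'(2) chain_sub[of f] by (auto simp: R'_def)
      moreover have "\<sigma>' ` chain f = \<sigma>' ` X \<union> \<sigma>' ` (chain f - K)" by (auto simp: X_def)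
      ultimately have "insert (closing f \<sigma>') (\<sigma>' ` chain f) \<subseteq> insert (closing f \<sigma>') (\<sigma>' ` X) \<union> R'"
        "insert (closing f \<sigma>') (\<sigma>' ` chain f) - R' = insert (closing f \<sigma>') (\<sigma>' ` X)" by blast+
      then show ?thesis
        using closing_balanced[OF f(1) \<sigma>'(1)] circ unfolding \<Omega>'_def balanced_biased_minor by blast
    qed
    have "\<sigma>' ` X \<subseteq> edges \<Omega>'" using ct ks by (auto simp: circle_traversal_def)
    moreover have "insert f (te ` X) - {f} = te ` X" using fe XN by auto
    ultimately have "\<exists>!x. x \<in> edges \<Omega>' \<and> p x = f \<and> insert x (\<sigma>' ` X) \<in> balanced \<Omega>'"
      using circle_lifting_unique[OF exp' circ_\<Delta>, of f "\<sigma>' ` X"] bij_lift[OF \<sigma>'(1) XN]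
        \<open>\<sigma>' ` X \<subseteq> edges \<Omega>'\<close> by simp
    moreover have "x \<in> edges \<Omega>' \<and> p x = f" if "x \<in> fiber f" for x
      using that fS by (auto simp: fiber_def \<Omega>'_simps S'_def)
    ultimately have "closing f \<sigma>' = w"
      using bal_w bal_Q w(1) closing_fiber[OF f(1) \<sigma>'(1)] by blast
    then show ?thesis using w(2) by simp
  qed
  show ?thesis
    unfolding gains_def
  proof (intro exI conjI allI impI)
    show "group G" by (fact G)
    show "\<forall>e\<in>edges \<Delta> - te ` (N - K). bij_betw (\<psi> e) (fiber e) (carrier G)"
      using \<psi>_bij by (simp add: S_def R_def)
    fix h f \<sigma>'
    assume *: "f \<in> cotree \<and> chain f \<inter> K \<noteq> {} \<and> h \<in> V \<rightarrow> carrier G \<and>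
      (\<forall>x\<in>N - K. h (par x) = h x) \<and> lift \<sigma>' \<and> (\<forall>x\<in>N - K. \<sigma>' x = \<sigma> x) \<and>
      (\<forall>k\<in>K. \<psi> (te k) (\<sigma>' k) = inv\<^bsub>G\<^esub> (h k) \<otimes>\<^bsub>G\<^esub> h (par k))"
    show "\<psi> f (closing f \<sigma>') = inv\<^bsub>G\<^esub> (h (lo f)) \<otimes>\<^bsub>G\<^esub> h (hi f)"
      by (rule main) (use * in blast)+
  qed
qed

end

section \<open>Group operations recovered from a relation on pairs\<close>

lemma (in group) inv_cancel_left [simp]:
  "x \<in> carrier G \<Longrightarrow> y \<in> carrier G \<Longrightarrow> inv x \<otimes> (x \<otimes> y) = y"
  "x \<in> carrier G \<Longrightarrow> y \<in> carrier G \<Longrightarrow> x \<otimes> (inv x \<otimes> y) = y"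
  by (simp_all add: m_assoc[symmetric])

text \<open>
  For maps \<open>\<psi>\<^sub>a\<close>, \<open>\<psi>\<^sub>b\<close> into a group, the partition of pairs by the value of
  \<open>\<psi>\<^sub>b y \<psi>\<^sub>a x\<close> determines the group operations transported along \<open>\<psi>\<^sub>a\<close> and \<open>\<psi>\<^sub>b\<close>
  with prescribed units \<open>s\<close> and \<open>t\<close>.
\<close>

lemma (in group) op_upper_iff:
  assumes a: "bij_betw \<psi>a A (carrier G)" and b: "bij_betw \<psi>b B (carrier G)"
    and st: "s \<in> A" "t \<in> B" and uvw: "u \<in> A" "v \<in> A" "w \<in> A"
  shows "\<psi>a u \<otimes> (inv (\<psi>a s) \<otimes> \<psi>a v) = \<psi>a w \<longleftrightarrow>
    (\<exists>y\<in>B. \<psi>b y \<otimes> \<psi>a s = \<psi>b t \<otimes> \<psi>a u \<and> \<psi>b y \<otimes> \<psi>a v = \<psi>b t \<otimes> \<psi>a w)"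
proof -
  have ca: "\<psi>a x \<in> carrier G" if "x \<in> A" for x using a that bij_betwE by blast
  have cb: "\<psi>b x \<in> carrier G" if "x \<in> B" for x using b that bij_betwE by blast
  note c = ca[OF st(1)] cb[OF st(2)] ca[OF uvw(1)] ca[OF uvw(2)] ca[OF uvw(3)]
  have "\<psi>b t \<otimes> \<psi>a u \<otimes> inv (\<psi>a s) \<in> \<psi>b ` B" using c b by (simp add: bij_betw_imp_surj_on)
  then obtain y where y: "y \<in> B" "\<psi>b y = \<psi>b t \<otimes> \<psi>a u \<otimes> inv (\<psi>a s)" by (metis imageE)
  have iff: "\<psi>b z \<otimes> \<psi>a s = \<psi>b t \<otimes> \<psi>a u \<longleftrightarrow> \<psi>b z = \<psi>b y" if "z \<in> B" for z
    using c cb[OF that] y(2) by (metis inv_solve_right m_closed)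
  have "\<psi>b y \<otimes> \<psi>a v = \<psi>b t \<otimes> (\<psi>a u \<otimes> (inv (\<psi>a s) \<otimes> \<psi>a v))"
    using c y(2) by (simp add: m_assoc)
  then have "\<psi>b y \<otimes> \<psi>a v = \<psi>b t \<otimes> \<psi>a w \<longleftrightarrow> \<psi>a u \<otimes> (inv (\<psi>a s) \<otimes> \<psi>a v) = \<psi>a w"
    using c by simp
  then show ?thesis using iff y(1) by metis
qed

text \<open>Mirror image of \<open>op_upper_iff\<close>: the factor
  \<open>inv (\<psi>b t) \<otimes> \<psi>b v\<close> is handed to an upper edge \<open>x\<close>,
  and from there it is applied to \<open>u\<close>.\<close>

lemma (in group) op_lower_iff:
  assumes a: "bij_betw \<psi>a A (carrier G)" and b: "bij_betw \<psi>b B (carrier G)"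
    and st: "s \<in> A" "t \<in> B" and uvw: "u \<in> B" "v \<in> B" "w \<in> B"
  shows "\<psi>b u \<otimes> (inv (\<psi>b t) \<otimes> \<psi>b v) = \<psi>b w \<longleftrightarrow>
    (\<exists>x\<in>A. \<psi>b t \<otimes> \<psi>a x = \<psi>b v \<otimes> \<psi>a s \<and> \<psi>b u \<otimes> \<psi>a x = \<psi>b w \<otimes> \<psi>a s)"
proof -
  have ca: "\<psi>a x \<in> carrier G" if "x \<in> A" for x using a that bij_betwE by blast
  have cb: "\<psi>b x \<in> carrier G" if "x \<in> B" for x using b that bij_betwE by blast
  note c = ca[OF st(1)] cb[OF st(2)] cb[OF uvw(1)] cb[OF uvw(2)] cb[OF uvw(3)]
  have "inv (\<psi>b t) \<otimes> (\<psi>b v \<otimes> \<psi>a s) \<in> \<psi>a ` A" using c a by (simp add: bij_betw_imp_surj_on)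
  then obtain x where x: "x \<in> A" "\<psi>a x = inv (\<psi>b t) \<otimes> (\<psi>b v \<otimes> \<psi>a s)" by (metis imageE)
  have iff: "\<psi>b t \<otimes> \<psi>a z = \<psi>b v \<otimes> \<psi>a s \<longleftrightarrow> \<psi>a z = \<psi>a x" if "z \<in> A" for z
    using c ca[OF that] x(2) by (metis inv_solve_left m_closed)
  have "\<psi>b u \<otimes> \<psi>a x = (\<psi>b u \<otimes> (inv (\<psi>b t) \<otimes> \<psi>b v)) \<otimes> \<psi>a s"
    using c x(2) by (simp add: m_assoc)
  then have "\<psi>b u \<otimes> \<psi>a x = \<psi>b w \<otimes> \<psi>a s \<longleftrightarrow> \<psi>b u \<otimes> (inv (\<psi>b t) \<otimes> \<psi>b v) = \<psi>b w"
    using c by simp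
  then show ?thesis using iff x(1) by metis
qed

text \<open>Up to an isomorphism that is never written down, \<open>\<phi>a x\<close> is
  \<open>\<psi>a x \<otimes> inv (\<psi>a s)\<close>, as \<open>\<phi>a\<close> respects the
  operation with unit \<open>s\<close>. The choice of \<open>X\<close> makes
  \<open>\<phi>a (X y)\<close> correspond to \<open>inv (\<psi>b t) \<otimes> \<psi>b y\<close>.
  Then the product of \<open>\<phi>a (X y)\<close> and \<open>\<phi>a x\<close> corresponds to
  \<open>\<psi>b y \<otimes> \<psi>a x\<close> between two fixed outer factors, which cancel in
  equations.\<close>

lemma (in group) transported_product:
  assumes a: "bij_betw \<psi>a A (carrier G)" and b: "bij_betw \<psi>b B (carrier G)"
    and st: "s \<in> A" "t \<in> B" and \<phi>: "bij_betw \<phi>a A (carrier H)" "\<phi>a s = \<one>\<^bsub>H\<^esub>"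
    and X: "\<And>y. y \<in> B \<Longrightarrow> X y \<in> A \<and> \<psi>b t \<otimes> \<psi>a (X y) = \<psi>b y \<otimes> \<psi>a s"
    and op: "\<And>u v w. u \<in> A \<Longrightarrow> v \<in> A \<Longrightarrow> w \<in> A \<Longrightarrow> \<phi>a u \<otimes>\<^bsub>H\<^esub> \<phi>a v = \<phi>a w \<longleftrightarrow>
      \<psi>a u \<otimes> (inv (\<psi>a s) \<otimes> \<psi>a v) = \<psi>a w"
  shows "bij_betw (\<lambda>y. \<phi>a (X y)) B (carrier H)"
    and "\<phi>a (X t) = \<one>\<^bsub>H\<^esub>"
    and "\<And>u v w. u \<in> B \<Longrightarrow> v \<in> B \<Longrightarrow> w \<in> B \<Longrightarrow> \<phi>a (X u) \<otimes>\<^bsub>H\<^esub> \<phi>a (X v) = \<phi>a (X w) \<longleftrightarrow>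
      \<psi>b u \<otimes> (inv (\<psi>b t) \<otimes> \<psi>b v) = \<psi>b w"
    and "\<And>x x' y y'. x \<in> A \<Longrightarrow> x' \<in> A \<Longrightarrow> y \<in> B \<Longrightarrow> y' \<in> B \<Longrightarrow>
      \<phi>a (X y) \<otimes>\<^bsub>H\<^esub> \<phi>a x = \<phi>a (X y') \<otimes>\<^bsub>H\<^esub> \<phi>a x' \<longleftrightarrow>
      \<psi>b y \<otimes> \<psi>a x = \<psi>b y' \<otimes> \<psi>a x'"
proof -
  have ca: "\<psi>a x \<in> carrier G" if "x \<in> A" for x using a that bij_betwE by blast
  have cb: "\<psi>b x \<in> carrier G" if "x \<in> B" for x using b that bij_betwE by blast
  have ia: "\<psi>a x = \<psi>a y \<longleftrightarrow> x = y" if "x \<in> A" "y \<in> A" for x y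
    using a that by (auto simp: bij_betw_def inj_on_def)
  have ib: "\<psi>b x = \<psi>b y \<longleftrightarrow> x = y" if "x \<in> B" "y \<in> B" for x y
    using b that by (auto simp: bij_betw_def inj_on_def)
  note c = ca[OF st(1)] cb[OF st(2)]
  have XA: "X y \<in> A" if "y \<in> B" for y using X that by blast
  have \<psi>X: "\<psi>a (X y) = inv (\<psi>b t) \<otimes> (\<psi>b y \<otimes> \<psi>a s)" if "y \<in> B" for y
  proof -
    have "inv (\<psi>b t) \<otimes> (\<psi>b t \<otimes> \<psi>a (X y)) = inv (\<psi>b t) \<otimes> (\<psi>b y \<otimes> \<psi>a s)"
      using X[OF that] by simp
    then show ?thesis using c ca[OF XA[OF that]] by simp
  qed
  have "bij_betw X B A"
  proof (rule bij_betwI')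
    show "X x = X y \<longleftrightarrow> x = y" if "x \<in> B" "y \<in> B" for x y
    proof
      assume "X x = X y"
      then have "inv (\<psi>b t) \<otimes> (\<psi>b x \<otimes> \<psi>a s) = inv (\<psi>b t) \<otimes> (\<psi>b y \<otimes> \<psi>a s)"
        using \<psi>X that by metis
      then show "x = y" using c cb that ib by simp
    qed simp
    show "X x \<in> A" if "x \<in> B" for x using XA[OF that] .
    fix x assume x: "x \<in> A"
    have "\<psi>b t \<otimes> (\<psi>a x \<otimes> inv (\<psi>a s)) \<in> \<psi>b ` B"
      using c ca[OF x] b by (simp add: bij_betw_imp_surj_on)
    then obtain y where y: "y \<in> B" "\<psi>b y = \<psi>b t \<otimes> (\<psi>a x \<otimes> inv (\<psi>a s))" by (metis imageE)
    have "\<psi>a (X y) = \<psi>a x" using \<psi>X[OF y(1)] y(2) c ca[OF x] by (simp add: m_assoc)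
    then show "\<exists>y\<in>B. x = X y" using ia[OF XA[OF y(1)] x] y(1) by auto
  qed
  then show "bij_betw (\<lambda>y. \<phi>a (X y)) B (carrier H)"
    using bij_betw_trans[OF _ \<phi>(1)] by (simp add: o_def)
  have "\<psi>a (X t) = \<psi>a s" using \<psi>X[OF st(2)] c by simp
  then show "\<phi>a (X t) = \<one>\<^bsub>H\<^esub>" using ia[OF XA[OF st(2)] st(1)] \<phi>(2) by simp
  show "\<phi>a (X u) \<otimes>\<^bsub>H\<^esub> \<phi>a (X v) = \<phi>a (X w) \<longleftrightarrow>
      \<psi>b u \<otimes> (inv (\<psi>b t) \<otimes> \<psi>b v) = \<psi>b w" if "u \<in> B" "v \<in> B" "w \<in> B" for u v w
  proof -
    note cu = cb[OF that(1)] cb[OF that(2)] cb[OF that(3)]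
    have "\<psi>a (X u) \<otimes> (inv (\<psi>a s) \<otimes> \<psi>a (X v)) =
        inv (\<psi>b t) \<otimes> ((\<psi>b u \<otimes> (inv (\<psi>b t) \<otimes> \<psi>b v)) \<otimes> \<psi>a s)"
      using \<psi>X[OF that(1)] \<psi>X[OF that(2)] c cu by (simp add: m_assoc)
    then show ?thesis
      using op[OF XA[OF that(1)] XA[OF that(2)] XA[OF that(3)]] \<psi>X[OF that(3)] c cu by simp
  qed
  have prod: "\<exists>w\<in>A. \<phi>a (X y) \<otimes>\<^bsub>H\<^esub> \<phi>a x = \<phi>a w \<and> \<psi>a w = inv (\<psi>b t) \<otimes> (\<psi>b y \<otimes> \<psi>a x)"
    if xy: "x \<in> A" "y \<in> B" for x y
  proof -
    note cx = ca[OF xy(1)] cb[OF xy(2)]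
    have "inv (\<psi>b t) \<otimes> (\<psi>b y \<otimes> \<psi>a x) \<in> \<psi>a ` A"
      using c cx a by (simp add: bij_betw_imp_surj_on)
    then obtain w where w: "w \<in> A" "\<psi>a w = inv (\<psi>b t) \<otimes> (\<psi>b y \<otimes> \<psi>a x)" by (metis imageE)
    have "\<psi>a (X y) \<otimes> (inv (\<psi>a s) \<otimes> \<psi>a x) = \<psi>a w"
      using \<psi>X[OF xy(2)] w(2) c cx by (simp add: m_assoc)
    then show ?thesis using op[OF XA[OF xy(2)] xy(1) w(1)] w by blast
  qed
  show "\<phi>a (X y) \<otimes>\<^bsub>H\<^esub> \<phi>a x = \<phi>a (X y') \<otimes>\<^bsub>H\<^esub> \<phi>a x' \<longleftrightarrow>
      \<psi>b y \<otimes> \<psi>a x = \<psi>b y' \<otimes> \<psi>a x'"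
    if xy: "x \<in> A" "x' \<in> A" "y \<in> B" "y' \<in> B" for x x' y y'
  proof -
    obtain w where w: "w \<in> A" "\<phi>a (X y) \<otimes>\<^bsub>H\<^esub> \<phi>a x = \<phi>a w"
      "\<psi>a w = inv (\<psi>b t) \<otimes> (\<psi>b y \<otimes> \<psi>a x)" using prod[OF xy(1,3)] by blast
    obtain w' where w': "w' \<in> A" "\<phi>a (X y') \<otimes>\<^bsub>H\<^esub> \<phi>a x' = \<phi>a w'"
      "\<psi>a w' = inv (\<psi>b t) \<otimes> (\<psi>b y' \<otimes> \<psi>a x')" using prod[OF xy(2,4)] by blast
    have "\<phi>a w = \<phi>a w' \<longleftrightarrow> \<psi>a w = \<psi>a w'"
      using \<phi>(1) a w(1) w'(1) by (auto simp: bij_betw_def inj_on_def)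
    then show ?thesis
      unfolding w(2) w'(2) w(3) w'(3)
      using c ca[OF xy(1)] ca[OF xy(2)] cb[OF xy(3)] cb[OF xy(4)] by simp
  qed
qed

section \<open>Exchanging neighbouring tree edges\<close>

text \<open>2-connectedness enters through \<open>linked\<close> and \<open>root_child\<close>
  alone: some fundamental circle contains each tree edge together with its parent edge, and the root
  has at most one child.\<close>

locale four_minor_expansion = tree_expansion \<Delta> r par dep te \<Omega> p
  for \<Delta> :: "('v, 'f) multigraph" and r par dep te and \<Omega> :: "('v, 'e) biased_graph" and p +
  assumes minors: "expansion_minor \<Omega> \<Delta> p \<Omega>' \<Delta>' \<Longrightarrow> card (nodes \<Omega>') = 4 \<Longrightarrow> group_expansion \<Omega>' \<Delta>' p"
    and linked: "b \<in> N \<Longrightarrow> par b \<in> N \<Longrightarrow> \<exists>f\<in>cotree. b \<in> chain f \<and> par b \<in> chain f"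
    and root_child: "x \<in> N \<Longrightarrow> y \<in> N \<Longrightarrow> par x = r \<Longrightarrow> par y = r \<Longrightarrow> x = y"
    and card_nodes: "card (nodes \<Delta>) \<ge> 4"
begin

lemma gains_exist: "K \<subseteq> N \<Longrightarrow> card K = 3 \<Longrightarrow> lift \<sigma> \<Longrightarrow> \<exists>G \<psi>. gains \<sigma> K G \<psi>"
  by (rule minor_gains[OF minors])

lemma gains_bij:
  assumes "gains \<sigma> K G \<psi>" "k \<in> K" "K \<subseteq> N"
  shows "bij_betw (\<psi> (te k)) (tfiber k) (carrier G)"
proof -
  have "te k \<notin> te ` (N - K)" using inj_on_image_mem_iff[OF te_inj, of k "N - K"] assms by blast
  moreover have "te k \<in> edges \<Delta>" using te_in assms by blast
  ultimately show ?thesis using assms(1) by (simp add: gains_def)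
qed

text \<open>The potential is computed downwards from the root out of the gains of the lift,
  contracted edges contributing the unit; in this form it meets the hypotheses of
  \<open>gains\<close>.\<close>

lemma gains_potential:
  fixes G :: "'e monoid" (structure)
  assumes g: "gains \<sigma> K G \<psi>" and K: "K \<subseteq> N" and f: "f \<in> cotree" "chain f \<inter> K \<noteq> {}"
    and \<sigma>': "lift \<sigma>'" "\<forall>x\<in>N - K. \<sigma>' x = \<sigma> x"
    and m: "m = (\<lambda>z. if z \<in> K then \<psi> (te z) (\<sigma>' z) else \<one>)"
    and h: "h r = \<one>" "\<forall>z\<in>N. h z = h (par z) \<otimes> inv (m z)"
  shows "\<psi> f (closing f \<sigma>') = inv (h (lo f)) \<otimes> h (hi f)"
    and "\<And>z. z \<in> V \<Longrightarrow> h z \<in> carrier G" and "\<And>z. z \<in> N \<Longrightarrow> m z \<in> carrier G"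
proof -
  interpret group G using g by (simp add: gains_def)
  show mc: "m z \<in> carrier G" if "z \<in> N" for z
  proof (cases "z \<in> K")
    case True
    have "\<sigma>' z \<in> tfiber z" using \<sigma>'(1) that by (simp add: lift_def)
    then show ?thesis using bij_betwE[OF gains_bij[OF g True K]] True m by simp
  qed (simp add: m)
  show hc: "h z \<in> carrier G" if "z \<in> V" for z
    using that
  proof (induction rule: tree_induct)
    case (step x)
    then show ?case using h(2)[rule_format, OF step(1)] mc[OF step(1)] by simp
  qed (simp add: h)
  have "h (par x) = h x" if "x \<in> N - K" for x
  proof -
    have "x \<in> N" "m x = \<one>" using that m by auto
    then show ?thesis using h(2)[rule_format, of x] hc[OF par_in] by simp
  qed
  moreover have "\<psi> (te k) (\<sigma>' k) = inv (h k) \<otimes> h (par k)" if "k \<in> K" for k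
  proof -
    have k: "k \<in> N" using that K by blast
    have "m k = \<psi> (te k) (\<sigma>' k)" using that m by simp
    then show ?thesis using h(2)[rule_format, OF k] hc[OF par_in[OF k]] mc[OF k] by (simp add: inv_mult_group m_assoc)
  qed
  moreover have "h \<in> V \<rightarrow> carrier G" using hc by blast
  ultimately show "\<psi> f (closing f \<sigma>') = inv (h (lo f)) \<otimes> h (hi f)"
    using g f \<sigma>' unfolding gains_def by blast
qed

definition linking where "linking f b \<longleftrightarrow> f \<in> cotree \<and> b \<in> chain f \<and> par b \<in> chain f"

text \<open>The potentials of the two lifts are compared. They agree outside the subtree of
  \<open>par b\<close>, and again from \<open>b\<close> downwards, where only the product of the two
  gains enters. In between they may differ, but \<open>lo f\<close> lies at or below
  \<open>b\<close> and \<open>hi f\<close> strictly above \<open>par b\<close>, so the closing edges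
  have the same gain.\<close>

lemma gains_pair_same:
  fixes G :: "'e monoid" (structure)
  assumes g: "gains \<sigma> K G \<psi>" and K: "K \<subseteq> N" "b \<in> K" "par b \<in> K" and f: "linking f b"
    and \<sigma>': "lift \<sigma>'" "\<forall>z\<in>N - K. \<sigma>' z = \<sigma> z"
    and x: "x \<in> tfiber (par b)" "x' \<in> tfiber (par b)"
    and y: "y \<in> tfiber b" "y' \<in> tfiber b"
    and eq: "\<psi> (te b) y \<otimes> \<psi> (te (par b)) x = \<psi> (te b) y' \<otimes> \<psi> (te (par b)) x'"
  shows "closing f (\<sigma>'(par b := x, b := y)) = closing f (\<sigma>'(par b := x', b := y'))"
proof -
  interpret group G using g by (simp add: gains_def)
  define a where "a = par b"
  have b: "b \<in> N" "a \<in> N" using K by (auto simp: a_def)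
  have ab: "a \<noteq> b" using par_ne[OF b(1)] by (simp add: a_def)
  have ba: "(b, a) \<in> P" using b by (simp add: P_iff a_def)
  have f': "f \<in> cotree" "b \<in> chain f" "a \<in> chain f" using f by (auto simp: linking_def a_def)
  have chK: "chain f \<inter> K \<noteq> {}" using f' K by blast
  define \<sigma>1 \<sigma>2 where "\<sigma>1 = \<sigma>'(a := x, b := y)" and "\<sigma>2 = \<sigma>'(a := x', b := y')"
  have l: "lift \<sigma>1" "lift \<sigma>2" unfolding \<sigma>1_def \<sigma>2_def using x y \<sigma>'(1) by (auto intro!: lift_upd simp: a_def)
  have off: "\<forall>z\<in>N - K. \<sigma>1 z = \<sigma> z" "\<forall>z\<in>N - K. \<sigma>2 z = \<sigma> z"
    using \<sigma>'(2) K by (auto simp: \<sigma>1_def \<sigma>2_def a_def)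
  define m1 m2 where "m1 = (\<lambda>z. if z \<in> K then \<psi> (te z) (\<sigma>1 z) else \<one>)"
    and "m2 = (\<lambda>z. if z \<in> K then \<psi> (te z) (\<sigma>2 z) else \<one>)"
  obtain h1 where h1: "h1 r = \<one>" "\<forall>z\<in>N. h1 z = h1 (par z) \<otimes> inv (m1 z)"
    using tree_recursion[of "\<one>" "\<lambda>z g. g \<otimes> inv (m1 z)"] by blast
  obtain h2 where h2: "h2 r = \<one>" "\<forall>z\<in>N. h2 z = h2 (par z) \<otimes> inv (m2 z)"
    using tree_recursion[of "\<one>" "\<lambda>z g. g \<otimes> inv (m2 z)"] by blast
  note p1 = gains_potential[OF g K(1) f'(1) chK l(1) off(1) m1_def h1]
  note p2 = gains_potential[OF g K(1) f'(1) chK l(2) off(2) m2_def h2]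
  have m_eq: "m1 z = m2 z" if "z \<noteq> a" "z \<noteq> b" for z
    using that by (simp add: m1_def m2_def \<sigma>1_def \<sigma>2_def)
  have outside: "(z, a) \<notin> P\<^sup>* \<longrightarrow> h1 z = h2 z" if "z \<in> V" for z
    using that
  proof (induction rule: tree_induct)
    case root
    then show ?case by (simp add: h1 h2)
  next
    case (step z)
    show ?case
    proof
      assume z: "(z, a) \<notin> P\<^sup>*"
      have "(z, par z) \<in> P" using step(1) by (simp add: P_iff)
      then have "(par z, a) \<notin> P\<^sup>*" using z by (meson converse_rtrancl_into_rtrancl)
      moreover have "z \<noteq> a" "z \<noteq> b" using z ba by auto
      ultimately show "h1 z = h2 z" using step m_eq h1(2)[rule_format, OF step(1)] h2(2)[rule_format, OF step(1)] by simp
    qed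
  qed
  have "(par a, a) \<notin> P\<^sup>*" using dep_rtrancl[of "par a" a] dep_par[OF b(2)] by auto
  then have "h1 (par a) = h2 (par a)" using outside par_in[OF b(2)] by blast
  moreover have "m1 b \<otimes> m1 a = m2 b \<otimes> m2 a"
    using eq K ab by (simp add: m1_def m2_def \<sigma>1_def \<sigma>2_def a_def)
  then have "inv (m1 a) \<otimes> inv (m1 b) = inv (m2 a) \<otimes> inv (m2 b)"
    using p1(3)[OF b(1)] p1(3)[OF b(2)] p2(3)[OF b(1)] p2(3)[OF b(2)] by (simp add: inv_mult_group[symmetric])
  ultimately have hb: "h1 b = h2 b"
    using h1(2)[rule_format, OF b(1)] h1(2)[rule_format, OF b(2)] h2(2)[rule_format, OF b(1)] h2(2)[rule_format, OF b(2)]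
      p1(3)[OF b(1)] p1(3)[OF b(2)] p2(3)[OF b(1)] p2(3)[OF b(2)] p1(2)[OF par_in[OF b(2)]] p2(2)[OF par_in[OF b(2)]]
    by (simp add: a_def[symmetric] m_assoc)
  have below: "(z, b) \<in> P\<^sup>* \<longrightarrow> h1 z = h2 z" if "z \<in> V" for z
    using that
  proof (induction rule: tree_induct)
    case root
    then show ?case by (simp add: h1 h2)
  next
    case (step z)
    show ?case
    proof
      assume z: "(z, b) \<in> P\<^sup>*"
      show "h1 z = h2 z"
      proof (cases "z = b")
        case False
        then have "(par z, b) \<in> P\<^sup>*" using z step_up by blast
        moreover have "z \<noteq> a" using dep_rtrancl[OF z] dep_par[OF b(1)] by (auto simp: a_def)
        ultimately show ?thesis using step False m_eq h1(2)[rule_format, OF step(1)] h2(2)[rule_format, OF step(1)] by simp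
      qed (simp add: hb)
    qed
  qed
  have fe: "f \<in> edges \<Delta>" using f' by (simp add: cotree_def)
  have "h1 (lo f) = h2 (lo f)" using below f'(2) lo_hi_in[OF fe] by (simp add: chain_def)
  moreover have "(hi f, a) \<notin> P\<^sup>*" using f'(3) dep_rtrancl[of "hi f" a] dep_trancl[of a "hi f"] by (auto simp: chain_def)
  then have "h1 (hi f) = h2 (hi f)" using outside lo_hi_in[OF fe] by blast
  ultimately have "\<psi> f (closing f \<sigma>1) = \<psi> f (closing f \<sigma>2)" using p1(1) p2(1) by simp
  moreover have "f \<in> edges \<Delta> - te ` (N - K)" using f'(1) by (auto simp: cotree_def)
  then have "inj_on (\<psi> f) (fiber f)" using g by (auto simp: gains_def bij_betw_def)
  ultimately show ?thesis
    using closing_fiber[OF f'(1) l(1)] closing_fiber[OF f'(1) l(2)] by (simp add: inj_on_def \<sigma>1_def \<sigma>2_def a_def)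
qed

text \<open>For the converse, \<open>z\<close> is chosen so that \<open>z\<close> and
  \<open>x'\<close> have the same product as \<open>y\<close> and \<open>x\<close>. The other
  direction gives \<open>z\<close> and \<open>y'\<close> the same closing edge, and
  \<open>closing_solve\<close> makes them equal.\<close>

lemma gains_pair_iff:
  fixes G :: "'e monoid" (structure)
  assumes g: "gains \<sigma> K G \<psi>" and K: "K \<subseteq> N" "b \<in> K" "par b \<in> K" and f: "linking f b"
    and \<sigma>': "lift \<sigma>'" "\<forall>z\<in>N - K. \<sigma>' z = \<sigma> z"
    and x: "x \<in> tfiber (par b)" "x' \<in> tfiber (par b)"
    and y: "y \<in> tfiber b" "y' \<in> tfiber b"
  shows "closing f (\<sigma>'(par b := x, b := y)) = closing f (\<sigma>'(par b := x', b := y')) \<longleftrightarrow>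
    \<psi> (te b) y \<otimes> \<psi> (te (par b)) x = \<psi> (te b) y' \<otimes> \<psi> (te (par b)) x'"
    (is "?L \<longleftrightarrow> ?R")
proof
  interpret group G using g by (simp add: gains_def)
  assume L: ?L
  have bb: "bij_betw (\<psi> (te b)) (tfiber b) (carrier G)" using gains_bij[OF g K(2,1)] .
  have c: "\<psi> (te b) y \<in> carrier G" "\<psi> (te (par b)) x \<in> carrier G" "\<psi> (te (par b)) x' \<in> carrier G"
    using bij_betwE[OF bb] bij_betwE[OF gains_bij[OF g K(3,1)]] x y by auto
  have "\<psi> (te b) y \<otimes> \<psi> (te (par b)) x \<otimes> inv (\<psi> (te (par b)) x') \<in> \<psi> (te b) ` tfiber b"
    using c bij_betw_imp_surj_on[OF bb] by simp
  then obtain z where z: "z \<in> tfiber b"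
    "\<psi> (te b) z = \<psi> (te b) y \<otimes> \<psi> (te (par b)) x \<otimes> inv (\<psi> (te (par b)) x')" by (metis imageE)
  have zx: "\<psi> (te b) y \<otimes> \<psi> (te (par b)) x = \<psi> (te b) z \<otimes> \<psi> (te (par b)) x'"
    using z(2) c by (simp add: m_assoc)
  have "closing f (\<sigma>'(par b := x, b := y)) = closing f (\<sigma>'(par b := x', b := z))"
    using gains_pair_same[OF g K f \<sigma>' x y(1) z(1) zx] .
  then have "closing f ((\<sigma>'(par b := x'))(b := z)) = closing f ((\<sigma>'(par b := x'))(b := y'))" using L by simp
  moreover have f': "f \<in> cotree" "b \<in> chain f" using f by (auto simp: linking_def)
  moreover have l: "lift (\<sigma>'(par b := x'))" using lift_upd[OF \<sigma>'(1) x(2)] .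
  moreover have "closing f ((\<sigma>'(par b := x'))(b := y')) \<in> fiber f" using closing_fiber[OF f'(1) lift_upd[OF l y(2)]] .
  ultimately have "z = y'" using closing_solve[of f "\<sigma>'(par b := x')" b] z(1) y(2) by metis
  then show ?R using zx by simp
qed (rule gains_pair_same[OF assms])

text \<open>A fixed lift as base point: its edges will have unit gain on the whole tree, which
  removes the freedom of translating gains.\<close>

definition \<tau> where "\<tau> = (SOME \<sigma>. lift \<sigma>)"

lemma lift_\<tau>: "lift \<tau>"
  unfolding \<tau>_def using lift_exists by (rule someI_ex)

lemma \<tau>_fiber: "x \<in> N \<Longrightarrow> \<tau> x \<in> tfiber x"
  using lift_\<tau> by (simp add: lift_def)

definition pairs where "pairs = {b \<in> N. par b \<in> N}"

text \<open>
  Two pairs of edges over the tree edges of \<open>par b\<close> and \<open>b\<close> are exchangeable if they have the same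
  effect on every circle through both; \<open>exchange_indep\<close> shows that one circle and one lift decide this.
\<close>

definition exchange where
  "exchange b x y x' y' \<longleftrightarrow> (let f = SOME f. linking f b in
    closing f (\<tau>(par b := x, b := y)) = closing f (\<tau>(par b := x', b := y')))"

lemma some_linking: "b \<in> pairs \<Longrightarrow> linking (SOME f. linking f b) b"
  using linked[of b] by (intro someI_ex[of "\<lambda>f. linking f b"]) (auto simp: pairs_def linking_def)

lemma exchange_iff_gains:
  fixes G :: "'e monoid" (structure)
  assumes "b \<in> pairs" "gains \<tau> K G \<psi>" "K \<subseteq> N" "b \<in> K" "par b \<in> K"
    and "x \<in> tfiber (par b)" "x' \<in> tfiber (par b)" "y \<in> tfiber b" "y' \<in> tfiber b"
  shows "exchange b x y x' y' \<longleftrightarrow>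
    \<psi> (te b) y \<otimes> \<psi> (te (par b)) x = \<psi> (te b) y' \<otimes> \<psi> (te (par b)) x'"
  unfolding exchange_def Let_def
  by (rule gains_pair_iff[OF assms(2-5) some_linking[OF assms(1)] lift_\<tau> _ assms(6-9)]) simp

lemma triple_exists:
  assumes "A \<subseteq> N" "card A \<le> 3"
  shows "\<exists>K. A \<subseteq> K \<and> K \<subseteq> N \<and> card K = 3"
proof -
  have "finite N" "card N \<ge> 3" using fin_nodes card_nodes root_in by auto
  then show ?thesis using exists_subset_between[of A 3 N] assms by (metis)
qed

lemma triple_gains:
  assumes "lift \<sigma>" "a \<in> N" "b \<in> N" "c \<in> N"
  obtains K G \<psi> where "K \<subseteq> N" "{a, b, c} \<subseteq> K" "gains \<sigma> K G \<psi>"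
proof -
  have "card {a, b, c} \<le> 3" by (simp add: card_insert_le_m1)
  then obtain K where K: "{a, b, c} \<subseteq> K" "K \<subseteq> N" "card K = 3"
    using triple_exists[of "{a, b, c}"] assms by blast
  obtain G \<psi> where "gains \<sigma> K G \<psi>" using gains_exist[OF K(2,3) assms(1)] by blast
  then show ?thesis by (rule that[OF K(2,1)])
qed

text \<open>The lift is changed from \<open>\<tau>\<close> to \<open>\<sigma>\<close> at one node
  \<open>z\<close> at a time. Each change happens in a minor that keeps \<open>b\<close>,
  \<open>par b\<close> and \<open>z\<close>, whose gains decide the question for both lifts and for
  all linking edges at once. These three tree edges explain why minors of order four
  suffice.\<close>

lemma exchange_indep:
  assumes b: "b \<in> pairs" and \<sigma>: "lift \<sigma>" and f: "linking f b"
    and x: "x \<in> tfiber (par b)" "x' \<in> tfiber (par b)"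
    and y: "y \<in> tfiber b" "y' \<in> tfiber b"
  shows "closing f (\<sigma>(par b := x, b := y)) = closing f (\<sigma>(par b := x', b := y')) \<longleftrightarrow> exchange b x y x' y'"
proof -
  have bN: "b \<in> N" "par b \<in> N" using b by (auto simp: pairs_def)
  have change: "closing g (\<sigma>2(par b := x, b := y)) = closing g (\<sigma>2(par b := x', b := y')) \<longleftrightarrow>
      closing g' (\<sigma>1(par b := x, b := y)) = closing g' (\<sigma>1(par b := x', b := y'))"
    if l: "linking g b" "linking g' b" "lift \<sigma>1" "lift \<sigma>2" and z: "z \<in> N" "\<forall>w\<in>N - {z}. \<sigma>1 w = \<sigma>2 w" for g g' \<sigma>1 \<sigma>2 z
  proof -
    obtain K G \<psi> where K: "K \<subseteq> N" "{b, par b, z} \<subseteq> K" and g: "gains \<sigma>1 K G \<psi>"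
      using triple_gains[OF l(3) bN z(1)] .
    have bK: "b \<in> K" "par b \<in> K" using K by auto
    have "\<forall>w\<in>N - K. \<sigma>2 w = \<sigma>1 w" 
    proof
      fix w assume "w \<in> N - K"
      then have "w \<in> N - {z}" using K(2) by blast
      then have "\<sigma>1 w = \<sigma>2 w" by (rule bspec[OF z(2)])
      then show "\<sigma>2 w = \<sigma>1 w" ..
    qed
    moreover have "\<forall>w\<in>N - K. \<sigma>1 w = \<sigma>1 w" by simp
    ultimately show ?thesis
      using gains_pair_iff[OF g K(1) bK l(1,4) _ x y] gains_pair_iff[OF g K(1) bK l(2,3) _ x y] by simp
  qed
  define mix where "mix X = (\<lambda>w. if w \<in> X then \<sigma> w else \<tau> w)" for X
  have lm: "lift (mix X)" for X using \<sigma> lift_\<tau> by (auto simp: mix_def lift_def)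
  have "\<forall>g. linking g b \<longrightarrow>
      (closing g ((mix X)(par b := x, b := y)) = closing g ((mix X)(par b := x', b := y')) \<longleftrightarrow> exchange b x y x' y')"
    if "finite X" "X \<subseteq> N" for X
    using that
  proof (induction X rule: finite_induct)
    case empty
    have mix0: "mix {} = \<tau>" by (simp add: mix_def)
    show ?case unfolding mix0
      using change[OF _ some_linking[OF b] lift_\<tau> lift_\<tau> bN(1)] unfolding exchange_def Let_def by blast
  next
    case (insert z X)
    have "\<forall>w\<in>N - {z}. mix X w = mix (insert z X) w" by (auto simp: mix_def)
    then show ?case using insert change[OF _ _ lm[of X] lm[of "insert z X"], of _ _ z] by blast
  qed
  moreover have "finite N" using fin_nodes by simp
  ultimately have "closing f ((mix N)(par b := x, b := y)) = closing f ((mix N)(par b := x', b := y')) \<longleftrightarrow> exchange b x y x' y'"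
    using f by blast
  moreover have "closing f ((mix N)(par b := u, b := v)) = closing f (\<sigma>(par b := u, b := v))" for u v
    using chain_sub[of f] by (intro closing_cong) (auto simp: mix_def)
  ultimately show ?thesis by simp
qed

lemma pairs_in: "b \<in> pairs \<Longrightarrow> b \<in> N" "b \<in> pairs \<Longrightarrow> par b \<in> N"
  by (simp_all add: pairs_def)

lemma pair_gains:
  assumes "b \<in> pairs"
  obtains K G \<psi> where "K \<subseteq> N" "b \<in> K" "par b \<in> K" "gains \<tau> K G \<psi>"
proof (rule triple_gains[OF lift_\<tau>, of b "par b" b])
  show "b \<in> N" "par b \<in> N" "b \<in> N" using pairs_in[OF assms] by auto
  fix K G \<psi> assume "K \<subseteq> N" "{b, par b, b} \<subseteq> K" "gains \<tau> K G \<psi>"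
  then show thesis using that by simp
qed

text \<open>With \<open>op_lower\<close>, the right-hand sides of \<open>op_upper_iff\<close> and
  \<open>op_lower_iff\<close> for the units \<open>\<tau> (par b)\<close> and
  \<open>\<tau> b\<close>, equal products being replaced by \<open>exchange\<close>. The operations
  are thereby described without any group and can be compared across minors.\<close>

definition op_upper where
  "op_upper b u v w \<longleftrightarrow> (\<exists>y\<in>tfiber b. exchange b (\<tau> (par b)) y u (\<tau> b) \<and> exchange b v y w (\<tau> b))"

definition op_lower where
  "op_lower b u v w \<longleftrightarrow> (\<exists>x\<in>tfiber (par b). exchange b x (\<tau> b) (\<tau> (par b)) v \<and> exchange b x u (\<tau> (par b)) w)"

lemma op_gains_iff:
  fixes G :: "'e monoid" (structure)
  assumes b: "b \<in> pairs" and K: "K \<subseteq> N" "b \<in> K" "par b \<in> K" and g: "gains \<tau> K G \<psi>"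
  shows "u \<in> tfiber (par b) \<Longrightarrow> v \<in> tfiber (par b) \<Longrightarrow> w \<in> tfiber (par b) \<Longrightarrow>
      \<psi> (te (par b)) u \<otimes> (inv (\<psi> (te (par b)) (\<tau> (par b))) \<otimes> \<psi> (te (par b)) v) =
      \<psi> (te (par b)) w \<longleftrightarrow> op_upper b u v w"
    and "u \<in> tfiber b \<Longrightarrow> v \<in> tfiber b \<Longrightarrow> w \<in> tfiber b \<Longrightarrow>
      \<psi> (te b) u \<otimes> (inv (\<psi> (te b) (\<tau> b)) \<otimes> \<psi> (te b) v) = \<psi> (te b) w \<longleftrightarrow> op_lower b u v w"
proof -
  interpret group G using g by (simp add: gains_def)
  note exchange = exchange_iff_gains[OF b g K]
  note bij = gains_bij[OF g K(3,1)] gains_bij[OF g K(2,1)]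
  have t: "\<tau> (par b) \<in> tfiber (par b)" "\<tau> b \<in> tfiber b" using pairs_in[OF b] \<tau>_fiber by auto
  show "\<psi> (te (par b)) u \<otimes> (inv (\<psi> (te (par b)) (\<tau> (par b))) \<otimes> \<psi> (te (par b)) v) =
      \<psi> (te (par b)) w \<longleftrightarrow> op_upper b u v w"
    if "u \<in> tfiber (par b)" "v \<in> tfiber (par b)" "w \<in> tfiber (par b)"
    unfolding op_upper_iff[OF bij t that] op_upper_def using exchange t that by auto
  show "\<psi> (te b) u \<otimes> (inv (\<psi> (te b) (\<tau> b)) \<otimes> \<psi> (te b) v) = \<psi> (te b) w \<longleftrightarrow> op_lower b u v w"
    if "u \<in> tfiber b" "v \<in> tfiber b" "w \<in> tfiber b"
    unfolding op_lower_iff[OF bij t that] op_lower_def using exchange t that by auto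
qed

text \<open>When both edges of \<open>\<tau>\<close> have unit gain, this exchange forces the upper
  edge \<open>transport b y\<close> and the lower edge \<open>y\<close> to have the same
  gain.\<close>

definition transport where
  "transport b y = (SOME x. x \<in> tfiber (par b) \<and> exchange b x (\<tau> b) (\<tau> (par b)) y)"

lemma transport:
  assumes b: "b \<in> pairs" and y: "y \<in> tfiber b"
  shows "transport b y \<in> tfiber (par b) \<and> exchange b (transport b y) (\<tau> b) (\<tau> (par b)) y"
  unfolding transport_def
proof (rule someI_ex)
  obtain K G \<psi> where K: "K \<subseteq> N" "b \<in> K" "par b \<in> K" and g: "gains \<tau> K G \<psi>" using pair_gains[OF b] .
  interpret group G using g by (simp add: gains_def)
  note bij = gains_bij[OF g K(3,1)] gains_bij[OF g K(2,1)]
  have t: "\<tau> (par b) \<in> tfiber (par b)" "\<tau> b \<in> tfiber b" using pairs_in[OF b] \<tau>_fiber by auto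
  note c = bij_betwE[OF bij(1), rule_format, OF t(1)] bij_betwE[OF bij(2), rule_format, OF t(2)]
    bij_betwE[OF bij(2), rule_format, OF y]
  have "inv\<^bsub>G\<^esub> (\<psi> (te b) (\<tau> b)) \<otimes>\<^bsub>G\<^esub> (\<psi> (te b) y \<otimes>\<^bsub>G\<^esub> \<psi> (te (par b)) (\<tau> (par b)))
      \<in> \<psi> (te (par b)) ` tfiber (par b)"
    using c bij_betw_imp_surj_on[OF bij(1)] by simp
  then obtain x where x: "x \<in> tfiber (par b)"
    "\<psi> (te (par b)) x = inv\<^bsub>G\<^esub> (\<psi> (te b) (\<tau> b)) \<otimes>\<^bsub>G\<^esub> (\<psi> (te b) y \<otimes>\<^bsub>G\<^esub> \<psi> (te (par b)) (\<tau> (par b)))"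
    by (metis imageE)
  have "\<psi> (te b) (\<tau> b) \<otimes>\<^bsub>G\<^esub> \<psi> (te (par b)) x = \<psi> (te b) y \<otimes>\<^bsub>G\<^esub> \<psi> (te (par b)) (\<tau> (par b))"
    using c x(2) by simp
  then have "exchange b x (\<tau> b) (\<tau> (par b)) y" using exchange_iff_gains[OF b g K x(1) t y] by simp
  then show "\<exists>x. x \<in> tfiber (par b) \<and> exchange b x (\<tau> b) (\<tau> (par b)) y" using x(1) by blast
qed

text \<open>The invariant carried down the tree: the gains already placed on the upper edge of the
  pair \<open>b\<close> multiply as the exchanges at \<open>b\<close> dictate.\<close>

definition upper_gain where
  "upper_gain G \<phi> b \<longleftrightarrow> bij_betw (\<phi> (par b)) (tfiber (par b)) (carrier G) \<and>
    \<phi> (par b) (\<tau> (par b)) = \<one>\<^bsub>G\<^esub> \<and>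
    (\<forall>u\<in>tfiber (par b). \<forall>v\<in>tfiber (par b). \<forall>w\<in>tfiber (par b).
      \<phi> (par b) u \<otimes>\<^bsub>G\<^esub> \<phi> (par b) v = \<phi> (par b) w \<longleftrightarrow> op_upper b u v w)"

text \<open>The gains of an auxiliary minor mediate. Its group \<open>H\<close> may differ from
  \<open>G\<close>, but both induce \<open>op_upper b\<close> on the upper fiber, so
  \<open>transported_product\<close> moves the gains in \<open>G\<close> to the lower fiber.\<close>

lemma upper_gain_step:
  assumes G: "group G" and b: "b \<in> pairs" and u: "upper_gain G \<phi> b"
    and \<phi>: "\<phi> b = (\<lambda>y. \<phi> (par b) (transport b y))"
  shows "bij_betw (\<phi> b) (tfiber b) (carrier G)" "\<phi> b (\<tau> b) = \<one>\<^bsub>G\<^esub>"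
    and "\<forall>u\<in>tfiber b. \<forall>v\<in>tfiber b. \<forall>w\<in>tfiber b.
      \<phi> b u \<otimes>\<^bsub>G\<^esub> \<phi> b v = \<phi> b w \<longleftrightarrow> op_lower b u v w"
    and "\<forall>x\<in>tfiber (par b). \<forall>x'\<in>tfiber (par b). \<forall>y\<in>tfiber b. \<forall>y'\<in>tfiber b.
      exchange b x y x' y' \<longleftrightarrow> \<phi> b y \<otimes>\<^bsub>G\<^esub> \<phi> (par b) x = \<phi> b y' \<otimes>\<^bsub>G\<^esub> \<phi> (par b) x'"
proof -
  obtain K H \<psi> where K: "K \<subseteq> N" "b \<in> K" "par b \<in> K" and g: "gains \<tau> K H \<psi>" using pair_gains[OF b] .
  have H: "group H" using g by (simp add: gains_def)
  note bij = gains_bij[OF g K(3,1)] gains_bij[OF g K(2,1)]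
  have t: "\<tau> (par b) \<in> tfiber (par b)" "\<tau> b \<in> tfiber b" using pairs_in[OF b] \<tau>_fiber by auto
  note iff = op_gains_iff[OF b K g]
  have tr: "transport b y \<in> tfiber (par b) \<and>
      \<psi> (te b) (\<tau> b) \<otimes>\<^bsub>H\<^esub> \<psi> (te (par b)) (transport b y) = \<psi> (te b) y \<otimes>\<^bsub>H\<^esub> \<psi> (te (par b)) (\<tau> (par b))"
    if "y \<in> tfiber b" for y
    using transport[OF b that] exchange_iff_gains[OF b g K _ t that] by blast
  have op: "\<phi> (par b) u \<otimes>\<^bsub>G\<^esub> \<phi> (par b) v = \<phi> (par b) w \<longleftrightarrow>
      \<psi> (te (par b)) u \<otimes>\<^bsub>H\<^esub> (inv\<^bsub>H\<^esub> (\<psi> (te (par b)) (\<tau> (par b))) \<otimes>\<^bsub>H\<^esub> \<psi> (te (par b)) v) = \<psi> (te (par b)) w"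
    if "u \<in> tfiber (par b)" "v \<in> tfiber (par b)" "w \<in> tfiber (par b)" for u v w
    using u that iff(1)[OF that] unfolding upper_gain_def by blast
  have ug: "bij_betw (\<phi> (par b)) (tfiber (par b)) (carrier G)" "\<phi> (par b) (\<tau> (par b)) = \<one>\<^bsub>G\<^esub>"
    using u by (auto simp: upper_gain_def)
  note tp = group.transported_product[OF H bij t ug, of "transport b"]
  show "bij_betw (\<phi> b) (tfiber b) (carrier G)" "\<phi> b (\<tau> b) = \<one>\<^bsub>G\<^esub>"
    unfolding \<phi> by (rule tp(1), erule tr, erule (2) op) (rule tp(2), erule tr, erule (2) op)
  have "\<phi> b u \<otimes>\<^bsub>G\<^esub> \<phi> b v = \<phi> b w \<longleftrightarrow> op_lower b u v w"
    if "u \<in> tfiber b" "v \<in> tfiber b" "w \<in> tfiber b" for u v w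
    unfolding iff(2)[OF that, symmetric] \<phi> by (rule tp(3)) (erule tr, erule (2) op, (rule that)+)
  then show "\<forall>u\<in>tfiber b. \<forall>v\<in>tfiber b. \<forall>w\<in>tfiber b.
      \<phi> b u \<otimes>\<^bsub>G\<^esub> \<phi> b v = \<phi> b w \<longleftrightarrow> op_lower b u v w" by blast
  have "exchange b x y x' y' \<longleftrightarrow> \<phi> b y \<otimes>\<^bsub>G\<^esub> \<phi> (par b) x = \<phi> b y' \<otimes>\<^bsub>G\<^esub> \<phi> (par b) x'"
    if xy: "x \<in> tfiber (par b)" "x' \<in> tfiber (par b)" "y \<in> tfiber b" "y' \<in> tfiber b" for x x' y y'
    unfolding exchange_iff_gains[OF b g K xy] \<phi> by (rule tp(4)[symmetric]) (erule tr, erule (2) op, (rule xy)+)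
  then show "\<forall>x\<in>tfiber (par b). \<forall>x'\<in>tfiber (par b). \<forall>y\<in>tfiber b. \<forall>y'\<in>tfiber b.
      exchange b x y x' y' \<longleftrightarrow> \<phi> b y \<otimes>\<^bsub>G\<^esub> \<phi> (par b) x = \<phi> b y' \<otimes>\<^bsub>G\<^esub> \<phi> (par b) x'" by blast
qed

lemma not_pair: "x \<in> N \<Longrightarrow> x \<notin> pairs \<Longrightarrow> par x = r"
  using par_in[of x] by (auto simp: pairs_def)

definition tree_gains where
  "tree_gains G \<phi> \<longleftrightarrow>
    (\<forall>x\<in>N. bij_betw (\<phi> x) (tfiber x) (carrier G) \<and> \<phi> x (\<tau> x) = \<one>\<^bsub>G\<^esub>) \<and>
    (\<forall>b\<in>pairs. \<forall>x\<in>tfiber (par b). \<forall>x'\<in>tfiber (par b). \<forall>y\<in>tfiber b. \<forall>y'\<in>tfiber b.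
      exchange b x y x' y' \<longleftrightarrow> \<phi> b y \<otimes>\<^bsub>G\<^esub> \<phi> (par b) x = \<phi> b y' \<otimes>\<^bsub>G\<^esub> \<phi> (par b) x')"

text \<open>Gains spread downwards from the only tree edge at the root. Before they are passed on
  through a pair \<open>b\<close>, the operation that \<open>b\<close> sees on its upper edge must
  be shown to be the one already there; this comparison takes place in a minor that contains
  \<open>b\<close> and an earlier pair. The bijections on cotree fibers are kept for loops, whose
  chains contain no tree edge.\<close>

lemma tree_gains_exist:
  "\<exists>(G :: 'e monoid) \<phi>. group G \<and> (\<forall>f\<in>cotree. \<exists>\<chi>. bij_betw \<chi> (fiber f) (carrier G)) \<and> tree_gains G \<phi>"
proof -
  have "\<exists>x\<in>N. par x = r" if "z \<in> N" for z
  proof -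
    have "z \<in> N \<longrightarrow> ?thesis" if "z \<in> V" for z
      using that
    proof (induction rule: tree_induct)
      case (step z)
      then show ?case using par_in[of z] by blast
    qed simp
    then show ?thesis using that by blast
  qed
  moreover have fN: "finite N" "card N \<ge> 3" using fin_nodes card_nodes root_in by auto
  moreover have "N \<noteq> {}" using fN(2) by (metis card.empty not_numeral_le_zero)
  ultimately obtain r1 where r1: "r1 \<in> N" "par r1 = r" by blast
  have pairs: "pairs = N - {r1}"
  proof (intro equalityI subsetI)
    fix x assume x: "x \<in> pairs"
    then have "par x \<noteq> r" by (simp add: pairs_def)
    then show "x \<in> N - {r1}" using pairs_in(1)[OF x] r1(2) by blast
  next
    fix x assume "x \<in> N - {r1}"
    then show "x \<in> pairs" using root_child[OF _ r1(1) _ r1(2), of x] not_pair[of x] by blast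
  qed
  have "\<exists>c\<in>pairs. par c = r1" if "z \<in> pairs" for z
  proof -
    have "z \<in> pairs \<longrightarrow> ?thesis" if "z \<in> V" for z
      using that
    proof (induction rule: tree_induct)
      case root
      then show ?case by (simp add: pairs_def)
    next
      case (step z)
      show ?case
      proof
        assume z: "z \<in> pairs"
        then have "par z \<in> pairs \<or> par z = r1" using pairs pairs_in(2)[OF z] by blast
        then show "\<exists>c\<in>pairs. par c = r1" using z step.IH by blast
      qed
    qed
    then show ?thesis using that pairs_in(1)[OF that] by blast
  qed
  moreover have "pairs \<noteq> {}"
  proof
    assume "pairs = {}"
    then have "N \<subseteq> {r1}" using pairs by blast
    then have "card N \<le> card {r1}" by (intro card_mono) auto
    then show False using fN by simp
  qed
  ultimately obtain c0 where c0: "c0 \<in> pairs" "par c0 = r1" by blast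
  obtain K0 G \<psi>0 where K0: "K0 \<subseteq> N" "c0 \<in> K0" "par c0 \<in> K0" and g0: "gains \<tau> K0 G \<psi>0"
    using pair_gains[OF c0(1)] .
  interpret group G using g0 by (simp add: gains_def)
  \<comment> \<open>Right translation turns \<open>\<tau> r1\<close>, the unit of the induced
    operation, into the unit of \<open>G\<close>.\<close>
  define base where "base u = \<psi>0 (te r1) u \<otimes>\<^bsub>G\<^esub> inv\<^bsub>G\<^esub> (\<psi>0 (te r1) (\<tau> r1))" for u
  \<comment> \<open>The value at the root is never read, since children of the root take
    \<open>base\<close>.\<close>
  obtain \<phi> where \<phi>: "\<forall>x\<in>N. \<phi> x = (if par x = r then base else (\<lambda>y. \<phi> (par x) (transport x y)))"
    using tree_recursion[of undefined "\<lambda>x H. if par x = r then base else (\<lambda>y. H (transport x y))"] by blast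
  have \<phi>1: "\<phi> r1 = base" using \<phi> r1 by simp
  have \<phi>b: "\<phi> b = (\<lambda>y. \<phi> (par b) (transport b y))" if "b \<in> pairs" for b
    using \<phi> that by (auto simp: pairs_def)
  have b0: "bij_betw (\<psi>0 (te r1)) (tfiber r1) (carrier G)"
    using gains_bij[OF g0 K0(3,1)] c0(2) by simp
  have t1: "\<tau> r1 \<in> tfiber r1" using \<tau>_fiber[OF r1(1)] .
  have c1: "\<psi>0 (te r1) u \<in> carrier G" if "u \<in> tfiber r1" for u using bij_betwE[OF b0] that by blast
  have "bij_betw (\<lambda>g. g \<otimes>\<^bsub>G\<^esub> inv\<^bsub>G\<^esub> (\<psi>0 (te r1) (\<tau> r1))) (carrier G) (carrier G)"
    by (rule bij_betwI[where g = "\<lambda>g. g \<otimes>\<^bsub>G\<^esub> \<psi>0 (te r1) (\<tau> r1)"])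
      (use c1[OF t1] in \<open>auto simp: m_assoc\<close>)
  from bij_betw_trans[OF b0 this] have bij_base: "bij_betw base (tfiber r1) (carrier G)"
    by (simp add: base_def[abs_def] o_def)
  have upper0: "upper_gain G \<phi> c0"
    unfolding upper_gain_def c0(2) \<phi>1
  proof (intro conjI ballI)
    show "base (\<tau> r1) = \<one>\<^bsub>G\<^esub>" using c1[OF t1] by (simp add: base_def)
    fix u v w assume uvw: "u \<in> tfiber r1" "v \<in> tfiber r1" "w \<in> tfiber r1"
    note c = c1[OF uvw(1)] c1[OF uvw(2)] c1[OF uvw(3)] c1[OF t1]
    have "base u \<otimes>\<^bsub>G\<^esub> base v =
        (\<psi>0 (te r1) u \<otimes>\<^bsub>G\<^esub> (inv\<^bsub>G\<^esub> (\<psi>0 (te r1) (\<tau> r1)) \<otimes>\<^bsub>G\<^esub> \<psi>0 (te r1) v)) \<otimes>\<^bsub>G\<^esub> inv\<^bsub>G\<^esub> (\<psi>0 (te r1) (\<tau> r1))"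
      using c by (simp add: base_def m_assoc)
    then show "base u \<otimes>\<^bsub>G\<^esub> base v = base w \<longleftrightarrow> op_upper c0 u v w"
      using op_gains_iff(1)[OF c0(1) K0 g0, of u v w] uvw c by (simp add: c0(2) base_def)
  qed (rule bij_base)
  have upper: "upper_gain G \<phi> b" if "b \<in> pairs" for b
    using that
  proof (induction "dep b" arbitrary: b rule: less_induct)
    case less
    note b = \<open>b \<in> pairs\<close>
    show ?case
    proof (cases "par b = r1")
      case True
      \<comment> \<open>The pairs \<open>c0\<close> and \<open>b\<close> share the upper edge at
        \<open>r1\<close>; a minor containing both shows that they induce the same operation on
        it.\<close>
      obtain K H \<psi> where K: "K \<subseteq> N" "{r1, c0, b} \<subseteq> K" and g: "gains \<tau> K H \<psi>"
        using triple_gains[OF lift_\<tau> r1(1) pairs_in(1)[OF c0(1)] pairs_in(1)[OF b]] .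
      have "op_upper c0 u v w \<longleftrightarrow> op_upper b u v w"
        if "u \<in> tfiber r1" "v \<in> tfiber r1" "w \<in> tfiber r1" for u v w
        using op_gains_iff(1)[OF c0(1) K(1) _ _ g, of u v w] op_gains_iff(1)[OF b K(1) _ _ g, of u v w]
          K(2) that True c0(2) by simp
      then show ?thesis using upper0 True c0(2) unfolding upper_gain_def by simp
    next
      case False
      define a where "a = par b"
      have a: "a \<in> pairs" using False pairs pairs_in(2)[OF b] by (simp add: a_def)
      have "dep a < dep b" using dep_par[OF pairs_in(1)[OF b]] by (simp add: a_def)
      then have "upper_gain G \<phi> a" using less.hyps a by blast
      note st = upper_gain_step[OF is_group a this \<phi>b[OF a]]
      \<comment> \<open>The edge at \<open>a\<close> is the lower one of the pair \<open>a\<close>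
        and the upper one of the pair \<open>b\<close>; a minor containing both pairs identifies the
        two operations on it.\<close>
      obtain K H \<psi> where K: "K \<subseteq> N" "{par a, a, b} \<subseteq> K" and g: "gains \<tau> K H \<psi>"
        using triple_gains[OF lift_\<tau> pairs_in(2)[OF a] pairs_in(1)[OF a] pairs_in(1)[OF b]] .
      have "op_lower a u v w \<longleftrightarrow> op_upper b u v w"
        if "u \<in> tfiber a" "v \<in> tfiber a" "w \<in> tfiber a" for u v w
        using op_gains_iff(2)[OF a K(1) _ _ g, of u v w] op_gains_iff(1)[OF b K(1) _ _ g, of u v w]
          K(2) that by (simp add: a_def[symmetric])
      then show ?thesis using st(1-3) unfolding upper_gain_def by (simp add: a_def[symmetric])
    qed
  qed
  have all_bij: "bij_betw (\<phi> x) (tfiber x) (carrier G) \<and> \<phi> x (\<tau> x) = \<one>\<^bsub>G\<^esub>" if "x \<in> N" for x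
  proof (cases "x = r1")
    case True
    then show ?thesis using upper0 c0(2) by (simp add: upper_gain_def)
  next
    case False
    then have "x \<in> pairs" using that pairs by blast
    then show ?thesis using upper_gain_step(1,2)[OF is_group _ upper \<phi>b] by blast
  qed
  have "\<exists>\<chi>. bij_betw \<chi> (fiber f) (carrier G)" if "f \<in> cotree" for f
  proof -
    have "f \<in> edges \<Delta> - te ` (N - K0)" using that by (auto simp: cotree_def)
    then show ?thesis using g0 unfolding gains_def by blast
  qed
  then show ?thesis
    using all_bij upper_gain_step(4)[OF is_group _ upper \<phi>b] is_group unfolding tree_gains_def
    by (intro exI[of _ G] exI[of _ \<phi>]) blast
qed

end

section \<open>Gains on all edges\<close>

context four_minor_expansion
begin

text \<open>Provides the exchange partner of \<open>z\<close>: the next chain edge below it, the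
  other children of \<open>z\<close> being off the chain.\<close>

lemma pairs_chain_child:
  assumes "f \<in> cotree" "z \<in> chain f" "z \<noteq> lo f"
  obtains b where "b \<in> pairs" "par b = z" "b \<in> chain f" "linking f b"
    "\<And>w. w \<in> chain f \<Longrightarrow> par w = z \<Longrightarrow> w = b"
proof -
  have z: "(lo f, z) \<in> P\<^sup>*" "(z, hi f) \<in> P\<^sup>+" using assms by (auto simp: chain_def)
  then obtain b where b: "(lo f, b) \<in> P\<^sup>*" "(b, z) \<in> P" using assms(3) by (metis rtranclE)
  have par: "b \<in> N" "par b = z" using b(2) by (auto simp: P_iff)
  have bc: "b \<in> chain f" using b z by (auto simp: chain_def)
  have uniq: "w = b" if w: "w \<in> chain f" "par w = z" for w
  proof (rule ccontr)
    assume "w \<noteq> b"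
    then have "(z, b) \<in> P\<^sup>* \<or> (z, w) \<in> P\<^sup>*"
      using chain_linear[OF w(1) \<open>b \<in> chain f\<close>] step_up w(2) par(2) by metis
    moreover have "w \<in> N" using w(1) chain_sub by blast
    ultimately show False
      using dep_rtrancl[of z b] dep_rtrancl[of z w] dep_par[OF par(1)] dep_par[of w] par(2) w(2) by auto
  qed
  have "z \<in> N" using assms(2) chain_sub by blast
  then have "b \<in> pairs" "linking f b" using par assms bc by (simp_all add: pairs_def linking_def)
  then show ?thesis using that par(2) bc uniq by blast
qed

text \<open>Only one half of being a group expansion: gains that are potential differences yield
  balance. The other half will follow from unique lifting.\<close>

definition edge_gains where
  "edge_gains G \<kappa> \<longleftrightarrow> (\<forall>e\<in>edges \<Delta>. bij_betw (\<kappa> e) (fiber e) (carrier G)) \<and>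
    (\<forall>h s. h \<in> V \<rightarrow> carrier G \<and>
      (\<forall>e\<in>edges \<Delta>. s e \<in> fiber e \<and> \<kappa> e (s e) = inv\<^bsub>G\<^esub> (h (lo e)) \<otimes>\<^bsub>G\<^esub> h (hi e)) \<longrightarrow>
      (\<forall>C\<in>circles \<Delta>. s ` C \<in> balanced \<Omega>))"

text \<open>Changing \<open>h\<close> at an inner node of a chain multiplies the two adjacent gains
  by mutually inverse factors on their facing sides; this is an exchange and does not affect the
  closing edge. Flattening \<open>h\<close> to its value at \<open>hi f\<close> therefore moves the
  whole gain to the lowest chain edge, and the gains over \<open>f\<close> can be read off
  there.\<close>

lemma edge_gains_exist:
  fixes G :: "'e monoid" (structure)
  assumes "group G" and loops: "\<forall>f\<in>cotree. \<exists>\<chi>. bij_betw \<chi> (fiber f) (carrier G)"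
    and tg: "tree_gains G \<phi>"
  shows "\<exists>\<kappa>. edge_gains G \<kappa>"
proof -
  interpret group G by fact
  have inj: "\<phi> x u = \<phi> x v \<longleftrightarrow> u = v" if "x \<in> N" "u \<in> tfiber x" "v \<in> tfiber x" for x u v
    using tg that by (auto simp: tree_gains_def bij_betw_def inj_on_def)
  have bij: "\<forall>x\<in>N. bij_betw (\<phi> x) (tfiber x) (carrier G) \<and> \<phi> x (\<tau> x) = \<one>"
    using tg by (simp add: tree_gains_def)
  define lf where "lf h x = inv_into (tfiber x) (\<phi> x) (inv (h x) \<otimes> h (par x))" for h x
  have lf: "lf h x \<in> tfiber x \<and> \<phi> x (lf h x) = inv (h x) \<otimes> h (par x)"
    if "h \<in> V \<rightarrow> carrier G" "x \<in> N" for h x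
  proof -
    have "h x \<in> carrier G" "h (par x) \<in> carrier G" using that par_in[OF that(2)] by auto
    then have "inv (h x) \<otimes> h (par x) \<in> \<phi> x ` tfiber x"
      using bij that(2) by (auto simp: bij_betw_def)
    then show ?thesis unfolding lf_def by (simp add: inv_into_into f_inv_into_f)
  qed
  have lift_lf: "lift (lf h)" if "h \<in> V \<rightarrow> carrier G" for h
    using lf[OF that] by (simp add: lift_def)
  have change: "closing f (lf (h(z := g))) = closing f (lf h)"
    if f: "f \<in> cotree" "z \<in> chain f" "z \<noteq> lo f" and h: "h \<in> V \<rightarrow> carrier G" "g \<in> carrier G" for f z h g
  proof -
    obtain b where b: "b \<in> pairs" "par b = z" "b \<in> chain f" "linking f b"
      "\<And>w. w \<in> chain f \<Longrightarrow> par w = z \<Longrightarrow> w = b"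
      using pairs_chain_child[OF f] by blast
    define h' where "h' = h(z := g)"
    have h': "h' \<in> V \<rightarrow> carrier G" using h by (auto simp: h'_def)
    have N: "b \<in> N" "z \<in> N" using pairs_in[OF b(1)] b(2) by auto
    have ne: "b \<noteq> z" "par z \<noteq> z" using par_ne[OF N(1)] par_ne[OF N(2)] b(2) by auto
    note l = lf[OF h(1) N(1)] lf[OF h(1) N(2)] lf[OF h' N(1)] lf[OF h' N(2)]
    have c: "h b \<in> carrier G" "h z \<in> carrier G" "h (par z) \<in> carrier G"
      using h(1) N par_in[OF N(2)] by auto
    have eq: "\<phi> b (lf h' b) \<otimes> \<phi> z (lf h' z) = \<phi> b (lf h b) \<otimes> \<phi> z (lf h z)"
      using l ne b(2) c h(2) by (simp add: h'_def m_assoc)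
    have "exchange b (lf h' z) (lf h' b) (lf h z) (lf h b)"
      using conjunct2[OF tg[unfolded tree_gains_def], rule_format, OF b(1)] b(2) l eq by simp
    then have "closing f ((lf h)(z := lf h' z, b := lf h' b)) = closing f ((lf h)(z := lf h z, b := lf h b))"
      using exchange_indep[OF b(1) lift_lf[OF h(1)] b(4), unfolded b(2)] l by blast
    \<comment> \<open>The lifts over other children of \<open>z\<close> may change as well, but
      those edges are not on the chain.\<close>
    moreover have "lf h' w = lf h w" if "w \<in> chain f" "w \<noteq> z" "w \<noteq> b" for w
    proof -
      have "par w \<noteq> z" using b(5) that by blast
      then show ?thesis using that(2) by (simp add: lf_def h'_def)
    qed
    then have "closing f (lf h') = closing f ((lf h)(z := lf h' z, b := lf h' b))" by (intro closing_cong) auto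
    ultimately show ?thesis by (simp add: h'_def)
  qed
  have lo_only: "closing f (lf h) = closing f (\<tau>(lo f := y))"
    if f: "f \<in> cotree" "lo f \<noteq> hi f" and h: "h \<in> V \<rightarrow> carrier G"
      and y: "y \<in> tfiber (lo f)" "\<phi> (lo f) y = inv (h (lo f)) \<otimes> h (hi f)" for f h y
  proof -
    have fe: "f \<in> edges \<Delta>" using f(1) by (simp add: cotree_def)
    \<comment> \<open>Once all inner nodes carry the value at the top, every chain edge except the
      lowest has unit gain and is the edge of \<open>\<tau>\<close>.\<close>
    define mix where "mix X = (\<lambda>z. if z \<in> X then h (hi f) else h z)" for X
    have hh: "h (hi f) \<in> carrier G" using h lo_hi_in[OF fe] by blast
    have mix: "mix X \<in> V \<rightarrow> carrier G" for X using h hh by (auto simp: mix_def)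
    have "closing f (lf (mix X)) = closing f (lf h)" if "finite X" "X \<subseteq> chain f - {lo f}" for X
      using that
    proof (induction X rule: finite_induct)
      case empty
      then show ?case by (simp add: mix_def)
    next
      case (insert z X)
      have eq: "mix (insert z X) = (mix X)(z := h (hi f))" by (auto simp: mix_def)
      have "closing f (lf ((mix X)(z := h (hi f)))) = closing f (lf (mix X))"
        using insert.prems by (intro change[OF f(1) _ _ mix hh]) auto
      also have "\<dots> = closing f (lf h)" using insert.prems by (intro insert.IH) auto
      finally show ?case unfolding eq .
    qed
    moreover have "finite (chain f - {lo f})"
      using finite_subset[OF chain_sub[of f]] fin_nodes by simp
    ultimately have "closing f (lf h) = closing f (lf (mix (chain f - {lo f})))" (is "_ = closing f (lf ?m)") by simp
    moreover have "lf ?m x = (\<tau>(lo f := y)) x" if x: "x \<in> chain f" for x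
    proof -
      have xN: "x \<in> N" using x chain_sub by blast
      have parx: "?m (par x) = h (hi f)"
      proof (cases "par x = hi f")
        case True
        then show ?thesis by (simp add: mix_def)
      next
        case False
        have "(par x, hi f) \<in> P\<^sup>*" using x by (simp add: chain_def trancl_iff)
        then have "(par x, hi f) \<in> P\<^sup>+" using False by (simp add: rtrancl_eq_or_trancl)
        moreover have "(lo f, par x) \<in> P\<^sup>*"
          using x xN by (auto simp: chain_def P_iff intro: rtrancl_into_rtrancl)
        moreover have "par x \<noteq> lo f" using dep_par[OF xN] dep_rtrancl[of "lo f" x] x by (auto simp: chain_def)
        ultimately show ?thesis by (simp add: mix_def chain_def)
      qed
      note lx = lf[OF mix xN, of "chain f - {lo f}"]
      show ?thesis
      proof (cases "x = lo f")
        case True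
        have "\<phi> x (lf ?m x) = \<phi> x y" using lx parx y(2) True by (simp add: mix_def)
        moreover have "y \<in> tfiber x" using y(1) True by simp
        ultimately have "lf ?m x = y" using inj[OF xN conjunct1[OF lx]] by blast
        then show ?thesis using True by simp
      next
        case False
        then have "?m x = h (hi f)" using x by (simp add: mix_def)
        then have "\<phi> x (lf ?m x) = \<one>" using conjunct2[OF lx] parx hh by simp
        moreover have "\<phi> x (\<tau> x) = \<one>" using bij xN by blast
        ultimately have "lf ?m x = \<tau> x" using inj[OF xN conjunct1[OF lx] \<tau>_fiber[OF xN]] by simp
        then show ?thesis using False by simp
      qed
    qed
    ultimately show ?thesis using closing_cong[of f "lf ?m" "\<tau>(lo f := y)"] by simp
  qed
  have "\<exists>\<kappa>. bij_betw \<kappa> (fiber e) (carrier G) \<and> (e \<in> te ` N \<longrightarrow> \<kappa> = \<phi> (lo e)) \<and>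
      (e \<in> cotree \<longrightarrow> (\<forall>h \<in> V \<rightarrow> carrier G. \<kappa> (closing e (lf h)) = inv (h (lo e)) \<otimes> h (hi e)))"
    if e: "e \<in> edges \<Delta>" for e
  proof (cases "e \<in> te ` N")
    case True
    then obtain x where "x \<in> N" "e = te x" by blast
    then have "bij_betw (\<phi> (lo e)) (fiber e) (carrier G)" using bij lo_te[of x] by simp
    then show ?thesis using True by (auto simp: cotree_def)
  next
    case False
    then have ec: "e \<in> cotree" using e by (simp add: cotree_def)
    show ?thesis
    proof (cases "lo e = hi e")
      case True
      obtain \<chi> where \<chi>: "bij_betw \<chi> (fiber e) (carrier G)" using loops ec by blast
      \<comment> \<open>The chain of a loop is empty, so \<open>q\<close> is the balanced loop of
        the fiber. Any bijection onto the group serves after a translation that sends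
        \<open>q\<close> to the unit.\<close>
      define q where "q = closing e \<tau>"
      have "q \<in> fiber e" using closing_fiber[OF ec lift_\<tau>] by (simp add: q_def)
      then have \<chi>q: "\<chi> q \<in> carrier G" using bij_betwE[OF \<chi>] by blast
      have "bij_betw (\<lambda>g. inv (\<chi> q) \<otimes> g) (carrier G) (carrier G)"
        by (rule bij_betwI[where g = "\<lambda>g. \<chi> q \<otimes> g"]) (use \<chi>q in auto)
      from bij_betw_trans[OF \<chi> this]
      have "bij_betw (\<lambda>x. inv (\<chi> q) \<otimes> \<chi> x) (fiber e) (carrier G)" by (simp add: o_def)
      moreover have "closing e (lf h) = q" for h using closing_cong[of e "lf h" \<tau>] chain_loop[OF True] by (simp add: q_def)
      moreover have "inv (h (lo e)) \<otimes> h (hi e) = \<one>" if "h \<in> V \<rightarrow> carrier G" for h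
      proof -
        have "h (hi e) \<in> carrier G" using that lo_hi_in[OF e] by blast
        then show ?thesis using True by simp
      qed
      ultimately show ?thesis using False \<chi>q by (intro exI[of _ "\<lambda>x. inv (\<chi> q) \<otimes> \<chi> x"]) simp
    next
      case ne: False
      have lo: "lo e \<in> chain e" "lo e \<in> N" using lo_in_chain[OF e ne] chain_sub by auto
      \<comment> \<open>By \<open>closing_solve\<close> the lowest chain edge and the closing edge
        determine each other, so gains can be carried from the fiber at \<open>lo e\<close> to the
        fiber of \<open>e\<close>.\<close>
      define q where "q y = closing e (\<tau>(lo e := y))" for y
      have q_bij: "bij_betw q (tfiber (lo e)) (fiber e)"
      proof (rule bij_betwI')
        show "q y \<in> fiber e" if "y \<in> tfiber (lo e)" for y
          using closing_fiber[OF ec lift_upd[OF lift_\<tau> that]] by (simp add: q_def)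
        then show "q x = q y \<longleftrightarrow> x = y" if "x \<in> tfiber (lo e)" "y \<in> tfiber (lo e)" for x y
          using closing_solve[OF ec lift_\<tau> lo(1), of "q x"] that unfolding q_def by metis
        show "\<exists>x\<in>tfiber (lo e). w = q x" if "w \<in> fiber e" for w
          using closing_solve[OF ec lift_\<tau> lo(1) that] unfolding q_def by metis
      qed
      define \<kappa> where "\<kappa> w = \<phi> (lo e) (inv_into (tfiber (lo e)) q w)" for w
      have "bij_betw \<kappa> (fiber e) (carrier G)"
        using bij_betw_trans[OF bij_betw_inv_into[OF q_bij]] bij lo(2) by (auto simp: \<kappa>_def[abs_def] o_def)
      moreover have "\<kappa> (closing e (lf h)) = inv (h (lo e)) \<otimes> h (hi e)" if h: "h \<in> V \<rightarrow> carrier G" for h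
      proof -
        have "h (lo e) \<in> carrier G" "h (hi e) \<in> carrier G" using h lo_hi_in[OF e] by auto
        then have "inv (h (lo e)) \<otimes> h (hi e) \<in> \<phi> (lo e) ` tfiber (lo e)"
          using bij lo(2) by (auto simp: bij_betw_def)
        then obtain y where y: "y \<in> tfiber (lo e)" "\<phi> (lo e) y = inv (h (lo e)) \<otimes> h (hi e)"
          by (metis imageE)
        then have "closing e (lf h) = q y" using lo_only[OF ec ne h] by (simp add: q_def)
        then show ?thesis using bij_betw_inv_into_left[OF q_bij y(1)] y(2) by (simp add: \<kappa>_def)
      qed
      ultimately show ?thesis using False by blast
    qed
  qed
  then obtain \<kappa> where \<kappa>: "\<And>e. e \<in> edges \<Delta> \<Longrightarrow> bij_betw (\<kappa> e) (fiber e) (carrier G) \<and> (e \<in> te ` N \<longrightarrow> \<kappa> e = \<phi> (lo e)) \<and>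
      (e \<in> cotree \<longrightarrow> (\<forall>h \<in> V \<rightarrow> carrier G. \<kappa> e (closing e (lf h)) = inv (h (lo e)) \<otimes> h (hi e)))"
    by metis
  have "s ` C \<in> balanced \<Omega>"
    if h: "h \<in> V \<rightarrow> carrier G"
      and s: "\<And>e. e \<in> edges \<Delta> \<Longrightarrow> s e \<in> fiber e \<and> \<kappa> e (s e) = inv (h (lo e)) \<otimes> h (hi e)"
      and C: "C \<in> circles \<Delta>" for h s C
  proof (rule section_balanced[OF _ _ C])
    show "s e \<in> fiber e" if "e \<in> edges \<Delta>" for e using s[OF that] by blast
    fix f assume f: "f \<in> cotree"
    have "s (te x) = lf h x" if "x \<in> N" for x
    proof -
      have "\<phi> x (s (te x)) = \<phi> x (lf h x)"
        using s[OF te_in[OF that]] \<kappa>[OF te_in[OF that]] that lo_te[OF that] hi_te[OF that] lf[OF h that] by auto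
      then show ?thesis using inj[OF that] s[OF te_in[OF that]] lf[OF h that] by blast
    qed
    then have img: "(s \<circ> te) ` chain f = lf h ` chain f"
      using chain_sub[of f] by (intro image_cong) auto
    have fe: "f \<in> edges \<Delta>" using f by (simp add: cotree_def)
    have "\<kappa> f (closing f (lf h)) = \<kappa> f (s f)" using \<kappa>[OF fe] f h s[OF fe] by simp
    then have "closing f (lf h) = s f"
      using \<kappa>[OF fe] closing_fiber[OF f lift_lf[OF h]] s[OF fe] by (auto simp: bij_betw_def inj_on_def)
    then show "insert (s f) ((s \<circ> te) ` chain f) \<in> balanced \<Omega>"
      using closing_balanced[OF f lift_lf[OF h]] img by simp
  qed
  then show ?thesis using \<kappa> unfolding edge_gains_def by (intro exI[of _ \<kappa>]) blast
qed

text \<open>Oriented by \<open>lo\<close>, each edge has its upward gain. Gain one implies balance,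
  through a potential built from partial products. Conversely, among the last edges that complete a
  traversal exactly one gives gain one and exactly one gives balance, so these coincide. Circles
  with repeated projections are treated apart.\<close>

lemma group_expansion_of_edge_gains:
  fixes G :: "'e monoid" (structure)
  assumes G: "group G" and eg: "edge_gains G \<kappa>"
  shows "group_expansion \<Omega> \<Delta> p"
proof -
  interpret group G by fact
  let ?G = "gain_expansion G \<Delta> lo"
  let ?gp = "gain_product G lo"
  note \<kappa> = conjunct1[OF eg[unfolded edge_gains_def]] and sec = conjunct2[OF eg[unfolded edge_gains_def]]
  define \<theta> where "\<theta> x = (\<kappa> (p x) x, p x)" for x
  define \<gamma> where "\<gamma> v x = (if v = lo (p x) then \<kappa> (p x) x else inv (\<kappa> (p x) x))" for v x
  have x_fiber: "x \<in> fiber (p x)" if "x \<in> edges \<Omega>" for x using that by (simp add: fiber_def)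
  have \<kappa>_in: "\<kappa> (p x) x \<in> carrier G" if "x \<in> edges \<Omega>" for x
    using bij_betwE[OF bspec[OF \<kappa> p_in[OF that]]] x_fiber[OF that] by blast
  have \<gamma>_in: "\<gamma> v x \<in> carrier G" if "x \<in> edges \<Omega>" for v x
    using \<kappa>_in[OF that] by (simp add: \<gamma>_def)
  have \<kappa>_inj: "x = y" if "x \<in> edges \<Omega>" "y \<in> edges \<Omega>" "p x = p y" "\<kappa> (p x) x = \<kappa> (p x) y" for x y
  proof -
    have "inj_on (\<kappa> (p x)) (fiber (p x))" using \<kappa> p_in[OF that(1)] by (simp add: bij_betw_def)
    moreover have "y \<in> fiber (p x)" using that by (simp add: fiber_def)
    ultimately show ?thesis using x_fiber[OF that(1)] that(4) by (simp add: inj_on_def)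
  qed
  have \<theta>_bij: "bij_betw \<theta> (edges \<Omega>) (carrier G \<times> edges \<Delta>)"
  proof (rule bij_betwI')
    show "\<theta> x = \<theta> y \<longleftrightarrow> x = y" if "x \<in> edges \<Omega>" "y \<in> edges \<Omega>" for x y
      using \<kappa>_inj[OF that] by (auto simp: \<theta>_def)
    show "\<theta> x \<in> carrier G \<times> edges \<Delta>" if "x \<in> edges \<Omega>" for x
      using \<kappa>_in[OF that] p_in[OF that] by (simp add: \<theta>_def)
    fix q assume "q \<in> carrier G \<times> edges \<Delta>"
    then obtain g e where q: "q = (g, e)" "g \<in> carrier G" "e \<in> edges \<Delta>" by auto
    then have "g \<in> \<kappa> e ` fiber e" using \<kappa> by (simp add: bij_betw_def)
    then obtain x where "x \<in> fiber e" "\<kappa> e x = g" by (metis imageE)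
    then show "\<exists>x\<in>edges \<Omega>. q = \<theta> x" using q by (auto simp: \<theta>_def fiber_def)
  qed
  have gain_one_balanced: "set xs \<in> balanced \<Omega>"
    if c: "circle_traversal \<Omega> vs xs" and inj: "distinct (map p xs)"
      and one: "?gp vs (map \<theta> xs) = \<one>" for vs xs
  proof -
    define l where "l = length xs"
    have len: "length vs = l" and dist: "distinct vs" and "xs \<noteq> []" and xs: "set xs \<subseteq> edges \<Omega>"
      and vs: "set vs \<subseteq> nodes \<Omega>"
      and e: "\<And>i. i < l \<Longrightarrow> ends \<Omega> (xs ! i) = {vs ! i, vs ! (Suc i mod l)}"
      using c by (auto simp: circle_traversal_def l_def)
    have l: "0 < l" using \<open>xs \<noteq> []\<close> by (simp add: l_def)
    have xi: "xs ! i \<in> edges \<Omega>" if "i < l" for i using xs that by (auto simp: l_def)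
    \<comment> \<open>Partial products along the traversal. They close up because the total gain is
      one, and so they define a potential on the nodes of the circle.\<close>
    define g where "g = rec_nat \<one> (\<lambda>i a. a \<otimes> \<gamma> (vs ! i) (xs ! i))"
    have g0: "g 0 = \<one>" and gS: "g (Suc i) = g i \<otimes> \<gamma> (vs ! i) (xs ! i)" for i
      by (simp_all add: g_def)
    have gc: "g i \<in> carrier G" if "i \<le> l" for i
      using that by (induction i) (simp_all add: g0 gS \<gamma>_in xi)
    have step: "\<gamma> (vs ! i) (xs ! i) = inv (g i) \<otimes> g (Suc i)" if "i < l" for i
      using gc[of i] \<gamma>_in[OF xi[OF that]] that by (simp add: gS)
    have "?gp vs (map \<theta> xs) = inv (g 0) \<otimes> g (length (map \<theta> xs))"
    proof (rule gain_product_telescope[OF G])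
      show "length vs = length (map \<theta> xs)" using len by (simp add: l_def)
      show "g i \<in> carrier G" if "i \<le> length (map \<theta> xs)" for i using gc that by (simp add: l_def)
      fix i assume "i < length (map \<theta> xs)"
      then have i: "i < l" by (simp add: l_def)
      then have "map \<theta> xs ! i = (\<kappa> (p (xs ! i)) (xs ! i), p (xs ! i))" by (simp add: l_def \<theta>_def)
      then show "(if vs ! i = lo (snd (map \<theta> xs ! i)) then fst (map \<theta> xs ! i)
          else inv fst (map \<theta> xs ! i)) = inv g i \<otimes> g (Suc i)"
        using step[OF i] by (simp only: \<gamma>_def fst_conv snd_conv)
    qed
    then have gl: "g l = \<one>" using one gc[of l] by (simp add: g0 l_def[symmetric])
    \<comment> \<open>The value off the circle is arbitrary; the unit keeps \<open>h\<close> inside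
      the group.\<close>
    define h where "h v = (if v \<in> set vs then g (THE i. i < l \<and> vs ! i = v) else \<one>)" for v
    have hi': "h (vs ! i) = g i" if "i < l" for i
    proof -
      have "(THE j. j < l \<and> vs ! j = vs ! i) = i"
        using that dist len by (intro the_equality) (auto simp: nth_eq_iff_index_eq)
      then show ?thesis using that len by (simp add: h_def)
    qed
    have hc: "h v \<in> carrier G" for v
    proof (cases "v \<in> set vs")
      case True
      then obtain i where "i < l" "vs ! i = v" using len by (auto simp: in_set_conv_nth)
      then show ?thesis using hi'[of i] gc[of i] by simp
    qed (simp add: h_def)
    have step': "\<gamma> (vs ! i) (xs ! i) = inv (h (vs ! i)) \<otimes> h (vs ! (Suc i mod l))" if "i < l" for i
    proof (cases "Suc i = l")
      case True
      then have "g (Suc i) = h (vs ! (Suc i mod l))" using gl hi'[of 0] l g0 by simp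
      then show ?thesis using step[OF that] hi'[OF that] by simp
    next
      case False
      then show ?thesis using step[OF that] hi'[OF that] hi'[of "Suc i"] that by simp
    qed
    have \<kappa>x: "\<kappa> (p x) x = inv (h (lo (p x))) \<otimes> h (hi (p x))" if x: "x \<in> set xs" for x
    proof -
      obtain i where i: "i < l" "xs ! i = x" using x by (auto simp: in_set_conv_nth l_def)
      have xE: "x \<in> edges \<Omega>" using x xs by blast
      have ee: "{lo (p x), hi (p x)} = {vs ! i, vs ! (Suc i mod l)}"
        using e[OF i(1)] i(2) ends_p[OF xE] lo_hi(1)[OF p_in[OF xE]] by simp
      show ?thesis
      proof (cases "vs ! i = lo (p x)")
        case True
        then have "vs ! (Suc i mod l) = hi (p x)" using ee by (auto simp: doubleton_eq_iff)
        then show ?thesis using step'[OF i(1)] i(2) True by (simp add: \<gamma>_def)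
      next
        case False
        then have v: "vs ! i = hi (p x)" "vs ! (Suc i mod l) = lo (p x)" using ee by (auto simp: doubleton_eq_iff)
        have "inv (\<kappa> (p x) x) = inv (h (hi (p x))) \<otimes> h (lo (p x))"
          using step'[OF i(1)] i(2) False v by (simp add: \<gamma>_def)
        then have "inv (inv (\<kappa> (p x) x)) = inv (inv (h (hi (p x))) \<otimes> h (lo (p x)))" by simp
        then show ?thesis using hc \<kappa>_in[OF xE] by (simp add: inv_mult_group)
      qed
    qed
    have "\<exists>x. x \<in> fiber e \<and> \<kappa> e x = inv (h (lo e)) \<otimes> h (hi e)" if "e \<in> edges \<Delta>" for e
    proof -
      have "inv (h (lo e)) \<otimes> h (hi e) \<in> \<kappa> e ` fiber e" using \<kappa> that hc by (simp add: bij_betw_def)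
      then show ?thesis by (metis imageE)
    qed
    then obtain s where s: "\<And>e. e \<in> edges \<Delta> \<Longrightarrow> s e \<in> fiber e \<and> \<kappa> e (s e) = inv (h (lo e)) \<otimes> h (hi e)"
      by metis
    \<comment> \<open>The circle is part of the section \<open>s\<close>, because an edge is
      determined by its projection and its gain.\<close>
    have "s (p x) = x" if "x \<in> set xs" for x
    proof -
      have xE: "x \<in> edges \<Omega>" using that xs by blast
      have "s (p x) \<in> edges \<Omega>" "p (s (p x)) = p x" using s[OF p_in[OF xE]] by (auto simp: fiber_def)
      moreover have "\<kappa> (p x) (s (p x)) = \<kappa> (p x) x" using s[OF p_in[OF xE]] \<kappa>x[OF that] by simp
      ultimately show ?thesis using \<kappa>_inj[of "s (p x)" x] xE by simp
    qed
    then have img: "s ` set (map p xs) = set xs" by (simp add: image_image)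
    have "s ` set (map p xs) \<in> balanced \<Omega>"
      using sec hc s project_traversal[OF c inj] by blast
    then show ?thesis unfolding img .
  qed
  have \<gamma>_surj: "\<exists>w\<in>fiber e. \<gamma> v w = a" if "e \<in> edges \<Delta>" "a \<in> carrier G" for e v a
  proof -
    have "(if v = lo e then a else inv a) \<in> \<kappa> e ` fiber e" using \<kappa> that by (simp add: bij_betw_def)
    then obtain w where "w \<in> fiber e" "\<kappa> e w = (if v = lo e then a else inv a)" by (metis imageE)
    then show ?thesis using that by (auto simp: \<gamma>_def fiber_def)
  qed
  have gain_Cons: "?gp (v # vs) (map \<theta> (x # xs)) = \<gamma> v x \<otimes> ?gp vs (map \<theta> xs)"
    for v vs x xs by (simp add: gain_product_def \<gamma>_def \<theta>_def)
  have gain_in: "?gp vs (map \<theta> xs) \<in> carrier G" if "set xs \<subseteq> edges \<Omega>" for vs xs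
    using that
  proof (induction xs arbitrary: vs)
    case (Cons x xs)
    then show ?case
      by (cases vs) (auto simp: gain_Cons \<gamma>_in simp del: list.map, simp add: gain_product_def)
  qed (simp add: gain_product_def)
  have gain_snoc: "?gp (vs @ [v]) (map \<theta> (xs @ [x])) = ?gp vs (map \<theta> xs) \<otimes> \<gamma> v x"
    if "length vs = length xs" "set xs \<subseteq> edges \<Omega>" "x \<in> edges \<Omega>" for vs v xs x
    using that
  proof (induction vs xs rule: list_induct2)
    case Nil
    then show ?case using gain_Cons[of v "[]" x "[]"] \<gamma>_in by (simp add: gain_product_def)
  next
    case (Cons v' vs x' xs)
    then show ?case
      using gain_Cons[of v' "vs @ [v]" x' "xs @ [x]"] gain_Cons[of v' vs x' xs] gain_in[of xs vs]
      by (simp add: m_assoc \<gamma>_in)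
  qed
  have balanced_iff: "set xs \<in> balanced \<Omega> \<longleftrightarrow> ?gp vs (map \<theta> xs) = \<one>"
    if c: "circle_traversal \<Omega> vs xs" for vs xs
  proof -
    define l where "l = length xs"
    have len: "length vs = l" and dist: "distinct vs" "distinct xs" and "xs \<noteq> []" and xs: "set xs \<subseteq> edges \<Omega>"
      and vs: "set vs \<subseteq> nodes \<Omega>"
      and e: "\<And>i. i < l \<Longrightarrow> ends \<Omega> (xs ! i) = {vs ! i, vs ! (Suc i mod l)}"
      using c by (auto simp: circle_traversal_def l_def)
    show ?thesis
    proof (cases "distinct (map p xs)")
      case True
      obtain us v where vs_snoc: "vs = us @ [v]" using len \<open>xs \<noteq> []\<close> by (cases vs rule: rev_cases) (auto simp: l_def)
      obtain ys x where xs_snoc: "xs = ys @ [x]" using \<open>xs \<noteq> []\<close> by (cases xs rule: rev_cases) auto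
      have len': "length us = length ys" using len by (simp add: vs_snoc xs_snoc l_def)
      have ys: "set ys \<subseteq> edges \<Omega>" and x: "x \<in> edges \<Omega>" using xs by (auto simp: xs_snoc)
      let ?a = "?gp us (map \<theta> ys)"
      have a: "?a \<in> carrier G" using gain_in[OF ys] .
      \<comment> \<open>\<open>w\<close> replaces the last edge so that the gain becomes one; by
        unique lifting it is also the only last edge over \<open>p x\<close> that gives a balanced
        circle.\<close>
      obtain w where w: "w \<in> fiber (p x)" "\<gamma> v w = inv ?a"
        using \<gamma>_surj[OF p_in[OF x], of "inv ?a" v] a by auto
      have wE: "w \<in> edges \<Omega>" "p w = p x" using w(1) by (auto simp: fiber_def)
      have mp: "map p (ys @ [w]) = map p xs" using wE by (simp add: xs_snoc)
      have cw: "circle_traversal \<Omega> vs (ys @ [w])"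
      proof -
        have "ends \<Omega> ((ys @ [w]) ! i) = ends \<Omega> (xs ! i)" if "i < l" for i
          using that ends_p[OF wE(1)] ends_p[OF x] wE(2) by (auto simp: xs_snoc nth_append l_def)
        moreover have "distinct (ys @ [w])" using True mp by (metis distinct_map)
        ultimately show ?thesis
          using c ys wE e by (simp add: circle_traversal_def l_def xs_snoc)
      qed
      have "?gp vs (map \<theta> (ys @ [w])) = \<one>"
        using gain_snoc[OF len' ys wE(1), of v] w(2) a by (simp add: vs_snoc)
      then have bal_w: "insert w (set ys) \<in> balanced \<Omega>"
        using gain_one_balanced[OF cw True[folded mp]] by simp
      have "bij_betw p (set ys) (set (map p xs) - {p x})"
        using True by (auto simp: xs_snoc bij_betw_def distinct_map)
      then have "\<exists>!y. y \<in> edges \<Omega> \<and> p y = p x \<and> insert y (set ys) \<in> balanced \<Omega>"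
        using circle_lifting_unique[OF exp project_traversal[OF c True], of "p x" "set ys"] ys by (simp add: xs_snoc)
      then have iff: "insert x (set ys) \<in> balanced \<Omega> \<longleftrightarrow> x = w" using bal_w wE x by blast
      have "?gp vs (map \<theta> xs) = ?a \<otimes> \<gamma> v x"
        using gain_snoc[OF len' ys x, of v] by (simp add: vs_snoc xs_snoc)
      moreover have "?a \<otimes> \<gamma> v x = \<one> \<longleftrightarrow> x = w"
      proof
        assume "?a \<otimes> \<gamma> v x = \<one>"
        then have "?a \<otimes> \<gamma> v x = ?a \<otimes> \<gamma> v w" using w(2) a by simp
        then have "\<gamma> v x = \<gamma> v w" using a \<gamma>_in[OF x] \<gamma>_in[OF wE(1)] by simp
        then have "\<kappa> (p x) x = \<kappa> (p x) w"
          using wE(2) \<kappa>_in[OF x] \<kappa>_in[OF wE(1)] inv_inj by (auto simp: \<gamma>_def inj_on_def split: if_splits)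
        then show "x = w" using \<kappa>_inj[OF x wE(1)] wE(2) by simp
      qed (use w a in simp)
      ultimately show ?thesis using iff by (simp add: xs_snoc)
    next
      case False
      \<comment> \<open>Edges with the same projection have the same ends, so the circle is a digon
        inside a fiber. An expansion has no such balanced digon, and gain one would give the two
        edges the same upward gain and make them equal.\<close>
      then obtain i j where ij: "i < j" "j < l" "p (xs ! i) = p (xs ! j)"
        by (auto simp: distinct_conv_nth l_def) (metis linorder_neqE_nat)
      have xij: "xs ! i \<in> edges \<Omega>" "xs ! j \<in> edges \<Omega>" using xs ij by (auto simp: l_def)
      have "{vs ! i, vs ! (Suc i mod l)} = {vs ! j, vs ! (Suc j mod l)}"
        using e[of i] e[of j] ij ends_p[OF xij(1)] ends_p[OF xij(2)] by simp
      moreover have "vs ! i \<noteq> vs ! j" using ij dist(1) len by (simp add: nth_eq_iff_index_eq)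
      ultimately have "vs ! i = vs ! (Suc j mod l)" "vs ! j = vs ! (Suc i mod l)" by (auto simp: doubleton_eq_iff)
      moreover have "Suc i mod l < l" "Suc j mod l < l" using ij by auto
      ultimately have "i = Suc j mod l" "j = Suc i mod l"
        using ij dist(1) len by (simp_all add: nth_eq_iff_index_eq)
      then have "i = 0" "j = 1" "l = 2" using ij by (auto simp: mod_Suc split: if_splits)
      then obtain x y v u where xy: "xs = [x, y]" "vs = [v, u]"
        using len unfolding l_def by (auto simp: length_Suc_conv numeral_2_eq_2)
      have pxy: "p x = p y" "x \<in> edges \<Omega>" "y \<in> edges \<Omega>" "x \<noteq> y"
        using ij \<open>i = 0\<close> \<open>j = 1\<close> xy xs dist(2) by auto
      have "set xs \<notin> balanced \<Omega>" using exp pxy xy by (auto simp: biased_expansion_def)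
      moreover have "?gp vs (map \<theta> xs) \<noteq> \<one>"
      proof
        assume "?gp vs (map \<theta> xs) = \<one>"
        then have one: "\<gamma> v x \<otimes> \<gamma> u y = \<one>"
          using gain_Cons[of v "[u]" x "[y]"] gain_Cons[of u "[]" y "[]"] \<gamma>_in[OF pxy(3)] xy
          by (simp add: gain_product_def)
        have "v \<noteq> u" using dist(1) xy by simp
        moreover have "{v, u} = {lo (p x), hi (p x)}"
          using e[of 0] xy \<open>l = 2\<close> ends_p[OF pxy(2)] lo_hi(1)[OF p_in[OF pxy(2)]] by simp
        ultimately consider "v = lo (p x)" "u \<noteq> lo (p x)" | "u = lo (p x)" "v \<noteq> lo (p x)"
          by (auto simp: doubleton_eq_iff)
        then have "\<kappa> (p x) x = \<kappa> (p x) y"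
          using one pxy(1) \<kappa>_in[OF pxy(2)] \<kappa>_in[OF pxy(3)]
          by cases (simp_all add: \<gamma>_def, metis inv_closed inv_equality inv_inv, metis inv_closed inv_equality inv_inv l_inv)
        then show False using \<kappa>_inj[OF pxy(2,3,1)] pxy(4) by blast
      qed
      ultimately show ?thesis by blast
    qed
  qed
  have \<theta>_ends: "ends ?G (\<theta> x) = ends \<Omega> x" if "x \<in> edges \<Omega>" for x
    using ends_p[OF that] by (simp add: \<theta>_def)
  have \<theta>_inj: "inj_on \<theta> (edges \<Omega>)" and \<theta>_img: "\<theta> ` edges \<Omega> = edges ?G"
    using \<theta>_bij by (auto simp: bij_betw_def)
  have "C \<in> balanced \<Omega> \<longleftrightarrow> \<theta> ` C \<in> balanced ?G" if C: "C \<in> circles \<Omega>" for C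
  proof
    assume "C \<in> balanced \<Omega>"
    moreover obtain vs xs where c: "circle_traversal \<Omega> vs xs" "set xs = C" using C by (auto simp: circles_def)
    ultimately have "?gp vs (map \<theta> xs) = \<one>" using balanced_iff by blast
    moreover have "circle_traversal ?G vs (map \<theta> xs)"
      by (rule traversal_map[OF _ \<theta>_inj _ \<theta>_ends c(1)]) (simp_all add: nodes_eq \<theta>_img del: gain_expansion_simps(2))
    ultimately have "set (map \<theta> xs) \<in> balanced ?G" unfolding balanced_gain_expansion by blast
    then show "\<theta> ` C \<in> balanced ?G" using c(2) by simp
  next
    assume "\<theta> ` C \<in> balanced ?G"
    then obtain vs ys where ys: "circle_traversal ?G vs ys" "?gp vs ys = \<one>" "set ys = \<theta> ` C"
      unfolding balanced_gain_expansion by auto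
    let ?\<iota> = "inv_into (edges \<Omega>) \<theta>"
    have "set ys \<subseteq> edges ?G" using ys(1) by (simp add: circle_traversal_def)
    have CE: "C \<subseteq> edges \<Omega>" using C by (auto simp: circles_def circle_traversal_def)
    have "circle_traversal \<Omega> vs (map ?\<iota> ys)"
    proof (rule traversal_map[OF _ _ _ _ ys(1)])
      show "nodes ?G = nodes \<Omega>" by (simp add: nodes_eq)
      show "inj_on ?\<iota> (edges ?G)" unfolding \<theta>_img[symmetric] by (rule inj_on_inv_into) simp
      show "?\<iota> ` edges ?G \<subseteq> edges \<Omega>" unfolding \<theta>_img[symmetric] by (auto simp: inv_into_into)
      show "ends \<Omega> (?\<iota> q) = ends ?G q" if "q \<in> edges ?G" for q
        using \<theta>_ends[of "?\<iota> q"] that unfolding \<theta>_img[symmetric]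
        by (simp add: inv_into_into f_inv_into_f del: gain_expansion_simps)
    qed
    moreover have "map \<theta> (map ?\<iota> ys) = ys"
    proof -
      have "\<theta> (?\<iota> q) = q" if "q \<in> set ys" for q
        using that \<open>set ys \<subseteq> edges ?G\<close> unfolding \<theta>_img[symmetric] by (auto simp: f_inv_into_f)
      then show ?thesis by (simp add: map_idI)
    qed
    moreover have "set (map ?\<iota> ys) = C"
      using ys(3) CE inv_into_image_cancel[OF \<theta>_inj CE] by simp
    ultimately show "C \<in> balanced \<Omega>" using balanced_iff[of vs "map ?\<iota> ys"] ys(2) by metis
  qed
  then have "expansion_iso \<theta> \<Omega> p ?G snd"
    using \<theta>_bij \<theta>_ends nodes_eq by (simp add: expansion_iso_def) (simp add: \<theta>_def)
  moreover have "orientation \<Delta> lo" using lo_hi(1) by (auto simp: orientation_def)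
  ultimately show ?thesis unfolding group_expansion_def using exp G by blast
qed

lemma is_group_expansion: "group_expansion \<Omega> \<Delta> p"
  using tree_gains_exist edge_gains_exist group_expansion_of_edge_gains by metis

end

theorem theorem7p2:
  fixes \<Omega> :: "('v, 'e) biased_graph" and \<Delta> :: "('v, 'f) multigraph" and p :: "'e \<Rightarrow> 'f"
  assumes "biased_expansion \<Omega> \<Delta> p"
    and "finite (nodes \<Delta>)" and "finite (edges \<Delta>)"
    and "two_connected \<Delta>"
    and "card (nodes \<Delta>) \<ge> 4"
    and "\<And>\<Omega>' \<Delta>'. expansion_minor \<Omega> \<Delta> p \<Omega>' \<Delta>' \<Longrightarrow> card (nodes \<Omega>') = 4 \<Longrightarrow>
           group_expansion \<Omega>' \<Delta>' p"
  shows "group_expansion \<Omega> \<Delta> p"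
proof -
  let ?E = "adjacent_via \<Delta> (edges \<Delta>)"
  have wf: "wf_multigraph \<Delta>" using assms(1) by (simp add: biased_expansion_def)
  have conn: "connected_graph \<Delta>" using assms(4) by (simp add: two_connected_def)
  then obtain r where r: "r \<in> nodes \<Delta>" by (auto simp: connected_graph_def)
  have E_sub: "?E \<inter> nodes \<Delta> \<times> nodes \<Delta> = ?E"
    using wf by (auto simp: adjacent_via_def wf_multigraph_def doubleton_eq_iff)
  have "(r, x) \<in> (?E \<inter> nodes \<Delta> \<times> nodes \<Delta>)\<^sup>*" if "x \<in> nodes \<Delta>" for x
    unfolding E_sub using conn r that by (simp add: connected_graph_def)
  from normal_tree_exists[OF assms(2) r sym_adjacent_via this, unfolded normal_tree_def] obtain par dep where
    tree: "rooted_tree (nodes \<Delta>) r par dep" and par_edge: "\<forall>x\<in>nodes \<Delta> - {r}. (x, par x) \<in> ?E"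
    and norm: "\<forall>x\<in>nodes \<Delta>. \<forall>y\<in>nodes \<Delta>. (x, y) \<in> ?E \<longrightarrow>
      (x, y) \<in> (parent_rel (nodes \<Delta>) r par)\<^sup>* \<or> (y, x) \<in> (parent_rel (nodes \<Delta>) r par)\<^sup>*"
    by blast
  interpret rooted_tree "nodes \<Delta>" r par dep by fact
  have normal: "(x, y) \<in> P\<^sup>* \<or> (y, x) \<in> P\<^sup>*" if "(x, y) \<in> ?E" for x y
    using that norm E_sub by blast
  have bypass: "\<exists>f\<in>edges \<Delta>. \<exists>u v. ends \<Delta> f = {u, v} \<and> (v, b) \<in> P\<^sup>* \<and> (par b, u) \<in> P\<^sup>+"
    if "b \<in> nodes \<Delta> - {r}" "z \<in> nodes \<Delta>" "(z, b) \<notin> P\<^sup>*" "z \<noteq> par b" for b z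
    by (rule two_connected_bypass[OF refl assms(4) _ that]) (rule normal)
  have "\<forall>x\<in>nodes \<Delta> - {r}. \<exists>e\<in>edges \<Delta>. ends \<Delta> e = {x, par x}"
    using par_edge by (auto simp: adjacent_via_def)
  then obtain te where te: "\<And>x. x \<in> nodes \<Delta> - {r} \<Longrightarrow> te x \<in> edges \<Delta> \<and> ends \<Delta> (te x) = {x, par x}"
    by metis
  interpret tree_expansion \<Delta> r par dep te \<Omega> p
  proof unfold_locales
    show "(x, y) \<in> P\<^sup>* \<or> (y, x) \<in> P\<^sup>*" if "f \<in> edges \<Delta>" "ends \<Delta> f = {x, y}" for f x y
      using that by (intro normal) (auto simp: adjacent_via_def)
  qed (use te wf assms in auto)
  interpret four_minor_expansion \<Delta> r par dep te \<Omega> p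
  proof unfold_locales
    fix b assume b: "b \<in> N" "par b \<in> N"
    \<comment> \<open>The root lies outside the subtree of \<open>b\<close> and differs from
      \<open>par b\<close>, so it can play the role of \<open>z\<close>.\<close>
    have "(r, b) \<notin> P\<^sup>*" using root_top[of b] b by auto
    then obtain f u v where f: "f \<in> edges \<Delta>" "ends \<Delta> f = {u, v}" "(v, b) \<in> P\<^sup>*" "(par b, u) \<in> P\<^sup>+"
      using bypass[where b = b and z = r] b r by blast
    have bp: "(b, par b) \<in> P" using b(1) by (simp add: P_iff)
    have bu: "(b, u) \<in> P\<^sup>+" using bp f(4) by (rule trancl_into_trancl2)
    then have vu: "(v, u) \<in> P\<^sup>*" using f(3) by (meson rtrancl_trans trancl_into_rtrancl)
    have lohi: "lo f = v" "hi f = u" using lo_hi_unique[OF f(1) _ vu] f(2) by (auto simp: insert_commute)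
    have "b \<in> chain f" "par b \<in> chain f"
      using f(3,4) bu bp by (auto simp: chain_def lohi)
    \<comment> \<open>The edge \<open>f\<close> rises by at least two levels, from \<open>b\<close>
      or below to strictly above \<open>par b\<close>, whereas a tree edge rises by one.\<close>
    moreover have "f \<notin> te ` N"
    proof
      assume "f \<in> te ` N"
      then obtain x where x: "x \<in> N" "f = te x" by blast
      then have "dep v = Suc (dep u)" using dep_par[OF x(1)] lo_te[OF x(1)] hi_te[OF x(1)] lohi by simp
      then show False
        using dep_rtrancl[OF f(3)] dep_par[OF b(1)] dep_trancl[OF f(4)] by simp
    qed
    ultimately show "\<exists>f\<in>cotree. b \<in> chain f \<and> par b \<in> chain f" using f(1) by (auto simp: cotree_def)
  next
    fix x y assume xy: "x \<in> N" "y \<in> N" "par x = r" "par y = r"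
    show "x = y"
    proof (rule ccontr)
      assume "x \<noteq> y"
      \<comment> \<open>Outside the subtree of \<open>x\<close>, the second child \<open>y\<close>
        would yield an edge that ends strictly above the root.\<close>
      then have "(y, x) \<notin> P\<^sup>*" using step_up[of y x] root_top[of x] xy by auto
      then obtain u where "(par x, u) \<in> P\<^sup>+" using bypass[where b = x and z = y] xy by blast
      then show False using xy(3) by (simp add: trancl_iff)
    qed
  qed (use assms in auto)
  show ?thesis by (rule is_group_expansion)
qed

end
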